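(* If $c(x)=\sum_{A\in\Theta^{\jmath}(n,r)}x_A[A]$ (with $x_A\in K$) belongs to the center $Z(\boldsymbol{\mathcal S}^{\jmath}(n,r))$ of the type $B$ $q$-Schur algebra, then $x_A=0$ unless $A\in\Omega^{\jmath}(n,r)$, i.e. unless $\operatorname{row}(A)=\operatorname{col}(A)$. Hence every central element has a unique expression $$c(x)=\sum_{A\in\Omega^{\jmath}(n,r)}x_A[A].$$
   Context: Let $\upsilon$ be an indeterminate, $q=\upsilon^2$, $\mathcal A=\mathbb Z[\upsilon,\upsilon^{-1}]$, $K=\mathbb Q(\upsilon)$, $\mathbb N=\{0,1,2,\dots\}$. Set $N=2n+1$, $m=n+1$, $i^*=N+1-i$ for $1\le i\le N$. Hecke algebra of type $B_r$: $(W,S)$ is the Coxeter system of type $B_r$, $S=\{s_1,\dots,s_r\}$, and $\mathcal H_{\mathcal A}(B_r)$ is the $\mathcal A$-algebra generated by $T_i=T_{s_i}$ ($1\le i\le r$) with $T_i^2=(q-1)T_i+q$, $T_iT_j=T_jT_i$ if $|i-j|>1$, $T_iT_{i+1}T_i=T_{i+1}T_iT_{i+1}$ for $1\le i<r-1$, and $T_{r-1}T_rT_{r-1}T_r=T_rT_{r-1}T_rT_{r-1}$. $q$-Schur algebra of type $B$: let $\Lambda(n+1,r)=\{\lambda\in\mathbb N^{n+1}\mid\sum_i\lambda_i=r\}$. For $\lambda\in\Lambda(n+1,r)$ let $W_\lambda$ be the parabolic subgroup generated by $S\setminus\{s_{\lambda_1+\cdots+\lambda_i}\mid1\le i\le n\}$,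 let $\widetilde x_\lambda=\sum_{w\in W_\lambda}T_w$, and let $\widetilde\lambda=(\lambda_1,\dots,\lambda_n,2\lambda_{n+1}+1,\lambda_n,\dots,\lambda_1)\in\mathbb N^N$. Put $\mathcal S^{\jmath}(n,r)=\operatorname{End}_{\mathcal H_{\mathcal A}(B_r)}\big(\bigoplus_{\lambda\in\Lambda(n+1,r)}\widetilde x_\lambda\mathcal H_{\mathcal A}(B_r)\big)$ and $\boldsymbol{\mathcal S}^{\jmath}(n,r)=K\otimes_{\mathcal A}\mathcal S^{\jmath}(n,r)$. Normalized basis: $\Theta^{\jmath}(n,r)$ is the set of $N\times N$ matrices $A=(a_{ij})$ over $\mathbb N$ with $\sum_{i,j}a_{ij}=2r+1$ and $a_{ij}=a_{i^*,j^*}$; $\operatorname{row}(A)$ and $\operatorname{col}(A)$ are the vectors of row sums and of column sums. Realize $W$ as the group of permutations of $\{1,\dots,2r+1\}$ commuting with $i\mapsto 2r+2-i$, with $s_i=(i,i+1)(2r+1-i,2r+2-i)$ for $i<r$ and $s_r=(r,r+2)$. If $\operatorname{row}(A)=\widetilde\lambda$, $\operatorname{col}(A)=\widetilde\mu$, then $A$ corresponds to the double coset $D_A=W_\lambda wW_\mu$ with $a_{ij}=|R^\lambda_i\cap wR^\mu_j|$, where $R^\lambda_1,\dots,R^\lambda_N$ are the consecutive blocks of $\{1,\dots,2r+1\}$ of sizes $\widetilde\lambda_1,\dots,\widetilde\lambda_N$. Let $e_A\in\mathcal S^{\jmath}(n,r)$ be given by $e_A(\widetilde x_\nu h)=\delta_{\nu,\mu}\sum_{w\in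 D_A}T_wh$ and put $[A]=\upsilon^{-\ell(w_A^+)+\ell(w_{0,\mu})}e_A$, where $w_A^+$ and $w_{0,\mu}$ are the longest elements of $D_A$ and of $W_\mu$. The set $\{[A]\mid A\in\Theta^{\jmath}(n,r)\}$ is a $K$-basis of $\boldsymbol{\mathcal S}^{\jmath}(n,r)$. Balanced matrices: $\Omega^{\jmath}(n,r)=\{A\in\Theta^{\jmath}(n,r)\mid\operatorname{row}(A)=\operatorname{col}(A)\}$. *)

theory Defs
  imports
    "HOL-Library.Poly_Mapping"
    "HOL-Library.FuncSet"
    "HOL-Computational_Algebra.Polynomial"
    "HOL-Computational_Algebra.Fraction_Field"
    "HOL-Algebra.QuotRing"
    "HOL-Algebra.Generated_Groups"
    "HOL-Combinatorics.Permutations"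
    "Jordan_Normal_Form.Matrix"
begin

section \<open>Coefficients\<close>

text \<open>The library makes \<open>int \<Rightarrow>\<^sub>0 int\<close>, with convolution as product, the integral group ring of
  the additive group of integers, that is \<open>\<A> = \<int>[\<upsilon>, \<upsilon>\<inverse>]\<close>; here \<open>single k 1\<close> is \<open>\<upsilon>\<^sup>k\<close>.\<close>

type_synonym laurent = "int \<Rightarrow>\<^sub>0 int"

definition ups_pow :: "int \<Rightarrow> laurent" where
  "ups_pow k = Poly_Mapping.single k 1"

definition q_laurent :: laurent where
  "q_laurent = ups_pow 2"

text \<open>The field \<open>K = \<rat>(\<upsilon>)\<close> and the inclusion of \<open>\<A>\<close> into it.\<close>

type_synonym ratfun = "rat poly fract"

definition ups_K :: ratfun where
  "ups_K = Fract [:0, 1:] 1"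

definition laurent_to_K :: "laurent \<Rightarrow> ratfun" where
  "laurent_to_K f =
     (\<Sum>k\<in>Poly_Mapping.keys f. of_int (Poly_Mapping.lookup f k) * ups_K powi k)"


section \<open>Monoid rings, centers, and extension of scalars\<close>

definition monoid_ring :: "('m, 'z) monoid_scheme \<Rightarrow> ('m \<Rightarrow>\<^sub>0 'c::comm_ring_1) ring" where
  "monoid_ring M =
     \<lparr>carrier = {f. Poly_Mapping.keys f \<subseteq> carrier M},
      mult = (\<lambda>f g. \<Sum>x\<in>Poly_Mapping.keys f. \<Sum>y\<in>Poly_Mapping.keys g.
                Poly_Mapping.single (x \<otimes>\<^bsub>M\<^esub> y) (Poly_Mapping.lookup f x * Poly_Mapping.lookup g y)),
      one = Poly_Mapping.single \<one>\<^bsub>M\<^esub> 1,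
      zero = 0,
      add = (+)\<rparr>"

definition ring_center :: "('a, 'z) ring_scheme \<Rightarrow> 'a set" where
  "ring_center R = {z \<in> carrier R. \<forall>x\<in>carrier R. z \<otimes>\<^bsub>R\<^esub> x = x \<otimes>\<^bsub>R\<^esub> z}"

text \<open>Let \<open>\<phi>\<close> be a homomorphism from a commutative ring \<open>'a\<close> to a commutative ring \<open>'k\<close>, and let
  \<open>R\<close> be an \<open>'a\<close>-algebra with scalar action \<open>act\<close>.  The tensor product of \<open>'k\<close> and \<open>R\<close> over \<open>'a\<close>
  is the free abelian group on the pairs \<open>(k, x)\<close> modulo the subgroup generated by the relations
  below.  When the free abelian group carries the product \<open>(k, x) (k', x') = (k k', x x')\<close>, this
  subgroup is already a two-sided ideal, so dividing by the ideal generated by the relations gives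
  the tensor product together with its ring structure.\<close>

definition tensor_pre :: "('b, 'z) ring_scheme \<Rightarrow> ('k::comm_ring_1 \<times> 'b \<Rightarrow>\<^sub>0 int) ring" where
  "tensor_pre R = monoid_ring (\<lparr>carrier = (UNIV :: 'k set), mult = (*), one = 1\<rparr> \<times>\<times> R)"

definition tensor_rels ::
  "('a \<Rightarrow> 'k::comm_ring_1) \<Rightarrow> ('a \<Rightarrow> 'b \<Rightarrow> 'b) \<Rightarrow> ('b, 'z) ring_scheme \<Rightarrow> ('k \<times> 'b \<Rightarrow>\<^sub>0 int) set" where
  "tensor_rels \<phi> act R =
     (let g = (\<lambda>k x. Poly_Mapping.single (k, x) 1) in
       {g (k + k') x - g k x - g k' x | k k' x. x \<in> carrier R}
     \<union> {g k (x \<oplus>\<^bsub>R\<^esub> y) - g k x - g k y | k x y. x \<in> carrier R \<and> y \<in> carrier R}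
     \<union> {g (k * \<phi> a) x - g k (act a x) | k a x. x \<in> carrier R})"

definition tensor_ideal ::
  "('a \<Rightarrow> 'k::comm_ring_1) \<Rightarrow> ('a \<Rightarrow> 'b \<Rightarrow> 'b) \<Rightarrow> ('b, 'z) ring_scheme \<Rightarrow> ('k \<times> 'b \<Rightarrow>\<^sub>0 int) set" where
  "tensor_ideal \<phi> act R = Idl\<^bsub>tensor_pre R\<^esub> (tensor_rels \<phi> act R)"

definition base_change ::
  "('a \<Rightarrow> 'k::comm_ring_1) \<Rightarrow> ('a \<Rightarrow> 'b \<Rightarrow> 'b) \<Rightarrow> ('b, 'z) ring_scheme
     \<Rightarrow> (('k \<times> 'b \<Rightarrow>\<^sub>0 int) set) ring" where
  "base_change \<phi> act R = tensor_pre R Quot tensor_ideal \<phi> act R"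

definition tensor ::
  "('a \<Rightarrow> 'k::comm_ring_1) \<Rightarrow> ('a \<Rightarrow> 'b \<Rightarrow> 'b) \<Rightarrow> ('b, 'z) ring_scheme
     \<Rightarrow> 'k \<Rightarrow> 'b \<Rightarrow> ('k \<times> 'b \<Rightarrow>\<^sub>0 int) set" where
  "tensor \<phi> act R k x =
     tensor_ideal \<phi> act R +>\<^bsub>tensor_pre R\<^esub> Poly_Mapping.single (k, x) 1"


section \<open>The Coxeter group of type B\<close>

definition B_group :: "nat \<Rightarrow> (nat \<Rightarrow> nat) monoid" where
  "B_group r =
     \<lparr>carrier = {w. w permutes {1..2*r+1} \<and>
                    (\<forall>i\<in>{1..2*r+1}. w (2*r+2-i) = 2*r+2 - w i)},
      mult = (\<circ>),
      one = id\<rparr>"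

definition B_refl :: "nat \<Rightarrow> nat \<Rightarrow> (nat \<Rightarrow> nat)" where
  "B_refl r i =
     (if i < r
      then Transposition.transpose i (i+1) \<circ> Transposition.transpose (2*r+1-i) (2*r+2-i)
      else Transposition.transpose r (r+2))"

definition B_word :: "nat \<Rightarrow> nat list \<Rightarrow> (nat \<Rightarrow> nat)" where
  "B_word r is = foldr (\<circ>) (map (B_refl r) is) id"

definition B_length :: "nat \<Rightarrow> (nat \<Rightarrow> nat) \<Rightarrow> nat" where
  "B_length r w = (LEAST k. \<exists>is. set is \<subseteq> {1..r} \<and> B_word r is = w \<and> length is = k)"

definition B_reduced :: "nat \<Rightarrow> (nat \<Rightarrow> nat) \<Rightarrow> nat list \<Rightarrow> bool" where
  "B_reduced r w is \<longleftrightarrow> set is \<subseteq> {1..r} \<and> B_word r is = w \<and> length is = B_length r w"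


section \<open>The Hecke algebra of type B\<close>

definition free_alg :: "nat \<Rightarrow> (nat list \<Rightarrow>\<^sub>0 laurent) ring" where
  "free_alg r = monoid_ring \<lparr>carrier = lists {1..r}, mult = (@), one = []\<rparr>"

text \<open>The last braid relation is imposed only for \<open>r \<ge> 2\<close>, as there is no generator of index 0.\<close>

definition hecke_rels :: "nat \<Rightarrow> (nat list \<Rightarrow>\<^sub>0 laurent) set" where
  "hecke_rels r =
     (let word = (\<lambda>is. Poly_Mapping.single is (1 :: laurent)) in
       {word [i, i] - (Poly_Mapping.single [i] (q_laurent - 1) + Poly_Mapping.single [] q_laurent)
          | i. 1 \<le> i \<and> i \<le> r}
     \<union> {word [i, j] - word [j, i]
          | i j. 1 \<le> i \<and> i \<le> r \<and> 1 \<le> j \<and> j \<le> r \<and> 1 < \<bar>int i - int j\<bar>}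
     \<union> {word [i, i+1, i] - word [i+1, i, i+1] | i. 1 \<le> i \<and> i + 1 < r}
     \<union> (if 2 \<le> r then {word [r-1, r, r-1, r] - word [r, r-1, r, r-1]} else {}))"

definition hecke_ideal :: "nat \<Rightarrow> (nat list \<Rightarrow>\<^sub>0 laurent) set" where
  "hecke_ideal r = Idl\<^bsub>free_alg r\<^esub> (hecke_rels r)"

type_synonym hecke_elt = "(nat list \<Rightarrow>\<^sub>0 laurent) set"

definition hecke :: "nat \<Rightarrow> hecke_elt ring" where
  "hecke r = free_alg r Quot hecke_ideal r"

definition hecke_scalar :: "nat \<Rightarrow> laurent \<Rightarrow> hecke_elt" where
  "hecke_scalar r a = hecke_ideal r +>\<^bsub>free_alg r\<^esub> Poly_Mapping.single [] a"

definition hecke_gen :: "nat \<Rightarrow> nat \<Rightarrow> hecke_elt" where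
  "hecke_gen r i = hecke_ideal r +>\<^bsub>free_alg r\<^esub> Poly_Mapping.single [i] 1"

text \<open>By the braid relations (Matsumoto) the choice of the reduced word does not matter.\<close>

definition hecke_T :: "nat \<Rightarrow> (nat \<Rightarrow> nat) \<Rightarrow> hecke_elt" where
  "hecke_T r w =
     foldr (\<otimes>\<^bsub>hecke r\<^esub>) (map (hecke_gen r) (SOME is. B_reduced r w is)) \<one>\<^bsub>hecke r\<^esub>"

definition hecke_T_sum :: "nat \<Rightarrow> (nat \<Rightarrow> nat) set \<Rightarrow> hecke_elt" where
  "hecke_T_sum r D = finsum (hecke r) (hecke_T r) D"


section \<open>The q-Schur algebra of type B\<close>

text \<open>Weights are lists, so \<open>\<lambda>\<^sub>i\<close> is \<open>lam ! (i - 1)\<close> and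
  \<open>\<lambda>\<^sub>1 + \<dots> + \<lambda>\<^sub>i\<close> is \<open>sum_list (take i lam)\<close>.\<close>

definition Lambda :: "nat \<Rightarrow> nat \<Rightarrow> nat list set" where
  "Lambda n r = {lam. length lam = n + 1 \<and> sum_list lam = r}"

definition tilde :: "nat list \<Rightarrow> nat list" where
  "tilde lam = butlast lam @ [2 * last lam + 1] @ rev (butlast lam)"

definition parabolic :: "nat \<Rightarrow> nat \<Rightarrow> nat list \<Rightarrow> (nat \<Rightarrow> nat) set" where
  "parabolic n r lam =
     generate (B_group r) (B_refl r ` ({1..r} - {sum_list (take i lam) | i. 1 \<le> i \<and> i \<le> n}))"

definition x_tilde :: "nat \<Rightarrow> nat \<Rightarrow> nat list \<Rightarrow> hecke_elt" where
  "x_tilde n r lam = hecke_T_sum r (parabolic n r lam)"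

text \<open>The direct sum of the right ideals \<open>x\<^sub>\<lambda> \<H>\<close>: families indexed by the finite set \<open>Lambda n r\<close>.\<close>

type_synonym tspace_elt = "nat list \<Rightarrow> hecke_elt"

definition tspace :: "nat \<Rightarrow> nat \<Rightarrow> tspace_elt set" where
  "tspace n r = (\<Pi>\<^sub>E lam\<in>Lambda n r. {x_tilde n r lam \<otimes>\<^bsub>hecke r\<^esub> h | h. h \<in> carrier (hecke r)})"

definition tspace_add :: "nat \<Rightarrow> nat \<Rightarrow> tspace_elt \<Rightarrow> tspace_elt \<Rightarrow> tspace_elt" where
  "tspace_add n r u v = (\<lambda>lam\<in>Lambda n r. u lam \<oplus>\<^bsub>hecke r\<^esub> v lam)"

definition tspace_act :: "nat \<Rightarrow> nat \<Rightarrow> tspace_elt \<Rightarrow> hecke_elt \<Rightarrow> tspace_elt" where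
  "tspace_act n r u h = (\<lambda>lam\<in>Lambda n r. u lam \<otimes>\<^bsub>hecke r\<^esub> h)"

definition tspace_zero :: "nat \<Rightarrow> nat \<Rightarrow> tspace_elt" where
  "tspace_zero n r = (\<lambda>lam\<in>Lambda n r. \<zero>\<^bsub>hecke r\<^esub>)"

definition tspace_inj :: "nat \<Rightarrow> nat \<Rightarrow> nat list \<Rightarrow> hecke_elt \<Rightarrow> tspace_elt" where
  "tspace_inj n r mu x = (\<lambda>lam\<in>Lambda n r. if lam = mu then x else \<zero>\<^bsub>hecke r\<^esub>)"

text \<open>The endomorphism ring of this right \<open>\<H>\<close>-module, and its \<open>\<A>\<close>-algebra structure.\<close>

definition schur :: "nat \<Rightarrow> nat \<Rightarrow> (tspace_elt \<Rightarrow> tspace_elt) ring" where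
  "schur n r =
     \<lparr>carrier = {f \<in> tspace n r \<rightarrow>\<^sub>E tspace n r.
         (\<forall>u\<in>tspace n r. \<forall>v\<in>tspace n r. f (tspace_add n r u v) = tspace_add n r (f u) (f v)) \<and>
         (\<forall>u\<in>tspace n r. \<forall>h\<in>carrier (hecke r). f (tspace_act n r u h) = tspace_act n r (f u) h)},
      mult = (\<lambda>f g. compose (tspace n r) f g),
      one = (\<lambda>u\<in>tspace n r. u),
      zero = (\<lambda>u\<in>tspace n r. tspace_zero n r),
      add = (\<lambda>f g. \<lambda>u\<in>tspace n r. tspace_add n r (f u) (g u))\<rparr>"

definition schur_smult ::
  "nat \<Rightarrow> nat \<Rightarrow> laurent \<Rightarrow> (tspace_elt \<Rightarrow> tspace_elt) \<Rightarrow> (tspace_elt \<Rightarrow> tspace_elt)" where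
  "schur_smult n r a f = (\<lambda>u\<in>tspace n r. tspace_act n r (f u) (hecke_scalar r a))"

type_synonym schurK_elt = "(ratfun \<times> (tspace_elt \<Rightarrow> tspace_elt) \<Rightarrow>\<^sub>0 int) set"

definition schurK :: "nat \<Rightarrow> nat \<Rightarrow> schurK_elt ring" where
  "schurK n r = base_change laurent_to_K (schur_smult n r) (schur n r)"

definition schurK_tensor :: "nat \<Rightarrow> nat \<Rightarrow> ratfun \<Rightarrow> (tspace_elt \<Rightarrow> tspace_elt) \<Rightarrow> schurK_elt" where
  "schurK_tensor n r = tensor laurent_to_K (schur_smult n r) (schur n r)"

definition schurK_smult :: "nat \<Rightarrow> nat \<Rightarrow> ratfun \<Rightarrow> schurK_elt \<Rightarrow> schurK_elt" where
  "schurK_smult n r k c = schurK_tensor n r k \<one>\<^bsub>schur n r\<^esub> \<otimes>\<^bsub>schurK n r\<^esub> c"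


section \<open>The normalized basis\<close>

text \<open>Matrix indices start at 0 in the library, so \<open>a\<^sub>i\<^sub>j\<close> is \<open>A $$ (i - 1, j - 1)\<close>, and \<open>i \<mapsto> i\<^sup>*\<close>
  becomes \<open>i \<mapsto> N - 1 - i\<close>.\<close>

definition Theta :: "nat \<Rightarrow> nat \<Rightarrow> nat mat set" where
  "Theta n r =
     (let N = 2*n+1 in
      {A \<in> carrier_mat N N.
         (\<Sum>i<N. \<Sum>j<N. A $$ (i, j)) = 2*r+1 \<and>
         (\<forall>i<N. \<forall>j<N. A $$ (i, j) = A $$ (N - 1 - i, N - 1 - j))})"

definition row_sums :: "nat mat \<Rightarrow> nat list" where
  "row_sums A = map (\<lambda>i. \<Sum>j<dim_col A. A $$ (i, j)) [0..<dim_row A]"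

definition col_sums :: "nat mat \<Rightarrow> nat list" where
  "col_sums A = map (\<lambda>j. \<Sum>i<dim_row A. A $$ (i, j)) [0..<dim_col A]"

definition Omega :: "nat \<Rightarrow> nat \<Rightarrow> nat mat set" where
  "Omega n r = {A \<in> Theta n r. row_sums A = col_sums A}"

text \<open>\<open>block lam i\<close> is the set \<open>R\<close> with upper index \<open>lam\<close> and lower index \<open>i + 1\<close>.\<close>

definition block :: "nat list \<Rightarrow> nat \<Rightarrow> nat set" where
  "block lam i = {sum_list (take i (tilde lam)) + 1 .. sum_list (take (i+1) (tilde lam))}"

definition row_weight :: "nat \<Rightarrow> nat \<Rightarrow> nat mat \<Rightarrow> nat list" where
  "row_weight n r A = (THE lam. lam \<in> Lambda n r \<and> tilde lam = row_sums A)"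

definition col_weight :: "nat \<Rightarrow> nat \<Rightarrow> nat mat \<Rightarrow> nat list" where
  "col_weight n r A = (THE mu. mu \<in> Lambda n r \<and> tilde mu = col_sums A)"

definition double_coset :: "nat \<Rightarrow> nat \<Rightarrow> nat mat \<Rightarrow> (nat \<Rightarrow> nat) set" where
  "double_coset n r A =
     (let lam = row_weight n r A; mu = col_weight n r A in
      THE D. \<exists>w\<in>carrier (B_group r).
        D = parabolic n r lam <#>\<^bsub>B_group r\<^esub> {w} <#>\<^bsub>B_group r\<^esub> parabolic n r mu \<and>
        (\<forall>i<2*n+1. \<forall>j<2*n+1. A $$ (i, j) = card (block lam i \<inter> w ` block mu j)))"

definition e_basis :: "nat \<Rightarrow> nat \<Rightarrow> nat mat \<Rightarrow> (tspace_elt \<Rightarrow> tspace_elt)" where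
  "e_basis n r A =
     (let lam = row_weight n r A; mu = col_weight n r A in
      THE f. f \<in> carrier (schur n r) \<and>
        (\<forall>nu\<in>Lambda n r. \<forall>h\<in>carrier (hecke r).
           f (tspace_inj n r nu (x_tilde n r nu \<otimes>\<^bsub>hecke r\<^esub> h)) =
             (if nu = mu
              then tspace_inj n r lam (hecke_T_sum r (double_coset n r A) \<otimes>\<^bsub>hecke r\<^esub> h)
              else tspace_zero n r)))"

definition longest :: "nat \<Rightarrow> (nat \<Rightarrow> nat) set \<Rightarrow> (nat \<Rightarrow> nat)" where
  "longest r D = (ARG_MAX (B_length r) w. w \<in> D)"

definition norm_basis :: "nat \<Rightarrow> nat \<Rightarrow> nat mat \<Rightarrow> (tspace_elt \<Rightarrow> tspace_elt)" where
  "norm_basis n r A =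
     schur_smult n r
       (ups_pow (- int (B_length r (longest r (double_coset n r A)))
                 + int (B_length r (longest r (parabolic n r (col_weight n r A))))))
       (e_basis n r A)"

text \<open>The image of \<open>[A]\<close> in the algebra over \<open>K\<close>.\<close>

definition norm_basis_K :: "nat \<Rightarrow> nat \<Rightarrow> nat mat \<Rightarrow> schurK_elt" where
  "norm_basis_K n r A = schurK_tensor n r 1 (norm_basis n r A)"

definition lin_comb :: "nat \<Rightarrow> nat \<Rightarrow> nat mat set \<Rightarrow> (nat mat \<Rightarrow> ratfun) \<Rightarrow> schurK_elt" where
  "lin_comb n r I x =
     finsum (schurK n r) (\<lambda>A. schurK_smult n r (x A) (norm_basis_K n r A)) I"

end

theory Submission
  imports Defs "HOL-Library.Product_Lexorder"
begin

text \<open>The algebra over \<open>K\<close> contains, for every weight \<open>\<kappa>\<close>, the idempotent that projects the tensor space onto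
its summand \<open>x\<^sub>\<kappa> \<H>\<close>.  The basis element of a matrix maps the summand of its column weight into the
summand of its row weight and kills all others.  Multiplication by the idempotent of \<open>\<kappa>\<close> from the left therefore keeps
exactly the coordinates at matrices of row weight \<open>\<kappa>\<close>, and multiplication from the right those at
matrices of column weight \<open>\<kappa>\<close>.  For a central element the two results agree, so its coordinate at
a matrix with different row and column weights vanishes.

This argument needs the basis theorem: the normalized elements \<open>[A]\<close> form a \<open>K\<close>-basis of the
algebra obtained by extension of scalars.  Extending the scalars of an algebra that is free with a finite
basis keeps the basis.  The algebra over \<open>K\<close> is a quotient of a monoid ring by the ideal generated by the
tensor relations; the coordinate functionals of the basis extend to the monoid ring, their common kernel
is an ideal, and hence they descend to the quotient (locale \<open>free_algebra\<close>).  It remains to find a basis over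
the Laurent polynomials.

The Hecke algebra, a quotient of a free algebra, has the basis \<open>T\<^sub>w\<close>.  Linear independence comes from an action on
functions on the group, given by the expected formula for \<open>T\<^sub>i T\<^sub>w\<close>.  The defining relations are verified in this
action through descents of signed permutations; spanning follows from the independence of \<open>T\<^sub>w\<close> of
the reduced word (\<open>matsumoto\<close>).  The left operators commute with the analogous right operators, so the
coefficients of a product with a generator on either side are known.

An element lies in \<open>x\<^sub>\<lambda> \<H>\<close> if and only if its coefficients are constant on the cosets \<open>W\<^sub>\<lambda> d\<close>, and similarly on the
other side (\<open>parab_sum_mult_left_invariant\<close>, \<open>left_invariant_parab_sum_mult\<close>, \<open>right_invariant_mult_parab_sum\<close>).
Hence an endomorphism of the tensor space is the same as a family of functions on the group, one for each pair of
weights, that are constant on the double cosets \<open>W\<^sub>\<lambda> w W\<^sub>\<mu>\<close>, and \<open>e\<^sub>A\<close> is the indicator function of the double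
coset of \<open>A\<close>.

Finally, symmetric matrices correspond to triples of two weights and a double coset: \<open>W\<^sub>\<lambda>\<close> is the stabilizer of
the blocks of \<open>\<lambda>\<close>, and both the existence and the uniqueness of the double coset with a given matrix are
instances of one lemma about matchings that commute with a symmetry (\<open>equivariant_matching\<close>).\<close>

section \<open>Monoid rings\<close>

text \<open>The evaluation at \<open>f\<close> of the additive map on the monoid ring that sends \<open>a x\<close> to \<open>\<phi> x a\<close>.\<close>

definition lin_ext :: "('m \<Rightarrow> 'c::zero \<Rightarrow> 'v::comm_monoid_add) \<Rightarrow> ('m \<Rightarrow>\<^sub>0 'c) \<Rightarrow> 'v" where
  "lin_ext \<phi> f = (\<Sum>x\<in>Poly_Mapping.keys f. \<phi> x (Poly_Mapping.lookup f x))"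

lemma lin_ext_superset:
  assumes "finite X" "Poly_Mapping.keys f \<subseteq> X" "\<And>x. \<phi> x 0 = 0"
  shows "lin_ext \<phi> f = (\<Sum>x\<in>X. \<phi> x (Poly_Mapping.lookup f x))"
  unfolding lin_ext_def
  by (rule sum.mono_neutral_left) (use assms in \<open>auto simp: in_keys_iff\<close>)

lemma lin_ext_add:
  assumes "\<And>x. \<phi> x 0 = 0" "\<And>x a b. \<phi> x (a + b) = \<phi> x a + \<phi> x b"
  shows "lin_ext \<phi> (f + g) = lin_ext \<phi> f + lin_ext \<phi> g"
proof -
  let ?X = "Poly_Mapping.keys f \<union> Poly_Mapping.keys g"
  have "Poly_Mapping.keys (f + g) \<subseteq> ?X" by (rule keys_add)
  then show ?thesis
    using assms by (simp add: lin_ext_superset[of ?X] lookup_add sum.distrib)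
qed

lemma lin_ext_zero [simp]: "lin_ext \<phi> 0 = 0"
  by (simp add: lin_ext_def)

lemma lin_ext_single:
  assumes "\<phi> x 0 = 0"
  shows "lin_ext \<phi> (Poly_Mapping.single x a) = \<phi> x a"
  using assms by (simp add: lin_ext_def)

lemma lin_ext_uminus:
  fixes f :: "'m \<Rightarrow>\<^sub>0 'c::ab_group_add" and \<phi> :: "'m \<Rightarrow> 'c \<Rightarrow> 'v::ab_group_add"
  assumes "\<And>x. \<phi> x 0 = 0" "\<And>x a b. \<phi> x (a + b) = \<phi> x a + \<phi> x b"
  shows "lin_ext \<phi> (- f) = - lin_ext \<phi> f"
proof -
  have "lin_ext \<phi> (- f) + lin_ext \<phi> f = lin_ext \<phi> (- f + f)"
    by (rule lin_ext_add[of \<phi>, symmetric]) (use assms in auto)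
  then show ?thesis by (simp add: eq_neg_iff_add_eq_0)
qed

lemma lin_ext_diff:
  fixes f :: "'m \<Rightarrow>\<^sub>0 'c::ab_group_add" and \<phi> :: "'m \<Rightarrow> 'c \<Rightarrow> 'v::ab_group_add"
  assumes "\<And>x. \<phi> x 0 = 0" "\<And>x a b. \<phi> x (a + b) = \<phi> x a + \<phi> x b"
  shows "lin_ext \<phi> (f - g) = lin_ext \<phi> f - lin_ext \<phi> g"
proof -
  have "lin_ext \<phi> (f + - g) = lin_ext \<phi> f + lin_ext \<phi> (- g)"
    by (rule lin_ext_add) (use assms in auto)
  moreover have "lin_ext \<phi> (- g) = - lin_ext \<phi> g"
    by (rule lin_ext_uminus) (use assms in auto)
  ultimately show ?thesis by simp
qed

text \<open>Every element of a monoid ring is a finite sum of scalar multiples of monoid elements.\<close>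

lemma monoid_ring_induct [consumes 1, case_names zero single add]:
  fixes f :: "'m \<Rightarrow>\<^sub>0 'c::comm_ring_1"
  assumes "Poly_Mapping.keys f \<subseteq> X"
    and zero: "P 0"
    and single: "\<And>x a. x \<in> X \<Longrightarrow> P (Poly_Mapping.single x a)"
    and add: "\<And>f g. Poly_Mapping.keys f \<subseteq> X \<Longrightarrow> Poly_Mapping.keys g \<subseteq> X \<Longrightarrow> P f \<Longrightarrow> P g \<Longrightarrow> P (f + g)"
  shows "P f"
proof -
  have *: "finite Y \<Longrightarrow> Y \<subseteq> X \<Longrightarrow>
      P (\<Sum>x\<in>Y. Poly_Mapping.single x (Poly_Mapping.lookup f x)) \<and>
      Poly_Mapping.keys (\<Sum>x\<in>Y. Poly_Mapping.single x (Poly_Mapping.lookup f x)) \<subseteq> X" for Y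
  proof (induction Y rule: finite_induct)
    case (insert y Y)
    have "Poly_Mapping.keys (Poly_Mapping.single y (Poly_Mapping.lookup f y)) \<subseteq> X"
      using insert by (auto simp: )
    moreover from this have "Poly_Mapping.keys (Poly_Mapping.single y (Poly_Mapping.lookup f y)
        + (\<Sum>x\<in>Y. Poly_Mapping.single x (Poly_Mapping.lookup f x))) \<subseteq> X"
      using insert keys_add by (metis (no_types, lifting) Un_subset_iff dual_order.trans insert_subset)
    ultimately show ?case using insert by (auto intro!: add single)
  qed (use zero in auto)
  have "f = (\<Sum>x\<in>Poly_Mapping.keys f. Poly_Mapping.single x (Poly_Mapping.lookup f x))"
    by (rule poly_mapping_eqI)
      (simp add: lookup_sum lookup_single when_def in_keys_iff)
  with * [of "Poly_Mapping.keys f"] assms(1) show ?thesis by simp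
qed

lemma monoid_ring_mult:
  "f \<otimes>\<^bsub>monoid_ring M\<^esub> g =
     lin_ext (\<lambda>x a. lin_ext (\<lambda>y b. Poly_Mapping.single (x \<otimes>\<^bsub>M\<^esub> y) (a * b)) g) f"
  by (simp add: monoid_ring_def lin_ext_def)

lemma monoid_ring_carrier: "f \<in> carrier (monoid_ring M) \<longleftrightarrow> Poly_Mapping.keys f \<subseteq> carrier M"
  by (simp add: monoid_ring_def)

lemma monoid_ring_add [simp]: "f \<oplus>\<^bsub>monoid_ring M\<^esub> g = f + g"
  by (simp add: monoid_ring_def)

lemma monoid_ring_zero [simp]: "\<zero>\<^bsub>monoid_ring M\<^esub> = 0"
  by (simp add: monoid_ring_def)

lemma monoid_ring_one: "\<one>\<^bsub>monoid_ring M\<^esub> = Poly_Mapping.single \<one>\<^bsub>M\<^esub> 1"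
  by (simp add: monoid_ring_def)

lemma single_in_monoid_ring [simp]:
  "x \<in> carrier M \<Longrightarrow> Poly_Mapping.single x a \<in> carrier (monoid_ring M)"
  by (auto simp: monoid_ring_carrier)

lemma monoid_ring_mult_add_left:
  fixes f :: "'m \<Rightarrow>\<^sub>0 'c::comm_ring_1"
  shows "(f + g) \<otimes>\<^bsub>monoid_ring M\<^esub> h = f \<otimes>\<^bsub>monoid_ring M\<^esub> h + g \<otimes>\<^bsub>monoid_ring M\<^esub> h"
  unfolding monoid_ring_mult
  by (rule lin_ext_add) (simp_all add: lin_ext_def distrib_right single_add sum.distrib)

lemma monoid_ring_mult_add_right:
  fixes f :: "'m \<Rightarrow>\<^sub>0 'c::comm_ring_1"
  shows "f \<otimes>\<^bsub>monoid_ring M\<^esub> (g + h) = f \<otimes>\<^bsub>monoid_ring M\<^esub> g + f \<otimes>\<^bsub>monoid_ring M\<^esub> h"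
proof -
  have "lin_ext (\<lambda>y b. Poly_Mapping.single (x \<otimes>\<^bsub>M\<^esub> y) (a * b)) (g + h)
      = lin_ext (\<lambda>y b. Poly_Mapping.single (x \<otimes>\<^bsub>M\<^esub> y) (a * b)) g
      + lin_ext (\<lambda>y b. Poly_Mapping.single (x \<otimes>\<^bsub>M\<^esub> y) (a * b)) h" for x and a :: 'c
    by (rule lin_ext_add) (simp_all add: distrib_left single_add)
  then show ?thesis
    unfolding monoid_ring_mult by (simp add: lin_ext_def sum.distrib)
qed

lemma monoid_ring_mult_single [simp]:
  "Poly_Mapping.single x a \<otimes>\<^bsub>monoid_ring M\<^esub> Poly_Mapping.single y b =
     Poly_Mapping.single (x \<otimes>\<^bsub>M\<^esub> y) (a * b)"
  unfolding monoid_ring_mult by (simp add: lin_ext_single)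

lemma monoid_ring_mult_zero [simp]:
  "0 \<otimes>\<^bsub>monoid_ring M\<^esub> f = 0" "f \<otimes>\<^bsub>monoid_ring M\<^esub> 0 = 0"
  unfolding monoid_ring_mult by (simp_all add: lin_ext_def)

lemma (in monoid) monoid_ring_mult_closed:
  assumes "f \<in> carrier (monoid_ring G)" "g \<in> carrier (monoid_ring G)"
  shows "f \<otimes>\<^bsub>monoid_ring G\<^esub> g \<in> carrier (monoid_ring G)"
proof -
  have add: "f + g \<in> carrier (monoid_ring G)"
    if "f \<in> carrier (monoid_ring G)" "g \<in> carrier (monoid_ring G)" for f g :: "'a \<Rightarrow>\<^sub>0 'c::comm_ring_1"
    using that keys_add[of f g] by (auto simp: monoid_ring_carrier)
  have "Poly_Mapping.keys f \<subseteq> carrier G" using assms by (simp add: monoid_ring_carrier)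
  then show ?thesis
  proof (induction rule: monoid_ring_induct)
    case (single x a)
    have "Poly_Mapping.keys g \<subseteq> carrier G" using assms by (simp add: monoid_ring_carrier)
    then show ?case
      by (induction rule: monoid_ring_induct)
        (auto simp: monoid_ring_mult_add_right monoid_ring_carrier single add[unfolded monoid_ring_carrier])
  next
    case (add f g) then show ?case by (simp add: monoid_ring_mult_add_left \<open>\<And>g f. _ \<Longrightarrow> _ \<Longrightarrow> f + g \<in> _\<close>)
  qed (simp add: monoid_ring_carrier)
qed

lemma (in monoid) monoid_ring_assoc:
  assumes "f \<in> carrier (monoid_ring G)" "g \<in> carrier (monoid_ring G)" "h \<in> carrier (monoid_ring G)"
  shows "f \<otimes>\<^bsub>monoid_ring G\<^esub> g \<otimes>\<^bsub>monoid_ring G\<^esub> h = f \<otimes>\<^bsub>monoid_ring G\<^esub> (g \<otimes>\<^bsub>monoid_ring G\<^esub> h)"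
proof -
  have f: "Poly_Mapping.keys f \<subseteq> carrier G" and g: "Poly_Mapping.keys g \<subseteq> carrier G"
    and h: "Poly_Mapping.keys h \<subseteq> carrier G"
    using assms by (simp_all add: monoid_ring_carrier)
  from f show ?thesis
  proof (induction rule: monoid_ring_induct)
    case fs: (single x a)
    from g show ?case
    proof (induction rule: monoid_ring_induct)
      case gs: (single y b)
      from h show ?case
        by (induction rule: monoid_ring_induct)
          (simp_all add: monoid_ring_mult_add_right fs gs m_assoc mult.assoc)
    qed (simp_all add: monoid_ring_mult_add_left monoid_ring_mult_add_right)
  qed (simp_all add: monoid_ring_mult_add_left)
qed

lemma (in monoid) monoid_ring_is_ring: "ring (monoid_ring G :: ('a \<Rightarrow>\<^sub>0 'c::comm_ring_1) ring)"
proof (rule ringI)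
  have add: "f + g \<in> carrier (monoid_ring G)"
    if "f \<in> carrier (monoid_ring G)" "g \<in> carrier (monoid_ring G)" for f g :: "'a \<Rightarrow>\<^sub>0 'c"
    using that keys_add[of f g] by (auto simp: monoid_ring_carrier)
  show "abelian_group (monoid_ring G :: ('a \<Rightarrow>\<^sub>0 'c) ring)"
  proof (rule abelian_groupI)
    fix f :: "'a \<Rightarrow>\<^sub>0 'c" assume "f \<in> carrier (monoid_ring G)"
    then show "\<exists>g\<in>carrier (monoid_ring G). g \<oplus>\<^bsub>monoid_ring G\<^esub> f = \<zero>\<^bsub>monoid_ring G\<^esub>"
      by (intro bexI[of _ "- f"]) (auto simp: monoid_ring_carrier)
  qed (auto simp: add add.assoc add.commute, simp add: monoid_ring_carrier)
  show "monoid (monoid_ring G :: ('a \<Rightarrow>\<^sub>0 'c) ring)"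
  proof (rule monoidI)
    fix f :: "'a \<Rightarrow>\<^sub>0 'c" assume "f \<in> carrier (monoid_ring G)"
    then have f: "Poly_Mapping.keys f \<subseteq> carrier G" by (simp add: monoid_ring_carrier)
    then show "\<one>\<^bsub>monoid_ring G\<^esub> \<otimes>\<^bsub>monoid_ring G\<^esub> f = f"
      by (induction rule: monoid_ring_induct) (simp_all add: monoid_ring_mult_add_right monoid_ring_one)
    from f show "f \<otimes>\<^bsub>monoid_ring G\<^esub> \<one>\<^bsub>monoid_ring G\<^esub> = f"
      by (induction rule: monoid_ring_induct) (simp_all add: monoid_ring_mult_add_left monoid_ring_one)
  qed (auto simp: monoid_ring_mult_closed monoid_ring_assoc, simp add: monoid_ring_one)
qed (simp_all add: monoid_ring_mult_add_left monoid_ring_mult_add_right)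

lemma (in monoid) monoid_ring_a_inv:
  assumes "f \<in> carrier (monoid_ring G :: ('a \<Rightarrow>\<^sub>0 'c::comm_ring_1) ring)"
  shows "\<ominus>\<^bsub>monoid_ring G\<^esub> f = - f"
proof -
  interpret MR: ring "monoid_ring G :: ('a \<Rightarrow>\<^sub>0 'c) ring" by (rule monoid_ring_is_ring)
  show ?thesis
    by (rule MR.minus_equality) (use assms in \<open>auto simp: monoid_ring_carrier\<close>)
qed

lemma (in monoid) monoid_ring_minus:
  assumes "f \<in> carrier (monoid_ring G :: ('a \<Rightarrow>\<^sub>0 'c::comm_ring_1) ring)" "g \<in> carrier (monoid_ring G)"
  shows "f \<ominus>\<^bsub>monoid_ring G\<^esub> g = f - g"
  using assms by (simp add: a_minus_def monoid_ring_a_inv)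

text \<open>A product with an arbitrary element is a sum of products with scalar multiples of monoid elements.\<close>

lemma (in monoid) monoid_ring_idealI:
  fixes J :: "('a \<Rightarrow>\<^sub>0 'c::comm_ring_1) set"
  assumes sub: "J \<subseteq> carrier (monoid_ring G)" and zero: "0 \<in> J"
    and add: "\<And>f g. f \<in> J \<Longrightarrow> g \<in> J \<Longrightarrow> f + g \<in> J"
    and neg: "\<And>f. f \<in> J \<Longrightarrow> - f \<in> J"
    and left: "\<And>x a f. x \<in> carrier G \<Longrightarrow> f \<in> J \<Longrightarrow> Poly_Mapping.single x a \<otimes>\<^bsub>monoid_ring G\<^esub> f \<in> J"
    and right: "\<And>x a f. x \<in> carrier G \<Longrightarrow> f \<in> J \<Longrightarrow> f \<otimes>\<^bsub>monoid_ring G\<^esub> Poly_Mapping.single x a \<in> J"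
  shows "ideal J (monoid_ring G)"
proof -
  interpret MR: ring "monoid_ring G :: ('a \<Rightarrow>\<^sub>0 'c) ring" by (rule monoid_ring_is_ring)
  show ?thesis
  proof (rule idealI)
    show "ring (monoid_ring G :: ('a \<Rightarrow>\<^sub>0 'c) ring)" by (rule monoid_ring_is_ring)
    show "subgroup J (add_monoid (monoid_ring G))"
    proof (rule MR.add.subgroupI)
      show "\<ominus>\<^bsub>monoid_ring G\<^esub> f \<in> J" if "f \<in> J" for f
        using neg[OF that] that sub by (simp add: monoid_ring_a_inv subset_iff)
    qed (use sub zero add in auto)
    fix f x :: "'a \<Rightarrow>\<^sub>0 'c" assume f: "f \<in> J" and "x \<in> carrier (monoid_ring G)"
    then have x: "Poly_Mapping.keys x \<subseteq> carrier G" by (simp add: monoid_ring_carrier)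
    from x show "x \<otimes>\<^bsub>monoid_ring G\<^esub> f \<in> J"
      by (induction rule: monoid_ring_induct) (auto simp: monoid_ring_mult_add_left zero add left f)
    from x show "f \<otimes>\<^bsub>monoid_ring G\<^esub> x \<in> J"
      by (induction rule: monoid_ring_induct) (auto simp: monoid_ring_mult_add_right zero add right f)
  qed
qed

section \<open>Extension of scalars of a free algebra\<close>

text \<open>An algebra \<open>R\<close> over \<open>'a\<close>, free with basis \<open>e\<close> and coordinates \<open>c\<close>, and a homomorphism \<open>\<phi>\<close> along which
  the scalars are extended.\<close>

locale free_algebra = ring R for R (structure) +
  fixes \<phi> :: "'a::comm_ring_1 \<Rightarrow> 'k::comm_ring_1"
    and act :: "'a \<Rightarrow> 'b \<Rightarrow> 'b"
    and B :: "'i set" and e :: "'i \<Rightarrow> 'b" and c :: "'i \<Rightarrow> 'b \<Rightarrow> 'a"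
  assumes phi_add: "\<phi> (a + b) = \<phi> a + \<phi> b"
    and phi_mult: "\<phi> (a * b) = \<phi> a * \<phi> b"
    and phi_one: "\<phi> 1 = 1"
    and act_closed: "x \<in> carrier R \<Longrightarrow> act a x \<in> carrier R"
    and act_mult_left: "x \<in> carrier R \<Longrightarrow> y \<in> carrier R \<Longrightarrow> act a x \<otimes> y = act a (x \<otimes> y)"
    and act_mult_right: "x \<in> carrier R \<Longrightarrow> y \<in> carrier R \<Longrightarrow> x \<otimes> act a y = act a (x \<otimes> y)"
    and finite_basis: "finite B"
    and basis_closed: "i \<in> B \<Longrightarrow> e i \<in> carrier R"
    and coord_add: "i \<in> B \<Longrightarrow> x \<in> carrier R \<Longrightarrow> y \<in> carrier R \<Longrightarrow> c i (x \<oplus> y) = c i x + c i y"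
    and coord_act: "i \<in> B \<Longrightarrow> x \<in> carrier R \<Longrightarrow> c i (act a x) = a * c i x"
    and coord_basis: "i \<in> B \<Longrightarrow> j \<in> B \<Longrightarrow> c i (e j) = (if i = j then 1 else 0)"
    and expand: "x \<in> carrier R \<Longrightarrow> x = (\<Oplus>i\<in>B. act (c i x) (e i))"
begin

abbreviation TP :: "('k \<times> 'b \<Rightarrow>\<^sub>0 int) ring" where "TP \<equiv> tensor_pre R"
abbreviation TI :: "('k \<times> 'b \<Rightarrow>\<^sub>0 int) set" where "TI \<equiv> tensor_ideal \<phi> act R"
abbreviation BC :: "('k \<times> 'b \<Rightarrow>\<^sub>0 int) set ring" where "BC \<equiv> base_change \<phi> act R"
abbreviation KR :: "('k \<times> 'b) monoid" where
  "KR \<equiv> \<lparr>carrier = (UNIV :: 'k set), mult = (*), one = 1\<rparr> \<times>\<times> R"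

lemma phi_zero: "\<phi> 0 = 0"
  using phi_add[of 0 0] by simp

lemma phi_sum: "\<phi> (sum f S) = (\<Sum>s\<in>S. \<phi> (f s))"
  by (induction S rule: infinite_finite_induct) (simp_all add: phi_zero phi_add)

lemma coord_zero: "i \<in> B \<Longrightarrow> c i \<zero> = 0"
  using coord_add[of i \<zero> \<zero>] by simp

lemma coord_finsum:
  assumes "i \<in> B" "finite S" "f \<in> S \<rightarrow> carrier R"
  shows "c i (finsum R f S) = (\<Sum>s\<in>S. c i (f s))"
  using assms(2,3)
proof (induction S rule: finite_induct)
  case (insert s S)
  then show ?case using assms(1) by (simp add: Pi_iff coord_add)
qed (simp add: assms(1) coord_zero)

text \<open>Left multiplication by \<open>y\<close> is linear, so its coordinates are those of \<open>x\<close> transformed by a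
  matrix that depends on \<open>y\<close> only.\<close>

lemma coord_mult_left:
  assumes "i \<in> B" "x \<in> carrier R" "y \<in> carrier R"
  shows "c i (y \<otimes> x) = (\<Sum>j\<in>B. c j x * c i (y \<otimes> e j))"
proof -
  have cl: "(\<lambda>j. act (c j x) (e j)) \<in> B \<rightarrow> carrier R"
    by (simp add: act_closed basis_closed)
  have "y \<otimes> x = y \<otimes> (\<Oplus>j\<in>B. act (c j x) (e j))" using expand[OF assms(2)] by simp
  also have "\<dots> = (\<Oplus>j\<in>B. y \<otimes> act (c j x) (e j))"
    by (rule finsum_rdistr[OF finite_basis assms(3) cl])
  also have "\<dots> = (\<Oplus>j\<in>B. act (c j x) (y \<otimes> e j))"
    by (rule finsum_cong') (use assms in \<open>auto simp: act_mult_right basis_closed act_closed\<close>)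
  finally show ?thesis using assms
    by (simp add: coord_finsum finite_basis basis_closed act_closed coord_act)
qed

lemma coord_mult_right:
  assumes "i \<in> B" "x \<in> carrier R" "y \<in> carrier R"
  shows "c i (x \<otimes> y) = (\<Sum>j\<in>B. c j x * c i (e j \<otimes> y))"
proof -
  have cl: "(\<lambda>j. act (c j x) (e j)) \<in> B \<rightarrow> carrier R"
    by (simp add: act_closed basis_closed)
  have "x \<otimes> y = (\<Oplus>j\<in>B. act (c j x) (e j)) \<otimes> y" using expand[OF assms(2)] by simp
  also have "\<dots> = (\<Oplus>j\<in>B. act (c j x) (e j) \<otimes> y)"
    by (rule finsum_ldistr[OF finite_basis assms(3) cl])
  also have "\<dots> = (\<Oplus>j\<in>B. act (c j x) (e j \<otimes> y))"
    by (rule finsum_cong') (use assms in \<open>auto simp: act_mult_left basis_closed act_closed\<close>)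
  finally show ?thesis using assms
    by (simp add: coord_finsum finite_basis basis_closed act_closed coord_act)
qed

text \<open>The coordinates of an element of \<open>'k \<otimes> R\<close>, read off from a representative in the monoid ring.\<close>

definition pre_coord :: "'i \<Rightarrow> ('k \<times> 'b \<Rightarrow>\<^sub>0 int) \<Rightarrow> 'k" where
  "pre_coord i = lin_ext (\<lambda>t n. of_int n * (fst t * \<phi> (c i (snd t))))"

lemma pre_coord_simps [simp]:
  "pre_coord i (F + G) = pre_coord i F + pre_coord i G"
  "pre_coord i (F - G) = pre_coord i F - pre_coord i G"
  "pre_coord i (- F) = - pre_coord i F"
  "pre_coord i 0 = 0"
  "pre_coord i (Poly_Mapping.single (k, x) n) = of_int n * (k * \<phi> (c i x))"
  unfolding pre_coord_def
  by (simp_all add: lin_ext_add lin_ext_diff lin_ext_uminus lin_ext_single ring_distribs)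

lemma monoid_KR: "monoid KR"
proof (rule DirProd_monoid)
  show "monoid \<lparr>carrier = (UNIV :: 'k set), mult = (*), one = 1\<rparr>"
    by (rule monoidI) (simp_all add: mult.assoc)
qed (rule monoid_axioms)

sublocale KR: monoid KR by (rule monoid_KR)

lemma TP_eq: "TP = monoid_ring KR"
  by (simp add: tensor_pre_def)

sublocale TP: ring TP
  unfolding TP_eq by (rule KR.monoid_ring_is_ring)

lemma TP_carrier: "F \<in> carrier TP \<longleftrightarrow> Poly_Mapping.keys F \<subseteq> UNIV \<times> carrier R"
  by (simp add: TP_eq monoid_ring_carrier)

lemma pre_coord_mult_left:
  assumes "i \<in> B" "y \<in> carrier R" "F \<in> carrier TP"
  shows "pre_coord i (Poly_Mapping.single (k, y) n \<otimes>\<^bsub>TP\<^esub> F)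
    = of_int n * k * (\<Sum>j\<in>B. \<phi> (c i (y \<otimes> e j)) * pre_coord j F)"
proof -
  have "Poly_Mapping.keys F \<subseteq> UNIV \<times> carrier R" using assms by (simp add: TP_carrier)
  then show ?thesis unfolding TP_eq
  proof (induction rule: monoid_ring_induct)
    case (single t a)
    obtain k' x where t: "t = (k', x)" and x: "x \<in> carrier R" using single by auto
    show ?case using assms x
      by (simp add: t coord_mult_left phi_sum phi_mult sum_distrib_left algebra_simps)
  qed (simp_all add: monoid_ring_mult_add_right distrib_left sum.distrib)
qed

lemma pre_coord_mult_right:
  assumes "i \<in> B" "y \<in> carrier R" "F \<in> carrier TP"
  shows "pre_coord i (F \<otimes>\<^bsub>TP\<^esub> Poly_Mapping.single (k, y) n)
    = of_int n * k * (\<Sum>j\<in>B. \<phi> (c i (e j \<otimes> y)) * pre_coord j F)"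
proof -
  have "Poly_Mapping.keys F \<subseteq> UNIV \<times> carrier R" using assms by (simp add: TP_carrier)
  then show ?thesis unfolding TP_eq
  proof (induction rule: monoid_ring_induct)
    case (single t a)
    obtain k' x where t: "t = (k', x)" and x: "x \<in> carrier R" using single by auto
    show ?case using assms x
      by (simp add: t coord_mult_right phi_sum phi_mult sum_distrib_left algebra_simps)
  qed (simp_all add: monoid_ring_mult_add_left distrib_left sum.distrib)
qed

text \<open>The coordinates of a product with a monoid element are linear combinations of the coordinates
  of the other factor, so the common kernel absorbs products on both sides.  Since the kernel contains the
  tensor relations, it contains the ideal that they generate, and the coordinates are well defined on
  the tensor product.\<close>

lemma kernel_ideal: "ideal {F \<in> carrier TP. \<forall>i\<in>B. pre_coord i F = 0} TP"
proof -
  have TPc: "carrier TP = carrier (monoid_ring KR)" by (simp add: TP_eq)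
  show ?thesis
    unfolding TP_eq
  proof (rule KR.monoid_ring_idealI)
    fix t a and F :: "'k \<times> 'b \<Rightarrow>\<^sub>0 int"
    assume t: "t \<in> carrier KR" and F: "F \<in> {F \<in> carrier (monoid_ring KR). \<forall>i\<in>B. pre_coord i F = 0}"
    obtain k y where ky: "t = (k, y)" "y \<in> carrier R" using t by auto
    have "Poly_Mapping.single t a \<otimes>\<^bsub>TP\<^esub> F \<in> carrier TP" "F \<otimes>\<^bsub>TP\<^esub> Poly_Mapping.single t a \<in> carrier TP"
      using F ky by (auto simp: TP_eq intro!: KR.monoid_ring_mult_closed)
    then show "Poly_Mapping.single t a \<otimes>\<^bsub>monoid_ring KR\<^esub> F \<in> {F \<in> carrier (monoid_ring KR). \<forall>i\<in>B. pre_coord i F = 0}"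
      and "F \<otimes>\<^bsub>monoid_ring KR\<^esub> Poly_Mapping.single t a \<in> {F \<in> carrier (monoid_ring KR). \<forall>i\<in>B. pre_coord i F = 0}"
      using F ky by (auto simp: pre_coord_mult_left pre_coord_mult_right simp flip: TP_eq)
  next
    fix F G :: "'k \<times> 'b \<Rightarrow>\<^sub>0 int"
    assume "F \<in> {F \<in> carrier (monoid_ring KR). \<forall>i\<in>B. pre_coord i F = 0}"
      "G \<in> {F \<in> carrier (monoid_ring KR). \<forall>i\<in>B. pre_coord i F = 0}"
    then show "F + G \<in> {F \<in> carrier (monoid_ring KR). \<forall>i\<in>B. pre_coord i F = 0}"
      using keys_add[of F G] by (auto simp: monoid_ring_carrier)
  qed (auto simp: monoid_ring_carrier)
qed

lemma rels_in_carrier: "tensor_rels \<phi> act R \<subseteq> carrier TP"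
proof -
  have d: "F - G \<in> carrier TP" if "F \<in> carrier TP" "G \<in> carrier TP" for F G
    using that keys_diff[of F G] by (auto simp: TP_carrier)
  have s: "Poly_Mapping.single (k, x) n \<in> carrier TP" if "x \<in> carrier R" for k x n
    using that by (auto simp: TP_carrier)
  show ?thesis
    unfolding tensor_rels_def Let_def by (auto intro!: d s simp: act_closed)
qed

sublocale TI: ideal TI TP
  unfolding tensor_ideal_def by (rule TP.genideal_ideal[OF rels_in_carrier])

lemma TI_coord:
  assumes "F \<in> TI" "i \<in> B"
  shows "pre_coord i F = 0"
proof -
  have "tensor_rels \<phi> act R \<subseteq> {F \<in> carrier TP. \<forall>i\<in>B. pre_coord i F = 0}"
  proof
    fix F assume F: "F \<in> tensor_rels \<phi> act R"
    then have "\<forall>i\<in>B. pre_coord i F = 0"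
      unfolding tensor_rels_def Let_def
      by (auto simp: phi_add phi_mult coord_add coord_act distrib_left distrib_right mult.assoc)
    then show "F \<in> {F \<in> carrier TP. \<forall>i\<in>B. pre_coord i F = 0}"
      using F rels_in_carrier by auto
  qed
  then have "TI \<subseteq> {F \<in> carrier TP. \<forall>i\<in>B. pre_coord i F = 0}"
    unfolding tensor_ideal_def by (rule TP.genideal_minimal[OF kernel_ideal])
  then show ?thesis using assms by auto
qed

lemma TI_rel: "F \<in> tensor_rels \<phi> act R \<Longrightarrow> F \<in> TI"
  unfolding tensor_ideal_def using TP.genideal_self[OF rels_in_carrier] by auto

lemma TP_add [simp]: "F \<oplus>\<^bsub>TP\<^esub> G = F + G" by (simp add: TP_eq)
lemma TP_zero [simp]: "\<zero>\<^bsub>TP\<^esub> = 0" by (simp add: TP_eq)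
lemma TP_minus: "F \<in> carrier TP \<Longrightarrow> G \<in> carrier TP \<Longrightarrow> F \<ominus>\<^bsub>TP\<^esub> G = F - G"
  unfolding TP_eq by (rule KR.monoid_ring_minus)
lemma TP_uminus: "F \<in> carrier TP \<Longrightarrow> \<ominus>\<^bsub>TP\<^esub> F = - F"
  unfolding TP_eq by (rule KR.monoid_ring_a_inv)

lemma TI_add: "F \<in> TI \<Longrightarrow> G \<in> TI \<Longrightarrow> F + G \<in> TI"
  using TI.a_closed by simp

lemma TI_uminus: "F \<in> TI \<Longrightarrow> - F \<in> TI"
  using TI.a_inv_closed[of F] TI.Icarr[of F] by (simp add: TP_uminus)

lemma TI_diff: "F \<in> TI \<Longrightarrow> G \<in> TI \<Longrightarrow> F - G \<in> TI"
  using TI_add[of F "- G"] TI_uminus[of G] by simp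

lemma TI_zero: "0 \<in> TI"
  using TI.zero_closed by simp

lemma TI_sum: "(\<And>s. s \<in> S \<Longrightarrow> f s \<in> TI) \<Longrightarrow> sum f S \<in> TI"
  by (induction S rule: infinite_finite_induct) (simp_all add: TI_add TI_zero)

lemma rel_add_left:
  "x \<in> carrier R \<Longrightarrow> Poly_Mapping.single (k + k', x) 1 - Poly_Mapping.single (k, x) 1 - Poly_Mapping.single (k', x) 1 \<in> TI"
  by (rule TI_rel) (auto simp: tensor_rels_def Let_def)

lemma rel_add_right:
  "x \<in> carrier R \<Longrightarrow> y \<in> carrier R \<Longrightarrow>
   Poly_Mapping.single (k, x \<oplus> y) 1 - Poly_Mapping.single (k, x) 1 - Poly_Mapping.single (k, y) 1 \<in> TI"
  by (rule TI_rel) (unfold tensor_rels_def Let_def, blast)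

lemma rel_act:
  "x \<in> carrier R \<Longrightarrow> Poly_Mapping.single (k * \<phi> a, x) 1 - Poly_Mapping.single (k, act a x) 1 \<in> TI"
  by (rule TI_rel) (unfold tensor_rels_def Let_def, blast)

lemma rel_diff_left:
  assumes "x \<in> carrier R"
  shows "Poly_Mapping.single (k - k', x) 1 - Poly_Mapping.single (k, x) 1 + Poly_Mapping.single (k', x) 1 \<in> TI"
  using TI_uminus[OF rel_add_left[OF assms, of "k - k'" k']] by (simp add: algebra_simps)

lemma rel_finsum:
  assumes "finite S" "f \<in> S \<rightarrow> carrier R"
  shows "Poly_Mapping.single (k, finsum R f S) 1 - (\<Sum>s\<in>S. Poly_Mapping.single (k, f s) 1) \<in> TI"
  using assms
proof (induction S rule: finite_induct)
  case empty
  show ?case using TI_uminus[OF rel_add_right[of \<zero> \<zero> k]] by simp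
next
  case (insert s S)
  then have fs: "f s \<in> carrier R" and fS: "finsum R f S \<in> carrier R" "f \<in> S \<rightarrow> carrier R"
    by (auto simp: Pi_iff)
  have "(Poly_Mapping.single (k, f s \<oplus> finsum R f S) 1 - Poly_Mapping.single (k, f s) 1 - Poly_Mapping.single (k, finsum R f S) 1)
      + (Poly_Mapping.single (k, finsum R f S) 1 - (\<Sum>s\<in>S. Poly_Mapping.single (k, f s) 1)) \<in> TI"
    by (intro TI_add rel_add_right fs fS insert.IH)
  then show ?case using insert fs fS by (simp add: algebra_simps)
qed

definition pre_normal :: "('k \<times> 'b \<Rightarrow>\<^sub>0 int) \<Rightarrow> ('k \<times> 'b \<Rightarrow>\<^sub>0 int)" where
  "pre_normal F = (\<Sum>j\<in>B. Poly_Mapping.single (pre_coord j F, e j) 1)"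

text \<open>Modulo the tensor relations every element is a combination of the pairs \<open>(k, e j)\<close>.  By additivity
  it is enough to see this for a single pair \<open>(k, x)\<close>: expand \<open>x\<close> and move the coefficients to the left.\<close>

lemma pre_normal_cong:
  assumes "F \<in> carrier TP"
  shows "F - pre_normal F \<in> TI"
proof -
  have "Poly_Mapping.keys F \<subseteq> UNIV \<times> carrier R" using assms by (simp add: TP_carrier)
  then show ?thesis
  proof (induction F rule: frag_induction)
    case zero
    have "- Poly_Mapping.single (0, e j) 1 \<in> TI" if "j \<in> B" for j
      using rel_add_left[OF basis_closed[OF that], of 0 0] by simp
    then show ?case using TI_sum[of B "\<lambda>j. - Poly_Mapping.single (0, e j) 1"]
      by (simp add: pre_normal_def sum_negf)
  next
    case (one t)
    then obtain k x where t: "t = (k, x)" and x: "x \<in> carrier R" by auto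
    have "(\<Sum>j\<in>B. Poly_Mapping.single (k, act (c j x) (e j)) 1 - Poly_Mapping.single (k * \<phi> (c j x), e j) 1) \<in> TI"
    proof (rule TI_sum)
      fix j assume "j \<in> B"
      then show "Poly_Mapping.single (k, act (c j x) (e j)) 1 - Poly_Mapping.single (k * \<phi> (c j x), e j) 1 \<in> TI"
        using TI_uminus[OF rel_act[OF basis_closed, of j k "c j x"]] by simp
    qed
    moreover have "Poly_Mapping.single (k, x) 1 - (\<Sum>j\<in>B. Poly_Mapping.single (k, act (c j x) (e j)) 1) \<in> TI"
      using rel_finsum[OF finite_basis, of "\<lambda>j. act (c j x) (e j)" k] expand[OF x]
      by (simp add: act_closed basis_closed)
    ultimately have "(Poly_Mapping.single (k, x) 1 - (\<Sum>j\<in>B. Poly_Mapping.single (k, act (c j x) (e j)) 1))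
      + (\<Sum>j\<in>B. Poly_Mapping.single (k, act (c j x) (e j)) 1 - Poly_Mapping.single (k * \<phi> (c j x), e j) 1) \<in> TI"
      by (intro TI_add)
    then show ?case by (simp add: t pre_normal_def sum_subtractf)
  next
    case (diff F G)
    have "(\<Sum>j\<in>B. Poly_Mapping.single (pre_coord j F - pre_coord j G, e j) 1
        - Poly_Mapping.single (pre_coord j F, e j) 1 + Poly_Mapping.single (pre_coord j G, e j) 1) \<in> TI"
      by (intro TI_sum rel_diff_left basis_closed)
    then have "pre_normal (F - G) - pre_normal F + pre_normal G \<in> TI"
      by (simp add: pre_normal_def sum_subtractf sum.distrib)
    then have "(F - pre_normal F) - (G - pre_normal G) - (pre_normal (F - G) - pre_normal F + pre_normal G) \<in> TI"
      by (rule TI_diff[OF TI_diff[OF diff]])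
    then show ?case by (simp add: algebra_simps)
  qed
qed

abbreviation cls :: "('k \<times> 'b \<Rightarrow>\<^sub>0 int) \<Rightarrow> ('k \<times> 'b \<Rightarrow>\<^sub>0 int) set" where
  "cls F \<equiv> TI +>\<^bsub>TP\<^esub> F"

sublocale BC: ring BC
  unfolding base_change_def by (rule TI.quotient_is_ring)

sublocale cls: ring_hom_ring TP BC cls
  unfolding base_change_def by (rule TI.rcos_ring_hom_ring)

lemma BC_carrierE:
  assumes "C \<in> carrier BC"
  obtains F where "F \<in> carrier TP" "C = cls F"
  using assms by (auto simp: base_change_def FactRing_def A_RCOSETS_def' a_r_coset_def)

lemma cls_eq_iff:
  assumes "F \<in> carrier TP" "G \<in> carrier TP"
  shows "cls F = cls G \<longleftrightarrow> F - G \<in> TI"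
  using TP.quotient_eq_iff_same_a_r_cos[OF TI.is_ideal assms] assms by (simp add: TP_minus)

definition bc_coord :: "'i \<Rightarrow> ('k \<times> 'b \<Rightarrow>\<^sub>0 int) set \<Rightarrow> 'k" where
  "bc_coord i C = pre_coord i (SOME F. F \<in> carrier TP \<and> C = cls F)"

lemma bc_coord_cls:
  assumes "i \<in> B" "F \<in> carrier TP"
  shows "bc_coord i (cls F) = pre_coord i F"
proof -
  let ?G = "SOME G. G \<in> carrier TP \<and> cls F = cls G"
  have "?G \<in> carrier TP \<and> cls F = cls ?G"
    by (rule someI[where x = F]) (use assms in simp)
  then have "F - ?G \<in> TI" using assms cls_eq_iff[of F ?G] by blast
  then show ?thesis unfolding bc_coord_def using TI_coord[OF _ assms(1)] by force
qed

lemma bc_coord_add: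
  assumes "i \<in> B" "C \<in> carrier BC" "D \<in> carrier BC"
  shows "bc_coord i (C \<oplus>\<^bsub>BC\<^esub> D) = bc_coord i C + bc_coord i D"
proof -
  obtain F G where *: "F \<in> carrier TP" "C = cls F" "G \<in> carrier TP" "D = cls G"
    using assms BC_carrierE by metis
  then have "C \<oplus>\<^bsub>BC\<^esub> D = cls (F + G)" using cls.hom_add[of F G] by simp
  then show ?thesis using * assms(1) TP.a_closed[of F G] by (simp add: bc_coord_cls)
qed

lemma bc_coord_finsum:
  assumes "i \<in> B" "finite S" "f \<in> S \<rightarrow> carrier BC"
  shows "bc_coord i (finsum BC f S) = (\<Sum>s\<in>S. bc_coord i (f s))"
  using assms(2,3)
proof (induction S rule: finite_induct)
  case empty
  have "\<zero>\<^bsub>BC\<^esub> = cls 0" using cls.hom_zero by simp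
  then show ?case using bc_coord_cls[OF assms(1), of 0] by (simp add: TP_carrier)
next
  case (insert s S)
  then show ?case using assms(1) by (simp add: Pi_iff bc_coord_add)
qed

lemma single_TP [simp]: "x \<in> carrier R \<Longrightarrow> Poly_Mapping.single (k, x) n \<in> carrier TP"
  by (auto simp: TP_carrier)

lemma tensor_closed: "x \<in> carrier R \<Longrightarrow> tensor \<phi> act R k x \<in> carrier BC"
  by (simp add: tensor_def)

lemma tensor_mult:
  assumes "x \<in> carrier R" "y \<in> carrier R"
  shows "tensor \<phi> act R k x \<otimes>\<^bsub>BC\<^esub> tensor \<phi> act R k' y = tensor \<phi> act R (k * k') (x \<otimes> y)"
proof -
  have "Poly_Mapping.single (k, x) (1::int) \<otimes>\<^bsub>TP\<^esub> Poly_Mapping.single (k', y) 1 = Poly_Mapping.single (k * k', x \<otimes> y) 1"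
    by (simp add: TP_eq)
  then show ?thesis
    unfolding tensor_def using assms
    by (simp flip: cls.hom_mult)
qed

lemma bc_coord_tensor:
  "i \<in> B \<Longrightarrow> x \<in> carrier R \<Longrightarrow> bc_coord i (tensor \<phi> act R k x) = k * \<phi> (c i x)"
  by (simp add: tensor_def bc_coord_cls)

lemma bc_coord_mult_left:
  assumes "i \<in> B" "y \<in> carrier R" "C \<in> carrier BC"
  shows "bc_coord i (tensor \<phi> act R k y \<otimes>\<^bsub>BC\<^esub> C) = k * (\<Sum>j\<in>B. \<phi> (c i (y \<otimes> e j)) * bc_coord j C)"
proof -
  obtain F where F: "F \<in> carrier TP" "C = cls F" using assms BC_carrierE by metis
  have "tensor \<phi> act R k y \<otimes>\<^bsub>BC\<^esub> C = cls (Poly_Mapping.single (k, y) 1 \<otimes>\<^bsub>TP\<^esub> F)"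
    unfolding tensor_def F(2) using F assms by simp
  then show ?thesis using F assms
    by (simp add: bc_coord_cls pre_coord_mult_left del: cls.hom_mult)
qed

lemma bc_coord_mult_right:
  assumes "i \<in> B" "y \<in> carrier R" "C \<in> carrier BC"
  shows "bc_coord i (C \<otimes>\<^bsub>BC\<^esub> tensor \<phi> act R k y) = k * (\<Sum>j\<in>B. \<phi> (c i (e j \<otimes> y)) * bc_coord j C)"
proof -
  obtain F where F: "F \<in> carrier TP" "C = cls F" using assms BC_carrierE by metis
  have "C \<otimes>\<^bsub>BC\<^esub> tensor \<phi> act R k y = cls (F \<otimes>\<^bsub>TP\<^esub> Poly_Mapping.single (k, y) 1)"
    unfolding tensor_def F(2) using F assms by simp
  then show ?thesis using F assms
    by (simp add: bc_coord_cls pre_coord_mult_right del: cls.hom_mult)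
qed

definition bc_comb :: "'i set \<Rightarrow> ('i \<Rightarrow> 'k) \<Rightarrow> ('k \<times> 'b \<Rightarrow>\<^sub>0 int) set" where
  "bc_comb S x = finsum BC (\<lambda>j. tensor \<phi> act R (x j) \<one> \<otimes>\<^bsub>BC\<^esub> tensor \<phi> act R 1 (e j)) S"

lemma bc_comb_alt:
  assumes "S \<subseteq> B"
  shows "bc_comb S x = finsum BC (\<lambda>j. tensor \<phi> act R (x j) (e j)) S"
  unfolding bc_comb_def
  by (rule BC.finsum_cong') (use assms in \<open>auto simp: tensor_closed tensor_mult basis_closed subset_iff\<close>)

lemma bc_coord_comb:
  assumes "S \<subseteq> B" "i \<in> B"
  shows "bc_coord i (bc_comb S x) = (if i \<in> S then x i else 0)"
proof -
  have "finite S" using assms finite_basis finite_subset by blast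
  have "bc_coord i (bc_comb S x) = (\<Sum>j\<in>S. bc_coord i (tensor \<phi> act R (x j) (e j)))"
    unfolding bc_comb_alt[OF assms(1)]
    by (rule bc_coord_finsum) (use assms \<open>finite S\<close> in \<open>auto simp: tensor_closed basis_closed subset_iff\<close>)
  also have "\<dots> = (\<Sum>j\<in>S. if i = j then x j else 0)"
    by (rule sum.cong) (use assms in \<open>auto simp: bc_coord_tensor basis_closed coord_basis phi_one phi_zero subset_iff\<close>)
  finally show ?thesis using \<open>finite S\<close> by simp
qed

lemma TP_finsum: "f \<in> S \<rightarrow> carrier TP \<Longrightarrow> finsum TP f S = sum f S"
  by (induction S rule: infinite_finite_induct) (auto simp: TP.finsum_infinite)

lemma cls_finsum:
  "f \<in> S \<rightarrow> carrier TP \<Longrightarrow> cls (finsum TP f S) = finsum BC (cls \<circ> f) S"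
proof (induction S rule: infinite_finite_induct)
  case (insert s S)
  have "cls \<circ> f \<in> S \<rightarrow> carrier BC" using insert.prems by (auto simp: Pi_iff)
  then show ?case using insert by (auto simp: Pi_iff simp del: TP_add TP_zero)
qed (auto simp: TP.finsum_infinite BC.finsum_infinite simp del: TP_add TP_zero)

lemma bc_expand:
  assumes "C \<in> carrier BC"
  shows "C = bc_comb B (\<lambda>i. bc_coord i C)"
proof -
  obtain F where F: "F \<in> carrier TP" "C = cls F" using assms BC_carrierE by metis
  have cl: "(\<lambda>j. Poly_Mapping.single (pre_coord j F, e j) (1::int)) \<in> B \<rightarrow> carrier TP"
    by (simp add: basis_closed)
  have n: "pre_normal F = finsum TP (\<lambda>j. Poly_Mapping.single (pre_coord j F, e j) 1) B"
    unfolding pre_normal_def by (rule TP_finsum[OF cl, symmetric])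
  then have "pre_normal F \<in> carrier TP" using cl by simp
  then have "C = cls (pre_normal F)"
    using F cls_eq_iff pre_normal_cong by blast
  also have "\<dots> = finsum BC (cls \<circ> (\<lambda>j. Poly_Mapping.single (pre_coord j F, e j) (1::int))) B"
    unfolding n by (rule cls_finsum[OF cl])
  also have "\<dots> = finsum BC (\<lambda>j. tensor \<phi> act R (bc_coord j C) (e j)) B"
    by (rule BC.finsum_cong') (use F in \<open>auto simp: tensor_def bc_coord_cls basis_closed\<close>)
  also have "\<dots> = bc_comb B (\<lambda>i. bc_coord i C)" by (simp add: bc_comb_alt)
  finally show ?thesis .
qed

end

section \<open>Signed permutations and lengths\<close>

text \<open>The neighbour exchanged with position \<open>i\<close> by the \<open>i\<close>-th simple reflection.  The middle position \<open>r + 1\<close>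
  is fixed by the whole group, and the chain of positions \<open>1, \<dots>, r, r+2, \<dots>, 2r+1\<close> skips it.\<close>

definition next_pos :: "nat \<Rightarrow> nat \<Rightarrow> nat" where
  "next_pos r i = (if i < r then i + 1 else r + 2)"

abbreviation BW :: "nat \<Rightarrow> (nat \<Rightarrow> nat) set" where
  "BW r \<equiv> carrier (B_group r)"

text \<open>The plain notation for the inverse function is taken by the inverse in a group.\<close>

abbreviation pinv :: "(nat \<Rightarrow> nat) \<Rightarrow> nat \<Rightarrow> nat" where
  "pinv w \<equiv> inv_into UNIV w"

lemma BW_iff:
  "w \<in> BW r \<longleftrightarrow> w permutes {1..2*r+1} \<and> (\<forall>i\<in>{1..2*r+1}. w (2*r+2-i) = 2*r+2 - w i)"
  by (simp add: B_group_def)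

lemma BW_permutes: "w \<in> BW r \<Longrightarrow> w permutes {1..2*r+1}"
  by (simp add: BW_iff)

lemma BW_star: "w \<in> BW r \<Longrightarrow> i \<in> {1..2*r+1} \<Longrightarrow> w (2*r+2-i) = 2*r+2 - w i"
  by (simp add: BW_iff)

lemma BW_range: "w \<in> BW r \<Longrightarrow> i \<in> {1..2*r+1} \<Longrightarrow> w i \<in> {1..2*r+1}"
  using BW_permutes permutes_in_image by metis

lemma BW_inj: "w \<in> BW r \<Longrightarrow> w i = w j \<longleftrightarrow> i = j"
  using BW_permutes permutes_inj inj_eq by metis

lemma BW_out: "w \<in> BW r \<Longrightarrow> i \<notin> {1..2*r+1} \<Longrightarrow> w i = i"
  by (meson BW_permutes permutes_not_in)

lemma BW_mid: assumes "w \<in> BW r" shows "w (r+1) = r+1"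
proof -
  have "w (2*r+2-(r+1)) = 2*r+2 - w (r+1)" by (rule BW_star[OF assms]) auto
  then show ?thesis by simp
qed

lemma BW_mid_iff: "w \<in> BW r \<Longrightarrow> w i = r+1 \<longleftrightarrow> i = r+1"
  using BW_mid BW_inj by metis

lemma BW_eqI:
  assumes "w \<in> BW r" "v \<in> BW r" "\<And>i. i \<in> {1..2*r+1} \<Longrightarrow> w i = v i"
  shows "w = v"
proof
  fix i show "w i = v i"
  proof (cases "i \<in> {1..2*r+1}")
    case True then show ?thesis by (rule assms(3))
  next
    case False
    then have "w i = i" "v i = i" using BW_out assms(1,2) by blast+
    then show ?thesis by (rule trans[OF _ sym])
  qed
qed

lemma BW_id [simp]: "id \<in> BW r"
  by (auto simp: BW_iff permutes_id)

lemma BW_comp [intro]: "w \<in> BW r \<Longrightarrow> v \<in> BW r \<Longrightarrow> w \<circ> v \<in> BW r"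
  using BW_range[of v r] unfolding BW_iff by (simp add: permutes_compose)

lemma BW_inv_apply [simp]:
  "w \<in> BW r \<Longrightarrow> w (pinv w i) = i" "w \<in> BW r \<Longrightarrow> pinv w (w i) = i"
  by (simp_all add: permutes_inverses[OF BW_permutes])

lemma BW_inv_comp [simp]:
  "w \<in> BW r \<Longrightarrow> w \<circ> pinv w = id" "w \<in> BW r \<Longrightarrow> pinv w \<circ> w = id"
  by (auto simp: fun_eq_iff)

lemma BW_inv [intro]: assumes "w \<in> BW r" shows "pinv w \<in> BW r"
proof -
  have p: "pinv w permutes {1..2*r+1}" using assms BW_permutes permutes_inv by blast
  have "pinv w (2*r+2-i) = 2*r+2 - pinv w i" if i: "i \<in> {1..2*r+1}" for i
  proof -
    have "pinv w i \<in> {1..2*r+1}" using i p permutes_in_image by metis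
    then have "w (2*r+2 - pinv w i) = 2*r+2 - i" using BW_star[OF assms] assms by simp
    then show ?thesis using BW_inv_apply(2)[OF assms] by metis
  qed
  with p show ?thesis by (simp add: BW_iff)
qed

lemma BW_inv_inv [simp]: "w \<in> BW r \<Longrightarrow> pinv (pinv w) = w"
  using BW_permutes permutes_inv_inv by blast

lemma BW_inv_of_comp: "w \<in> BW r \<Longrightarrow> v \<in> BW r \<Longrightarrow> pinv (w \<circ> v) = pinv v \<circ> pinv w"
  by (meson BW_permutes o_inv_distrib permutes_bij)

lemma B_group_mult [simp]: "x \<otimes>\<^bsub>B_group r\<^esub> y = x \<circ> y"
  by (simp add: B_group_def)
lemma B_group_one [simp]: "\<one>\<^bsub>B_group r\<^esub> = id"
  by (simp add: B_group_def)

lemma group_B: "group (B_group r)"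
proof (rule groupI)
  fix w assume "w \<in> BW r"
  then show "\<exists>v\<in>BW r. v \<otimes>\<^bsub>B_group r\<^esub> w = \<one>\<^bsub>B_group r\<^esub>"
    by (intro bexI[of _ "pinv w"]) auto
qed (auto simp: comp_assoc)

lemma B_group_inv: "w \<in> BW r \<Longrightarrow> inv\<^bsub>B_group r\<^esub> w = pinv w"
  by (rule group.inv_equality[OF group_B]) auto

lemma finite_BW: "finite (BW r)"
proof (rule finite_subset)
  show "BW r \<subseteq> {w. w permutes {1..2*r+1}}" by (auto simp: BW_iff)
  show "finite {w. w permutes {1..2*r+1}}" by (rule finite_permutations) simp
qed

lemma two_transpositions:
  assumes "distinct [a, b, c, d]"
  shows "(Transposition.transpose a b \<circ> Transposition.transpose c d) k =
    (if k = a then b else if k = b then a else if k = d then c else if k = c then d else k)"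
  using assms by (auto simp: Transposition.transpose_def)

lemma B_refl_apply:
  assumes "1 \<le> i" "i \<le> r"
  shows "B_refl r i k = (if k = i then next_pos r i else if k = next_pos r i then i
    else if k = 2*r+2-i then 2*r+2-next_pos r i else if k = 2*r+2-next_pos r i then 2*r+2-i else k)"
proof (cases "i < r")
  case True
  then have "distinct [i, i + 1, 2*r+1-i, 2*r+2-i]" "2*r+2-(i+1) = 2*r+1-i" by auto
  then show ?thesis using True by (simp only: B_refl_def next_pos_def if_True two_transpositions)
next
  case False
  then have "i = r" using assms by simp
  then show ?thesis by (simp add: B_refl_def next_pos_def Transposition.transpose_def)
qed

text \<open>The four points moved by a simple reflection, as variables tied by linear relations:
  this keeps truncated subtraction out of the case analyses.\<close>

lemma B_refl_form:
  assumes "i \<in> {1..r}"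
  obtains n i' n' where "next_pos r i = n" "2*r+2-i = i'" "2*r+2-n = n'" "i + i' = 2*r+2" "n + n' = 2*r+2"
    "(i < r \<and> n = i + 1) \<or> (i = r \<and> n = i')" "1 \<le> i" "1 \<le> n'"
    "\<And>k. B_refl r i k = (if k = i then n else if k = n then i else if k = i' then n' else if k = n' then i' else k)"
proof
  show "B_refl r i k = (if k = i then next_pos r i else if k = next_pos r i then i
    else if k = 2*r+2-i then 2*r+2-next_pos r i else if k = 2*r+2-next_pos r i then 2*r+2-i else k)" for k
    using assms by (intro B_refl_apply) auto
qed (use assms in \<open>auto simp: next_pos_def\<close>)

lemma B_refl_simps:
  assumes "i \<in> {1..r}"
  shows "B_refl r i i = next_pos r i" "B_refl r i (next_pos r i) = i"
  using assms by (simp_all add: B_refl_apply)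

lemma B_refl_refl [simp]:
  assumes "i \<in> {1..r}"
  shows "B_refl r i (B_refl r i k) = k"
  using assms by (rule B_refl_form) auto

lemma B_refl_comp [simp]: "i \<in> {1..r} \<Longrightarrow> B_refl r i \<circ> B_refl r i = id"
  by (auto simp: fun_eq_iff)

lemma B_refl_comp_left [simp]: "i \<in> {1..r} \<Longrightarrow> B_refl r i \<circ> (B_refl r i \<circ> w) = w"
  by (auto simp: fun_eq_iff)

lemma B_refl_comp_right [simp]: "i \<in> {1..r} \<Longrightarrow> w \<circ> B_refl r i \<circ> B_refl r i = w"
  by (auto simp: fun_eq_iff)

lemma B_refl_in [simp]: assumes "i \<in> {1..r}" shows "B_refl r i \<in> BW r"
  using assms
proof (rule B_refl_form)
  fix n i' n' assume f: "2*r+2-i = i'" "2*r+2-n = n'" "i + i' = 2*r+2" "n + n' = 2*r+2"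
    "(i < r \<and> n = i + 1) \<or> (i = r \<and> n = i')" "1 \<le> i" "1 \<le> n'"
    "\<And>k. B_refl r i k = (if k = i then n else if k = n then i else if k = i' then n' else if k = n' then i' else k)"
  have rg: "i \<in> {1..2*r+1}" "n \<in> {1..2*r+1}" "i' \<in> {1..2*r+1}" "n' \<in> {1..2*r+1}"
    using f(3-7) assms by auto
  have "B_refl r i permutes {1..2*r+1}"
  proof (rule bij_imp_permutes)
    show "bij_betw (B_refl r i) {1..2*r+1} {1..2*r+1}"
    proof (rule bij_betwI[of _ _ _ "B_refl r i"])
      show "B_refl r i \<in> {1..2*r+1} \<rightarrow> {1..2*r+1}"
        using rg unfolding f(8) by (simp add: Pi_iff)
      then show "B_refl r i \<in> {1..2*r+1} \<rightarrow> {1..2*r+1}" .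
    qed (use assms in auto)
    fix k assume "k \<notin> {1..2*r+1}"
    then show "B_refl r i k = k" using rg unfolding f(8) by metis
  qed
  moreover have "B_refl r i (2*r+2-k) = 2*r+2 - B_refl r i k" if "k \<in> {1..2*r+1}" for k
  proof -
    define k' where "k' = 2*r+2-k"
    then have k': "2*r+2-k = k'" "k + k' = 2*r+2" using that by auto
    have "B_refl r i k + B_refl r i k' = 2*r+2"
      using f(3-6) k'(2) unfolding f(8) by (auto split: if_splits)
    then show ?thesis using k' by simp
  qed
  ultimately show ?thesis by (simp add: BW_iff)
qed

lemma B_refl_inv [simp]: "i \<in> {1..r} \<Longrightarrow> pinv (B_refl r i) = B_refl r i"
  by (rule inv_unique_comp) simp_all

lemma next_pos_range: "i \<in> {1..r} \<Longrightarrow> next_pos r i \<in> {1..2*r+1}"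
  by (auto simp: next_pos_def)

text \<open>The simple reflection exchanges two neighbours of the chain \<open>1, \<dots>, r, r+2, \<dots>, 2r+1\<close>
  (and their mirror images), so it reverses no other pair.\<close>

definition special :: "nat \<Rightarrow> nat \<Rightarrow> nat \<Rightarrow> nat \<Rightarrow> bool" where
  "special r i a b \<longleftrightarrow> (a = i \<and> b = next_pos r i) \<or> (a = 2*r+2 - next_pos r i \<and> b = 2*r+2-i)"

lemma B_refl_mono:
  assumes "i \<in> {1..r}" "a \<noteq> r+1" "b \<noteq> r+1" "a < b" "\<not> special r i a b"
  shows "B_refl r i a < B_refl r i b"
  using assms(1)
proof (rule B_refl_form)
  fix n i' n' assume f: "next_pos r i = n" "2*r+2-i = i'" "2*r+2-n = n'" "i + i' = 2*r+2" "n + n' = 2*r+2"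
    "(i < r \<and> n = i + 1) \<or> (i = r \<and> n = i')"
    "\<And>k. B_refl r i k = (if k = i then n else if k = n then i else if k = i' then n' else if k = n' then i' else k)"
  have ns: "\<not> (a = i \<and> b = n)" "\<not> (a = n' \<and> b = i')"
    using assms(5) f(1-3) by (auto simp: special_def)
  show ?thesis
    using f(6)
  proof (elim disjE conjE)
    assume n: "i < r" "n = i + 1"
    then have i': "i' = n' + 1" "n < n'" using f(4,5) by linarith+
    have up: "B_refl r i k \<le> k + 1" and down: "k \<le> B_refl r i k + 1"
      and up': "k \<noteq> i \<Longrightarrow> k \<noteq> n' \<Longrightarrow> B_refl r i k \<le> k"
      and down': "k \<noteq> n \<Longrightarrow> k \<noteq> i' \<Longrightarrow> k \<le> B_refl r i k" for k
      unfolding f(7) using n(2) i'(1) by simp_all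
    show ?thesis
    proof (cases "b = a + 1")
      case True
      then have "a \<noteq> i" "a \<noteq> n'" "b \<noteq> n" "b \<noteq> i'" using ns n(2) i'(1) by auto
      then show ?thesis using up'[of a] down'[of b] assms(4) by linarith
    next
      case False
      then have "B_refl r i a \<le> B_refl r i b" using up[of a] down[of b] assms(4) by linarith
      moreover have "B_refl r i a \<noteq> B_refl r i b"
        using assms(1,4) B_refl_refl by (metis less_irrefl)
      ultimately show ?thesis by simp
    qed
  next
    assume n: "i = r" "n = i'"
    then have e: "i' = r + 2" "n' = r" using f(4,5) by linarith+
    have s: "B_refl r i k = (if k = r then r + 2 else if k = r + 2 then r else k)" for k
      using f(7)[of k] n e by simp
    consider "a = r" | "b = r + 2" | "a \<noteq> r" "b \<noteq> r + 2" by blast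
    then show ?thesis using ns n(2) e assms(2-4) unfolding s by cases simp_all
  qed
qed

lemma B_refl_special:
  assumes "i \<in> {1..r}" "special r i a b"
  shows "a < b" "B_refl r i a = b" "B_refl r i b = a" "a \<noteq> r+1" "b \<noteq> r+1" "a \<in> {1..2*r+1}" "b \<in> {1..2*r+1}"
proof -
  obtain n i' n' where f: "next_pos r i = n" "2*r+2-i = i'" "2*r+2-n = n'" "i + i' = 2*r+2" "n + n' = 2*r+2"
    "(i < r \<and> n = i + 1) \<or> (i = r \<and> n = i')" "1 \<le> i" "1 \<le> n'"
    "\<And>k. B_refl r i k = (if k = i then n else if k = n then i else if k = i' then n' else if k = n' then i' else k)"
    using assms(1) by (rule B_refl_form) (rule that)
  have ab: "a = i \<and> b = n \<or> a = n' \<and> b = i'" using assms(2) f(1-3) by (auto simp: special_def)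
  have ii: "i \<le> r" using assms(1) by simp
  have in': "i < n" "n \<le> 2*r+1" "i \<noteq> r+1" "n \<noteq> r+1" "n' \<noteq> r+1" "i' \<noteq> r+1" "n' < i'" "i' \<le> 2*r+1"
    using f(4-8) ii by linarith+
  have s1: "B_refl r i i = n" "B_refl r i n = i" using f(9)[of i] f(9)[of n] in'(1) by simp_all
  have s2: "B_refl r i n' = i'" "B_refl r i i' = n'"
  proof -
    have "i < r \<and> n < n' \<or> i' = n \<and> n' = i" using f(4-6) by linarith
    then show "B_refl r i n' = i'" "B_refl r i i' = n'"
      using f(9)[of n'] f(9)[of i'] in' s1 by auto
  qed
  have "a < b \<and> B_refl r i a = b \<and> B_refl r i b = a \<and> a \<noteq> r+1 \<and> b \<noteq> r+1 \<and> 1 \<le> a \<and> b \<le> 2*r+1"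
    using ab
  proof (elim disjE conjE)
    assume "a = i" "b = n"
    then show ?thesis using in' s1 f(7) by simp
  next
    assume "a = n'" "b = i'"
    then show ?thesis using in' s2 f(8) by simp
  qed
  then show "a < b" "B_refl r i a = b" "B_refl r i b = a" "a \<noteq> r+1" "b \<noteq> r+1"
    "a \<in> {1..2*r+1}" "b \<in> {1..2*r+1}" by auto
qed

lemma B_refl_mid: "i \<in> {1..r} \<Longrightarrow> B_refl r i k = r+1 \<longleftrightarrow> k = r+1"
  using BW_mid_iff B_refl_in by blast

definition inv1 :: "nat \<Rightarrow> (nat \<Rightarrow> nat) \<Rightarrow> (nat \<times> nat) set" where
  "inv1 r w = {(a, b). a \<in> {1..2*r+1} \<and> b \<in> {1..2*r+1} \<and> a \<noteq> r+1 \<and> b \<noteq> r+1 \<and> a < b \<and> w b < w a}"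

text \<open>Inversions that are their own mirror image.\<close>

definition inv2 :: "nat \<Rightarrow> (nat \<Rightarrow> nat) \<Rightarrow> (nat \<times> nat) set" where
  "inv2 r w = {(a, b) \<in> inv1 r w. a + b = 2*r+2}"

text \<open>The length counts orbits of inversions under the mirror symmetry.  An orbit has two elements unless
  its inversion is its own mirror image, so counting the latter twice gives twice the length.\<close>

definition inv_stat :: "nat \<Rightarrow> (nat \<Rightarrow> nat) \<Rightarrow> nat" where
  "inv_stat r w = card (inv1 r w) + card (inv2 r w)"

lemma finite_inv1: "finite (inv1 r w)"
  by (rule finite_subset[of _ "{1..2*r+1} \<times> {1..2*r+1}"]) (auto simp: inv1_def)

lemma finite_inv2: "finite (inv2 r w)"
  by (rule finite_subset[OF _ finite_inv1[of r w]]) (auto simp: inv2_def)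

text \<open>A simple reflection preserves the order of all pairs except the one that it exchanges and its
  mirror image; only these become new inversions.\<close>

lemma inv1_comp_refl:
  assumes w: "w \<in> BW r" and i: "i \<in> {1..r}" and asc: "w i < w (next_pos r i)"
  shows "inv1 r (w \<circ> B_refl r i)
    = map_prod (B_refl r i) (B_refl r i) ` inv1 r w \<union> {(a, b). special r i a b}"
    and "map_prod (B_refl r i) (B_refl r i) ` inv1 r w \<inter> {(a, b). special r i a b} = {}"
proof -
  let ?s = "B_refl r i"
  have sp: "w a < w b" if "special r i a b" for a b
  proof -
    have "w (2*r+2 - next_pos r i) = 2*r+2 - w (next_pos r i)" "w (2*r+2 - i) = 2*r+2 - w i"
      using BW_star[OF w] next_pos_range[OF i] i by auto
    moreover have "w i \<in> {1..2*r+1}" "w (next_pos r i) \<in> {1..2*r+1}"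
      using BW_range[OF w] next_pos_range[OF i] i by auto
    ultimately show ?thesis using that asc by (auto simp: special_def)
  qed
  have r: "?s a \<in> {1..2*r+1}" if "a \<in> {1..2*r+1}" for a
    using BW_range[OF B_refl_in[OF i] that] .
  have A: "(?s a, ?s b) \<in> inv1 r w" if "(a, b) \<in> inv1 r (w \<circ> ?s)" "\<not> special r i a b" for a b
    using that B_refl_mono[OF i, of a b] r B_refl_mid[OF i] by (auto simp: inv1_def)
  have B: "(?s a, ?s b) \<in> inv1 r (w \<circ> ?s)" "\<not> special r i (?s a) (?s b)" if "(a, b) \<in> inv1 r w" for a b
  proof -
    have ns: "\<not> special r i a b" using that sp by (force simp: inv1_def)
    have lt: "?s a < ?s b" using that B_refl_mono[OF i, of a b] ns by (auto simp: inv1_def)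
    show "(?s a, ?s b) \<in> inv1 r (w \<circ> ?s)"
      using that r B_refl_mid[OF i] lt i by (auto simp: inv1_def)
    show "\<not> special r i (?s a) (?s b)"
    proof
      assume "special r i (?s a) (?s b)"
      from B_refl_special(2,3)[OF i this] have "?s b = a" "?s a = b" using i by auto
      then show False using lt that by (auto simp: inv1_def)
    qed
  qed
  have C: "(a, b) \<in> inv1 r (w \<circ> ?s)" if "special r i a b" for a b
    using sp[OF that] B_refl_special[OF i that] by (auto simp: inv1_def)
  show "inv1 r (w \<circ> ?s) = map_prod ?s ?s ` inv1 r w \<union> {(a, b). special r i a b}"
  proof (intro equalityI subsetI)
    fix p assume "p \<in> inv1 r (w \<circ> ?s)"
    then obtain a b where p: "p = (a, b)" "(a, b) \<in> inv1 r (w \<circ> ?s)" by (cases p) auto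
    show "p \<in> map_prod ?s ?s ` inv1 r w \<union> {(a, b). special r i a b}"
    proof (cases "special r i a b")
      case False
      have "(a, b) = map_prod ?s ?s (?s a, ?s b)" using i by simp
      then show ?thesis using A[OF p(2) False] p(1) by blast
    qed (use p in auto)
  qed (use B C in auto)
  show "map_prod ?s ?s ` inv1 r w \<inter> {(a, b). special r i a b} = {}"
    using B(2) by auto
qed

lemma inv_stat_ascent:
  assumes w: "w \<in> BW r" and i: "i \<in> {1..r}" and asc: "w i < w (next_pos r i)"
  shows "inv_stat r (w \<circ> B_refl r i) = inv_stat r w + 2"
proof -
  let ?s = "B_refl r i" and ?S = "{(a, b). special r i a b}"
  let ?m = "map_prod ?s ?s"
  have inj: "inj_on ?m X" for X
    by (rule inj_on_inverseI[of _ ?m]) (use i in auto)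
  have sum: "?s a + ?s b = 2*r+2 \<longleftrightarrow> a + b = 2*r+2"
    if "a \<in> {1..2*r+1}" "b \<in> {1..2*r+1}" for a b
  proof -
    have "?s a + ?s b = 2*r+2" if "a + b = 2*r+2" "a \<in> {1..2*r+1}" "b \<in> {1..2*r+1}" for a b
    proof -
      have "b = 2*r+2-a" using that by simp
      then have "?s b = 2*r+2 - ?s a" using BW_star[OF B_refl_in[OF i]] that by simp
      moreover have "?s a \<in> {1..2*r+1}" using BW_range[OF B_refl_in[OF i]] that by simp
      ultimately show ?thesis by simp
    qed
    from this[of a b] this[of "?s a" "?s b"] show ?thesis
      using that BW_range[OF B_refl_in[OF i]] i by auto
  qed
  have S: "?S = {(i, next_pos r i), (2*r+2 - next_pos r i, 2*r+2-i)}" by (auto simp: special_def)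
  have c1: "card (inv1 r (w \<circ> ?s)) = card (inv1 r w) + card ?S"
    unfolding inv1_comp_refl(1)[OF assms]
    by (subst card_Un_disjoint) (use inv1_comp_refl(2)[OF assms] in \<open>auto simp: finite_inv1 S card_image inj\<close>)
  let ?S2 = "{(a, b) \<in> ?S. a + b = 2*r+2}"
  have "inv2 r (w \<circ> ?s) = ?m ` inv2 r w \<union> ?S2"
    unfolding inv2_def inv1_comp_refl(1)[OF assms] using sum by (force simp: inv1_def)
  moreover have "?m ` inv2 r w \<inter> ?S2 = {}"
    using inv1_comp_refl(2)[OF assms] by (auto simp: inv2_def)
  moreover have "finite ?S2" by (rule finite_subset[of _ ?S]) (auto simp: S)
  ultimately have c2: "card (inv2 r (w \<circ> ?s)) = card (inv2 r w) + card ?S2"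
    by (simp add: card_Un_disjoint finite_inv2 card_image inj)
  have "card ?S + card ?S2 = 2"
  proof (cases "i < r")
    case True
    then have "?S2 = {}" by (auto simp: S next_pos_def)
    then have "card ?S2 = 0" by (simp only: card.empty)
    moreover have "card ?S = 2" using True i by (auto simp: S next_pos_def card_insert_if)
    ultimately show ?thesis by simp
  next
    case False
    then have "i = r" using i by simp
    then have "?S = {(r, r+2)}" unfolding S by (simp add: next_pos_def)
    moreover from this have "?S2 = {(r, r+2)}" by auto
    ultimately show ?thesis by simp
  qed
  with c1 c2 show ?thesis by (simp add: inv_stat_def)
qed

definition rdesc :: "nat \<Rightarrow> (nat \<Rightarrow> nat) \<Rightarrow> nat \<Rightarrow> bool" where
  "rdesc r w i \<longleftrightarrow> w (next_pos r i) < w i"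

definition ldesc :: "nat \<Rightarrow> nat \<Rightarrow> (nat \<Rightarrow> nat) \<Rightarrow> bool" where
  "ldesc r i w \<longleftrightarrow> pinv w (next_pos r i) < pinv w i"

lemma next_pos_neq: "i \<in> {1..r} \<Longrightarrow> i \<noteq> next_pos r i"
  by (auto simp: next_pos_def)

lemma not_rdesc: "w \<in> BW r \<Longrightarrow> i \<in> {1..r} \<Longrightarrow> \<not> rdesc r w i \<longleftrightarrow> w i < w (next_pos r i)"
  using BW_inj[of w r i "next_pos r i"] next_pos_neq[of i r] by (auto simp: rdesc_def)

lemma rdesc_comp: "w \<in> BW r \<Longrightarrow> i \<in> {1..r} \<Longrightarrow> rdesc r (w \<circ> B_refl r i) i \<longleftrightarrow> \<not> rdesc r w i"
  by (simp add: not_rdesc) (simp add: rdesc_def B_refl_simps)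

lemma inv_stat_descent:
  assumes "w \<in> BW r" "i \<in> {1..r}" "rdesc r w i"
  shows "inv_stat r w = inv_stat r (w \<circ> B_refl r i) + 2"
proof -
  have v: "w \<circ> B_refl r i \<in> BW r" using assms by (intro BW_comp B_refl_in)
  have "\<not> rdesc r (w \<circ> B_refl r i) i" using rdesc_comp assms by blast
  then have "(w \<circ> B_refl r i) i < (w \<circ> B_refl r i) (next_pos r i)" using not_rdesc[OF v assms(2)] by blast
  from inv_stat_ascent[OF v assms(2) this] show ?thesis unfolding B_refl_comp_right[OF assms(2)] .
qed

text \<open>Without descents \<open>w\<close> is increasing along the chain of positions, so \<open>w i \<ge> i\<close> counting from
  the left end and \<open>w i \<le> i\<close> counting from the middle.\<close>

lemma no_rdesc_imp_id:
  assumes w: "w \<in> BW r" and asc: "\<And>i. i \<in> {1..r} \<Longrightarrow> \<not> rdesc r w i"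
  shows "w = id"
proof -
  have a: "w i < w (next_pos r i)" if "i \<in> {1..r}" for i
    using asc[OF that] not_rdesc[OF w that] by simp
  have lower: "i \<le> w i" if "i \<in> {1..r}" for i
    using that
  proof (induction i)
    case (Suc i)
    show ?case
    proof (cases "i = 0")
      case True
      then show ?thesis using BW_range[OF w, of "Suc i"] Suc by simp
    next
      case False
      then have "i \<le> w i" "w i < w (Suc i)" using Suc a[of i] by (auto simp: next_pos_def)
      then show ?thesis by simp
    qed
  qed simp
  have upper: "i \<le> r \<Longrightarrow> w (r - i) \<le> r - i" for i
  proof (induction i)
    case 0
    show ?case
    proof (cases "r = 0")
      case True then show ?thesis using BW_out[OF w, of 0] by simp
    next
      case False
      then have "w r < w (2*r+2-r)" using a[of r] by (simp add: next_pos_def)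
      also have "\<dots> = 2*r+2 - w r" using BW_star[OF w, of r] False by simp
      finally show ?thesis using BW_mid_iff[OF w, of r] by simp
    qed
  next
    case (Suc i)
    show ?case
    proof (cases "r - Suc i = 0")
      case True then show ?thesis using BW_out[OF w, of 0] by simp
    next
      case False
      then have "w (r - Suc i) < w (r - i)" using a[of "r - Suc i"] Suc by (simp add: next_pos_def Suc_diff_Suc)
      then show ?thesis using Suc by simp
    qed
  qed
  have low: "w i = i" if "i \<in> {1..r}" for i
    using lower[OF that] upper[of "r - i"] that by simp
  show ?thesis
  proof (rule BW_eqI[OF w BW_id])
    fix i assume i: "i \<in> {1..2*r+1}"
    consider "i \<le> r" | "i = r+1" | "r+2 \<le> i" by linarith
    then show "w i = id i"
    proof cases
      case 3
      then have "w (2*r+2-(2*r+2-i)) = 2*r+2 - w (2*r+2-i)" using i by (intro BW_star[OF w]) auto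
      moreover have "2*r+2-i \<in> {1..r}" using 3 i by auto
      ultimately show ?thesis using low[of "2*r+2-i"] i by simp
    qed (use low i BW_mid[OF w] in auto)
  qed
qed

lemma B_word_Nil [simp]: "B_word r [] = id" by (simp add: B_word_def)
lemma B_word_Cons [simp]: "B_word r (i # is) = B_refl r i \<circ> B_word r is" by (simp add: B_word_def)
lemma B_word_append: "B_word r (is @ js) = B_word r is \<circ> B_word r js"
  by (induction "is") (simp_all add: comp_assoc)

lemma B_word_in: "set is \<subseteq> {1..r} \<Longrightarrow> B_word r is \<in> BW r"
  by (induction "is") (auto intro!: BW_comp B_refl_in simp del: atLeastAtMost_iff)

lemma inv_stat_id: "inv_stat r id = 0"
proof -
  have "inv1 r id = {}" by (auto simp: inv1_def)
  moreover then have "inv2 r id = {}" by (auto simp: inv2_def)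
  ultimately show ?thesis by (simp add: inv_stat_def)
qed

lemma inv_stat_word:
  assumes "set is \<subseteq> {1..r}"
  shows "inv_stat r (B_word r is) \<le> 2 * length is"
  using assms
proof (induction "is" rule: rev_induct)
  case (snoc i "is")
  then have w: "B_word r is \<in> BW r" "i \<in> {1..r}" using B_word_in by auto
  have e: "B_word r (is @ [i]) = B_word r is \<circ> B_refl r i" by (simp add: B_word_append)
  have "inv_stat r (B_word r is) \<le> 2 * length is" using snoc by simp
  then show ?case unfolding e
    using inv_stat_ascent[OF w] inv_stat_descent[OF w] not_rdesc[OF w]
    by (cases "rdesc r (B_word r is) i") (simp_all del: o_apply)
qed (simp add: inv_stat_id)

lemma inv_stat_word_ex:
  assumes "w \<in> BW r"
  shows "\<exists>is. set is \<subseteq> {1..r} \<and> B_word r is = w \<and> inv_stat r w = 2 * length is"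
  using assms
proof (induction "inv_stat r w" arbitrary: w rule: less_induct)
  case less
  show ?case
  proof (cases "\<exists>i\<in>{1..r}. rdesc r w i")
    case True
    then obtain i where i: "i \<in> {1..r}" "rdesc r w i" by blast
    note d = inv_stat_descent[OF less.prems i]
    then obtain "is" where "set is \<subseteq> {1..r}" "B_word r is = w \<circ> B_refl r i"
      "inv_stat r (w \<circ> B_refl r i) = 2 * length is"
      using less.hyps[of "w \<circ> B_refl r i"] less.prems i by (auto simp: BW_comp)
    moreover from this(2) have "B_word r (is @ [i]) = w" using i by (simp add: B_word_append)
    ultimately show ?thesis using i d by (intro exI[of _ "is @ [i]"]) simp
  next
    case False
    then have "w = id" using no_rdesc_imp_id[OF less.prems] by blast
    then show ?thesis by (intro exI[of _ "[]"]) (simp add: inv_stat_id)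
  qed
qed

text \<open>A word of length \<open>k\<close> has statistic at most \<open>2 k\<close>, and removing descents one by one produces a
  word for which equality holds.\<close>

lemma B_length_inv_stat:
  assumes "w \<in> BW r"
  shows "inv_stat r w = 2 * B_length r w"
proof -
  obtain "is" where "is": "set is \<subseteq> {1..r}" "B_word r is = w" "inv_stat r w = 2 * length is"
    using inv_stat_word_ex[OF assms] by blast
  have "B_length r w = length is"
    unfolding B_length_def
  proof (rule Least_equality)
    fix k assume "\<exists>js. set js \<subseteq> {1..r} \<and> B_word r js = w \<and> length js = k"
    then show "length is \<le> k" using inv_stat_word "is"(3) by fastforce
  qed (use "is" in blast)
  with "is" show ?thesis by simp
qed

lemma B_reduced_exists:
  assumes "w \<in> BW r"
  shows "\<exists>is. B_reduced r w is"
  using inv_stat_word_ex[OF assms] B_length_inv_stat[OF assms] by (auto simp: B_reduced_def)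

lemma length_right_ascent:
  assumes "w \<in> BW r" "i \<in> {1..r}" "\<not> rdesc r w i"
  shows "B_length r (w \<circ> B_refl r i) = B_length r w + 1"
  using assms inv_stat_ascent[of w r i] not_rdesc[of w r i]
    B_length_inv_stat[of w r] B_length_inv_stat[of "w \<circ> B_refl r i" r] BW_comp B_refl_in by auto

lemma length_right_descent:
  assumes "w \<in> BW r" "i \<in> {1..r}" "rdesc r w i"
  shows "B_length r w = B_length r (w \<circ> B_refl r i) + 1"
  using assms length_right_ascent[of "w \<circ> B_refl r i" r i] by (auto simp: rdesc_comp BW_comp)

lemma inv_refl_comp: "w \<in> BW r \<Longrightarrow> i \<in> {1..r} \<Longrightarrow> pinv (B_refl r i \<circ> w) = pinv w \<circ> B_refl r i"
  using BW_inv_of_comp[OF B_refl_in, of i r w] by simp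

lemma inv_comp_refl: "w \<in> BW r \<Longrightarrow> i \<in> {1..r} \<Longrightarrow> pinv (w \<circ> B_refl r i) = B_refl r i \<circ> pinv w"
  using BW_inv_of_comp[OF _ B_refl_in, of w r i] by simp

lemma B_word_rev: "set is \<subseteq> {1..r} \<Longrightarrow> B_word r (rev is) = pinv (B_word r is)"
  by (induction "is") (simp_all add: B_word_append inv_refl_comp B_word_in)

lemma length_inv_le: assumes "w \<in> BW r" shows "B_length r (pinv w) \<le> B_length r w"
proof -
  obtain "is" where "is": "B_reduced r w is" using B_reduced_exists[OF assms] by blast
  then have "inv_stat r (pinv w) \<le> 2 * length is"
    using inv_stat_word[of "rev is" r] B_word_rev[of "is" r] by (auto simp: B_reduced_def)
  then show ?thesis using "is" B_length_inv_stat[OF BW_inv[OF assms]] by (simp add: B_reduced_def)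
qed

lemma length_inv: assumes "w \<in> BW r" shows "B_length r (pinv w) = B_length r w"
  using length_inv_le[OF assms] length_inv_le[OF BW_inv[OF assms]] assms by simp

lemma ldesc_inv: "w \<in> BW r \<Longrightarrow> ldesc r i (pinv w) \<longleftrightarrow> rdesc r w i"
  by (simp add: ldesc_def rdesc_def)

lemma rdesc_inv: "rdesc r (pinv w) i \<longleftrightarrow> ldesc r i w"
  by (simp add: ldesc_def rdesc_def)

lemma ldesc_comp: "w \<in> BW r \<Longrightarrow> i \<in> {1..r} \<Longrightarrow> ldesc r i (B_refl r i \<circ> w) \<longleftrightarrow> \<not> ldesc r i w"
  using rdesc_comp[of "pinv w" r i] by (simp add: inv_refl_comp BW_inv flip: rdesc_inv)

lemma length_left_ascent:
  assumes "w \<in> BW r" "i \<in> {1..r}" "\<not> ldesc r i w"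
  shows "B_length r (B_refl r i \<circ> w) = B_length r w + 1"
  using length_right_ascent[of "pinv w" r i] assms length_inv[of w r] length_inv[of "B_refl r i \<circ> w" r]
  by (auto simp: rdesc_inv inv_refl_comp BW_inv BW_comp)

lemma length_left_descent:
  assumes "w \<in> BW r" "i \<in> {1..r}" "ldesc r i w"
  shows "B_length r w = B_length r (B_refl r i \<circ> w) + 1"
  using length_left_ascent[of "B_refl r i \<circ> w" r i] assms by (auto simp: ldesc_comp BW_comp)

lemma rdesc_iff_length:
  "w \<in> BW r \<Longrightarrow> i \<in> {1..r} \<Longrightarrow> rdesc r w i \<longleftrightarrow> B_length r (w \<circ> B_refl r i) < B_length r w"
  using length_right_ascent[of w r i] length_right_descent[of w r i] by force

lemma ldesc_iff_length:
  "w \<in> BW r \<Longrightarrow> i \<in> {1..r} \<Longrightarrow> ldesc r i w \<longleftrightarrow> B_length r (B_refl r i \<circ> w) < B_length r w"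
  using length_left_ascent[of w r i] length_left_descent[of w r i] by force

lemma B_refl_fix:
  assumes i: "i \<in> {1..r}" and sp: "special r i a b"
    and x: "x \<noteq> a" "x \<noteq> b" "x \<noteq> 2*r+2-a" "x \<noteq> 2*r+2-b"
  shows "B_refl r i x = x"
proof -
  have ii: "1 \<le> i" "i \<le> r" using i by auto
  have "2*r+2 - (2*r+2 - i) = i" "2*r+2 - (2*r+2 - next_pos r i) = next_pos r i"
    using ii next_pos_range[OF i] by auto
  then have "x \<noteq> i" "x \<noteq> next_pos r i" "x \<noteq> 2*r+2-i" "x \<noteq> 2*r+2-next_pos r i"
    using sp x unfolding special_def by metis+
  then show ?thesis by (simp only: B_refl_apply[OF ii] if_False)
qed

text \<open>Conjugating a simple reflection by \<open>w\<close> gives the reflection exchanging the images under \<open>w\<close> of the two neighbours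
  and their mirror images; if these images are again neighbours, it is simple.\<close>

lemma refl_conj:
  assumes w: "w \<in> BW r" and i: "i \<in> {1..r}" and j: "j \<in> {1..r}"
    and sp: "special r j (w i) (w (next_pos r i)) \<or> special r j (w (next_pos r i)) (w i)"
  shows "w \<circ> B_refl r i = B_refl r j \<circ> w"
proof (rule BW_eqI)
  have ir: "i \<in> {1..2*r+1}" using i by auto
  note nr = next_pos_range[OF i]
  have wr: "w i \<in> {1..2*r+1}" "w (next_pos r i) \<in> {1..2*r+1}"
    using BW_range[OF w] ir nr by blast+
  note stw = BW_star[OF w ir] BW_star[OF w nr]
  note sti = BW_star[OF B_refl_in[OF i] ir] BW_star[OF B_refl_in[OF i] nr]
  note stj = BW_star[OF B_refl_in[OF j] wr(1)] BW_star[OF B_refl_in[OF j] wr(2)]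
  have sj: "B_refl r j (w i) = w (next_pos r i)" "B_refl r j (w (next_pos r i)) = w i"
    using sp B_refl_special[OF j] by blast+
  note si = B_refl_simps[OF i]
  fix k
  consider "k = i" | "k = next_pos r i" | "k = 2*r+2-i" | "k = 2*r+2-next_pos r i"
    | (f) "k \<noteq> i" "k \<noteq> next_pos r i" "k \<noteq> 2*r+2-i" "k \<noteq> 2*r+2-next_pos r i" by blast
  then show "(w \<circ> B_refl r i) k = (B_refl r j \<circ> w) k"
  proof cases
    case f
    have "w k \<noteq> w i" "w k \<noteq> w (next_pos r i)" "w k \<noteq> 2*r+2-w i" "w k \<noteq> 2*r+2-w (next_pos r i)"
      using f unfolding stw[symmetric] BW_inj[OF w] by blast+
    then have "B_refl r j (w k) = w k"
      using sp B_refl_fix[OF j] by blast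
    moreover have "special r i i (next_pos r i)" by (simp add: special_def)
    then have "B_refl r i k = k" using f by (intro B_refl_fix[OF i])
    ultimately show ?thesis by (simp only: comp_apply)
  qed (simp_all only: comp_apply stw sti stj si sj)
qed (use w i j in \<open>auto intro!: BW_comp B_refl_in simp del: atLeastAtMost_iff\<close>)

text \<open>The exchange property, in the form that makes left and right multiplication operators commute:
  right multiplication by a simple reflection changes the order of the two relevant values only if
  it exchanges exactly them, and then it agrees with left multiplication.\<close>

lemma ldesc_right_mult:
  assumes w: "w \<in> BW r" and i: "i \<in> {1..r}" and j: "j \<in> {1..r}"
    and ne: "B_refl r i \<circ> w \<noteq> w \<circ> B_refl r j"
  shows "ldesc r i (w \<circ> B_refl r j) \<longleftrightarrow> ldesc r i w"
proof -
  let ?v = "pinv w"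
  have v: "?v \<in> BW r" using w by auto
  have nsp: "\<not> special r j (?v i) (?v (next_pos r i))" "\<not> special r j (?v (next_pos r i)) (?v i)"
  proof -
    have "?v \<circ> B_refl r i \<noteq> B_refl r j \<circ> ?v"
    proof
      assume "?v \<circ> B_refl r i = B_refl r j \<circ> ?v"
      then have "pinv (?v \<circ> B_refl r i) = pinv (B_refl r j \<circ> ?v)" by simp
      then show False using ne i j v w by (simp add: inv_refl_comp inv_comp_refl)
    qed
    then show "\<not> special r j (?v i) (?v (next_pos r i))" "\<not> special r j (?v (next_pos r i)) (?v i)"
      using refl_conj[OF v i j] by blast+
  qed
  have rg: "?v i \<noteq> r+1" "?v (next_pos r i) \<noteq> r+1"
    using i unfolding BW_mid_iff[OF v] by (auto simp: next_pos_def)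
  have "?v i \<noteq> ?v (next_pos r i)" using BW_inj[OF v] next_pos_neq[OF i] by simp
  then show ?thesis
    using B_refl_mono[OF j rg(1,2)] B_refl_mono[OF j rg(2,1)] nsp w j
    by (auto simp: ldesc_def inv_comp_refl) (metis linorder_less_linear order_less_asym)+
qed

lemma rdesc_left_mult:
  assumes w: "w \<in> BW r" and i: "i \<in> {1..r}" and j: "j \<in> {1..r}"
    and ne: "B_refl r i \<circ> w \<noteq> w \<circ> B_refl r j"
  shows "rdesc r (B_refl r i \<circ> w) j \<longleftrightarrow> rdesc r w j"
proof -
  have "B_refl r j \<circ> pinv w \<noteq> pinv w \<circ> B_refl r i"
  proof
    assume "B_refl r j \<circ> pinv w = pinv w \<circ> B_refl r i"
    then have "pinv (B_refl r j \<circ> pinv w) = pinv (pinv w \<circ> B_refl r i)" by simp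
    then show False using ne w i j BW_inv[OF w] by (simp add: inv_refl_comp inv_comp_refl)
  qed
  from ldesc_right_mult[OF BW_inv[OF w] j i this] show ?thesis
    using w i by (simp add: ldesc_inv BW_comp flip: inv_refl_comp)
qed

section \<open>Operators of the Hecke algebra on functions on the group\<close>

type_synonym wfun = "(nat \<Rightarrow> nat) \<Rightarrow> laurent"

text \<open>Left multiplication by the \<open>i\<close>-th generator in coordinates.  The coefficient of \<open>T\<^sub>w\<close> in \<open>T\<^sub>i v\<close> collects
  \<open>T\<^sub>i T\<^sub>s\<^sub>w = T\<^sub>w\<close> and the first term of \<open>T\<^sub>i T\<^sub>w = (q - 1) T\<^sub>w + q T\<^sub>s\<^sub>w\<close> if \<open>s\<close> is a descent of \<open>w\<close>, and only the second term
  of \<open>T\<^sub>i T\<^sub>s\<^sub>w = (q - 1) T\<^sub>s\<^sub>w + q T\<^sub>w\<close> otherwise.\<close>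

definition Lmul :: "nat \<Rightarrow> nat \<Rightarrow> wfun \<Rightarrow> wfun" where
  "Lmul r i v = (\<lambda>w. if w \<in> BW r then
     (if ldesc r i w then v (B_refl r i \<circ> w) + (q_laurent - 1) * v w
      else q_laurent * v (B_refl r i \<circ> w)) else 0)"

definition Rmul :: "nat \<Rightarrow> nat \<Rightarrow> wfun \<Rightarrow> wfun" where
  "Rmul r i v = (\<lambda>w. if w \<in> BW r then
     (if rdesc r w i then v (w \<circ> B_refl r i) + (q_laurent - 1) * v w
      else q_laurent * v (w \<circ> B_refl r i)) else 0)"

lemma Lmul_apply:
  "w \<in> BW r \<Longrightarrow> Lmul r i v w = (if ldesc r i w then v (B_refl r i \<circ> w) + (q_laurent - 1) * v w
      else q_laurent * v (B_refl r i \<circ> w))"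
  by (simp add: Lmul_def)

lemma Rmul_apply:
  "w \<in> BW r \<Longrightarrow> Rmul r i v w = (if rdesc r w i then v (w \<circ> B_refl r i) + (q_laurent - 1) * v w
      else q_laurent * v (w \<circ> B_refl r i))"
  by (simp add: Rmul_def)

lemma Lmul_out: "w \<notin> BW r \<Longrightarrow> Lmul r i v w = 0" by (simp add: Lmul_def)
lemma Rmul_out: "w \<notin> BW r \<Longrightarrow> Rmul r i v w = 0" by (simp add: Rmul_def)

lemma refl_comp_in [simp]:
  "w \<in> BW r \<Longrightarrow> i \<in> {1..r} \<Longrightarrow> B_refl r i \<circ> w \<in> BW r"
  "w \<in> BW r \<Longrightarrow> i \<in> {1..r} \<Longrightarrow> w \<circ> B_refl r i \<in> BW r"
  by (blast intro: BW_comp B_refl_in)+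

lemma Lmul_add: "Lmul r i (\<lambda>w. u w + v w) = (\<lambda>w. Lmul r i u w + Lmul r i v w)"
  by (auto simp: Lmul_def fun_eq_iff algebra_simps)
lemma Lmul_smult: "Lmul r i (\<lambda>w. a * v w) = (\<lambda>w. a * Lmul r i v w)"
  by (auto simp: Lmul_def fun_eq_iff algebra_simps)
lemma Lmul_zero [simp]: "Lmul r i (\<lambda>w. 0) = (\<lambda>w. 0)"
  by (auto simp: Lmul_def fun_eq_iff)
lemma Rmul_add: "Rmul r i (\<lambda>w. u w + v w) = (\<lambda>w. Rmul r i u w + Rmul r i v w)"
  by (auto simp: Rmul_def fun_eq_iff algebra_simps)
lemma Rmul_smult: "Rmul r i (\<lambda>w. a * v w) = (\<lambda>w. a * Rmul r i v w)"
  by (auto simp: Rmul_def fun_eq_iff algebra_simps)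
lemma Rmul_zero [simp]: "Rmul r i (\<lambda>w. 0) = (\<lambda>w. 0)"
  by (auto simp: Rmul_def fun_eq_iff)

lemma Lmul_quadratic:
  assumes i: "i \<in> {1..r}" and w: "w \<in> BW r"
  shows "Lmul r i (Lmul r i v) w = (q_laurent - 1) * Lmul r i v w + q_laurent * v w"
  using refl_comp_in(1)[OF w i] w ldesc_comp[OF w i] B_refl_comp_left[OF i, of w]
  by (simp add: Lmul_apply algebra_simps del: B_refl_comp_left)

lemma ldesc_refl:
  "w \<in> BW r \<Longrightarrow> j \<in> {1..r} \<Longrightarrow>
    ldesc r i (B_refl r j \<circ> w) \<longleftrightarrow> pinv w (B_refl r j (next_pos r i)) < pinv w (B_refl r j i)"
  by (simp only: ldesc_def inv_refl_comp comp_apply)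

text \<open>If \<open>s w \<noteq> w t\<close>, the two descent conditions do not influence each other, and both sides are the same
  combination of the values at \<open>w\<close>, \<open>s w\<close>, \<open>w t\<close> and \<open>s w t\<close>.  If \<open>s w = w t\<close>, the two operators act in the same way
  on the values at \<open>w\<close> and \<open>s w\<close>.\<close>

lemma Lmul_Rmul_commute:
  assumes i: "i \<in> {1..r}" and j: "j \<in> {1..r}"
  shows "Lmul r i (Rmul r j v) = Rmul r j (Lmul r i v)"
proof
  fix w
  show "Lmul r i (Rmul r j v) w = Rmul r j (Lmul r i v) w"
  proof (cases "w \<in> BW r")
    case w: True
    let ?s = "B_refl r i" and ?t = "B_refl r j"
    have cl: "?s \<circ> w \<in> BW r" "w \<circ> ?t \<in> BW r" using w i j by simp_all
    show ?thesis
    proof (cases "?s \<circ> w = w \<circ> ?t")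
      case True
      have "?s \<circ> (?s \<circ> w) = w" "w \<circ> ?t \<circ> ?t = w" using i j by simp_all
      then have e: "(?s \<circ> w) \<circ> ?t = w" "?s \<circ> (w \<circ> ?t) = w" using True by simp_all
      have d: "ldesc r i w \<longleftrightarrow> rdesc r w j"
        unfolding ldesc_iff_length[OF w i] rdesc_iff_length[OF w j] True ..
      have d': "ldesc r i (w \<circ> ?t) \<longleftrightarrow> \<not> ldesc r i w" using ldesc_comp[OF w i] True by simp
      have d'': "rdesc r (?s \<circ> w) j \<longleftrightarrow> \<not> rdesc r w j" using rdesc_comp[OF w j] True by simp
      show ?thesis
        unfolding Lmul_apply[OF w] Rmul_apply[OF w] Lmul_apply[OF cl(2)] Rmul_apply[OF cl(1)] d' d'' e d
        using True by (simp add: algebra_simps del: o_apply)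
    next
      case False
      have e: "?s \<circ> (w \<circ> ?t) = (?s \<circ> w) \<circ> ?t" by (simp only: comp_assoc)
      show ?thesis
        unfolding Lmul_apply[OF w] Rmul_apply[OF w] Lmul_apply[OF cl(2)] Rmul_apply[OF cl(1)]
          ldesc_right_mult[OF w i j False] rdesc_left_mult[OF w i j False] e
        by (simp add: algebra_simps del: o_apply)
    qed
  qed (simp add: Lmul_out Rmul_out)
qed

text \<open>The braid relations are checked on the positions that a pair of simple reflections moves.  The
  pairs are of three types: far apart, adjacent in the part of type A, and the last two.\<close>

lemma refl_far:
  assumes "i \<in> {1..r}" "j \<in> {1..r}" "i + 1 < j"
  shows "B_refl r i j = j" "B_refl r i (next_pos r j) = next_pos r j" "B_refl r j i = i" "B_refl r j (next_pos r i) = next_pos r i"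
proof -
  have ii: "1 \<le> i" "i \<le> r" and jj: "1 \<le> j" "j \<le> r" using assms by auto
  have "i < r" using assms by auto
  then have n: "next_pos r i = i + 1" "2*r+2-next_pos r i = 2*r+1-i" by (auto simp: next_pos_def)
  have "j < 2*r+1-i" "j < 2*r+2-i" "next_pos r j \<noteq> i" "next_pos r j \<noteq> i+1" "next_pos r j < 2*r+1-i" "next_pos r j < 2*r+2-i"
    using assms by (auto simp: next_pos_def)
  then show "B_refl r i j = j" "B_refl r i (next_pos r j) = next_pos r j"
    unfolding B_refl_apply[OF ii] n using assms by auto
  have "2*r+2-j \<noteq> i" "2*r+2-j \<noteq> i+1" "2*r+2-next_pos r j \<noteq> i" "2*r+2-next_pos r j \<noteq> i + 1"
    using assms by (auto simp: next_pos_def)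
  then show "B_refl r j i = i" "B_refl r j (next_pos r i) = next_pos r i"
    unfolding B_refl_apply[OF jj] n using assms \<open>next_pos r j \<noteq> i\<close> \<open>next_pos r j \<noteq> i+1\<close> by auto
qed

lemma refl_far_commute:
  assumes "i \<in> {1..r}" "j \<in> {1..r}" "i + 1 < j"
  shows "B_refl r i \<circ> B_refl r j = B_refl r j \<circ> B_refl r i"
proof -
  have "special r i (B_refl r j i) (B_refl r j (next_pos r i))"
    unfolding refl_far[OF assms] by (simp add: special_def)
  then show ?thesis using refl_conj[OF B_refl_in[OF assms(2)] assms(1,1)] by simp
qed

lemma refl_near:
  assumes "1 \<le> i" "i + 1 < r"
  shows "B_refl r i i = i+1" "B_refl r i (i+1) = i" "B_refl r i (i+2) = i+2"
    "B_refl r (i+1) i = i" "B_refl r (i+1) (i+1) = i+2" "B_refl r (i+1) (i+2) = i+1"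
    "next_pos r i = i+1" "next_pos r (i+1) = i+2"
  using assms by (auto simp: B_refl_apply next_pos_def)

lemma refl_near_braid:
  assumes "1 \<le> i" "i + 1 < r"
  shows "B_refl r i \<circ> (B_refl r (i+1) \<circ> B_refl r i) = B_refl r (i+1) \<circ> (B_refl r i \<circ> B_refl r (i+1))"
proof -
  let ?s = "B_refl r i" and ?t = "B_refl r (i+1)"
  have i: "i \<in> {1..r}" "i+1 \<in> {1..r}" using assms by auto
  have "special r (i+1) ((?s \<circ> ?t) i) ((?s \<circ> ?t) (next_pos r i))"
    using refl_near[OF assms] by (simp add: special_def)
  from refl_conj[OF BW_comp[OF B_refl_in[OF i(1)] B_refl_in[OF i(2)]] i disjI1[OF this]]
  show ?thesis by (simp only: comp_assoc)
qed

lemma refl_last: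
  assumes "2 \<le> r"
  shows "B_refl r (r-1) (r-1) = r" "B_refl r (r-1) r = r-1" "B_refl r (r-1) (r+2) = r+3" "B_refl r (r-1) (r+3) = r+2"
    "B_refl r r (r-1) = r-1" "B_refl r r r = r+2" "B_refl r r (r+2) = r" "B_refl r r (r+3) = r+3"
    "next_pos r (r-1) = r" "next_pos r r = r+2"
proof -
  obtain m where m: "r = m + 2" using assms by (metis le_Suc_ex add.commute)
  show "B_refl r (r-1) (r-1) = r" "B_refl r (r-1) r = r-1" "B_refl r (r-1) (r+2) = r+3" "B_refl r (r-1) (r+3) = r+2"
    "B_refl r r (r-1) = r-1" "B_refl r r r = r+2" "B_refl r r (r+2) = r" "B_refl r r (r+3) = r+3"
    "next_pos r (r-1) = r" "next_pos r r = r+2"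
    unfolding m by (simp_all add: B_refl_apply next_pos_def)
qed

lemma refl_last_braid:
  assumes "2 \<le> r"
  shows "B_refl r (r-1) \<circ> (B_refl r r \<circ> (B_refl r (r-1) \<circ> B_refl r r))
       = B_refl r r \<circ> (B_refl r (r-1) \<circ> (B_refl r r \<circ> B_refl r (r-1)))"
proof -
  let ?s = "B_refl r (r-1)" and ?t = "B_refl r r"
  have i: "r-1 \<in> {1..r}" "r \<in> {1..r}" using assms by auto
  have "special r r ((?s \<circ> (?t \<circ> ?s)) r) ((?s \<circ> (?t \<circ> ?s)) (next_pos r r))"
    using refl_last[OF assms] by (simp add: special_def)
  from refl_conj[OF BW_comp[OF B_refl_in[OF i(1)] BW_comp[OF B_refl_in[OF i(2)] B_refl_in[OF i(1)]]] i(2,2) disjI1[OF this]]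
  show ?thesis by (simp only: comp_assoc)
qed

lemma pinv_last:
  assumes "w \<in> BW r" "2 \<le> r"
  shows "pinv w (r+2) = 2*r+2 - pinv w r" "pinv w (r+3) = 2*r+2 - pinv w (r-1)"
proof -
  have e: "2*r+2-r = r+2" "2*r+2-(r-1) = r+3" using assms(2) by auto
  have m: "r \<in> {1..2*r+1}" "r-1 \<in> {1..2*r+1}" using assms(2) by auto
  show "pinv w (r+2) = 2*r+2 - pinv w r" "pinv w (r+3) = 2*r+2 - pinv w (r-1)"
    using BW_star[OF BW_inv[OF assms(1)] m(1)] BW_star[OF BW_inv[OF assms(1)] m(2)] by (simp_all only: e)
qed

lemma pinv_last_range:
  assumes "w \<in> BW r" "2 \<le> r"
  shows "pinv w (r-1) \<in> {1..2*r+1}" "pinv w r \<in> {1..2*r+1}"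
    "pinv w (r-1) \<noteq> pinv w r" "pinv w (r-1) + pinv w r \<noteq> 2*r+2" "pinv w r \<noteq> r+1" "pinv w (r-1) \<noteq> r+1"
proof -
  have m: "r \<in> {1..2*r+1}" "r-1 \<in> {1..2*r+1}" using assms(2) by auto
  note v = BW_inv[OF assms(1)]
  show rg: "pinv w (r-1) \<in> {1..2*r+1}" "pinv w r \<in> {1..2*r+1}" using BW_range[OF v] m by blast+
  show "pinv w (r-1) \<noteq> pinv w r" "pinv w r \<noteq> r+1" "pinv w (r-1) \<noteq> r+1"
    unfolding BW_inj[OF v] BW_mid_iff[OF v] using assms(2) by auto
  have "pinv w (r-1) \<noteq> pinv w (r+2)" unfolding BW_inj[OF v] by auto
  then show "pinv w (r-1) + pinv w r \<noteq> 2*r+2" unfolding pinv_last[OF assms] by linarith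
qed

lemma Lmul_far:
  assumes "i \<in> {1..r}" "j \<in> {1..r}" "i + 1 < j"
  shows "Lmul r i (Lmul r j v) = Lmul r j (Lmul r i v)"
proof
  fix w
  show "Lmul r i (Lmul r j v) w = Lmul r j (Lmul r i v) w"
  proof (cases "w \<in> BW r")
    case w: True
    have "ldesc r i (B_refl r j \<circ> w) = ldesc r i w" "ldesc r j (B_refl r i \<circ> w) = ldesc r j w"
      unfolding ldesc_refl[OF w assms(1)] ldesc_refl[OF w assms(2)] refl_far[OF assms]
      by (simp_all add: ldesc_def)
    moreover have "B_refl r j \<circ> (B_refl r i \<circ> w) = B_refl r i \<circ> (B_refl r j \<circ> w)"
      using refl_far_commute[OF assms] by (simp only: comp_assoc[symmetric])
    ultimately show ?thesis
      using w refl_comp_in(1)[OF w assms(1)] refl_comp_in(1)[OF w assms(2)]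
      by (simp add: Lmul_apply algebra_simps del: o_apply)
  qed (simp add: Lmul_out)
qed

lemma ldesc_near:
  assumes "1 \<le> i" "i + 1 < r" and w: "w \<in> BW r"
  defines "a \<equiv> pinv w i" and "b \<equiv> pinv w (i+1)" and "c \<equiv> pinv w (i+2)"
    and "s \<equiv> B_refl r i" and "t \<equiv> B_refl r (i+1)"
  shows "ldesc r i w \<longleftrightarrow> b < a" "ldesc r (i+1) w \<longleftrightarrow> c < b"
    "ldesc r (i+1) (s \<circ> w) \<longleftrightarrow> c < a" "ldesc r i (t \<circ> w) \<longleftrightarrow> c < a"
    "ldesc r i (s \<circ> w) \<longleftrightarrow> a < b" "ldesc r (i+1) (t \<circ> w) \<longleftrightarrow> b < c"
    "ldesc r i (t \<circ> (s \<circ> w)) \<longleftrightarrow> c < b" "ldesc r (i+1) (s \<circ> (t \<circ> w)) \<longleftrightarrow> b < a"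
    "ldesc r (i+1) (t \<circ> (s \<circ> w)) \<longleftrightarrow> a < c" "ldesc r i (s \<circ> (t \<circ> w)) \<longleftrightarrow> a < c"
proof -
  have i: "i \<in> {1..r}" "i+1 \<in> {1..r}" using assms by auto
  note n = refl_near[OF assms(1,2)]
  have u: "pinv (s \<circ> w) k = pinv w (s k)" "pinv (t \<circ> w) k = pinv w (t k)" for k
    unfolding s_def t_def inv_refl_comp[OF w i(1)] inv_refl_comp[OF w i(2)] comp_apply by simp_all
  have sw: "s \<circ> w \<in> BW r" "t \<circ> w \<in> BW r" using w i unfolding s_def t_def by (blast intro: refl_comp_in)+
  have u2: "pinv (t \<circ> (s \<circ> w)) k = pinv w (s (t k))" "pinv (s \<circ> (t \<circ> w)) k = pinv w (t (s k))" for k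
    using inv_refl_comp[OF sw(1) i(2)] inv_refl_comp[OF sw(2) i(1)] u
    unfolding s_def[symmetric] t_def[symmetric] by simp_all
  note n' = n[folded s_def t_def]
  show "ldesc r i w \<longleftrightarrow> b < a" "ldesc r (i+1) w \<longleftrightarrow> c < b"
    "ldesc r (i+1) (s \<circ> w) \<longleftrightarrow> c < a" "ldesc r i (t \<circ> w) \<longleftrightarrow> c < a"
    "ldesc r i (s \<circ> w) \<longleftrightarrow> a < b" "ldesc r (i+1) (t \<circ> w) \<longleftrightarrow> b < c"
    "ldesc r i (t \<circ> (s \<circ> w)) \<longleftrightarrow> c < b" "ldesc r (i+1) (s \<circ> (t \<circ> w)) \<longleftrightarrow> b < a"
    "ldesc r (i+1) (t \<circ> (s \<circ> w)) \<longleftrightarrow> a < c" "ldesc r i (s \<circ> (t \<circ> w)) \<longleftrightarrow> a < c"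
    unfolding ldesc_def u2 u n' a_def b_def c_def by (rule refl)+
qed

text \<open>On a coset of the subgroup generated by the two reflections, all descents are determined by
  the relative order of three values; each of the six orders gives a polynomial identity in \<open>q\<close>.\<close>

lemma Lmul_near:
  assumes "1 \<le> i" "i + 1 < r"
  shows "Lmul r i (Lmul r (i+1) (Lmul r i v)) = Lmul r (i+1) (Lmul r i (Lmul r (i+1) v))"
proof
  fix w
  show "Lmul r i (Lmul r (i+1) (Lmul r i v)) w = Lmul r (i+1) (Lmul r i (Lmul r (i+1) v)) w"
  proof (cases "w \<in> BW r")
    case w: True
    define s t where "s = B_refl r i" and "t = B_refl r (i+1)"
    have i: "i \<in> {1..r}" "i+1 \<in> {1..r}" using assms by auto
    note d = ldesc_near[OF assms w, folded s_def t_def]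
    have cl: "s \<circ> y \<in> BW r" "t \<circ> y \<in> BW r" if "y \<in> BW r" for y
      using that i unfolding s_def t_def by (blast intro: refl_comp_in)+
    note c1 = cl[OF w]
    note c2 = cl(2)[OF c1(1)] cl(1)[OF c1(2)]
    have can: "s \<circ> (s \<circ> y) = y" "t \<circ> (t \<circ> y) = y" for y :: "nat \<Rightarrow> nat"
      using B_refl_comp_left i unfolding s_def t_def by blast+
    have br: "s \<circ> (t \<circ> (s \<circ> w)) = t \<circ> (s \<circ> (t \<circ> w))"
      using refl_near_braid[OF assms, folded s_def t_def] by (metis comp_assoc)
    define a b c where "a = pinv w i" and "b = pinv w (i+1)" and "c = pinv w (i+2)"
    note d' = d[folded a_def b_def c_def]
    have ne: "a \<noteq> b" "b \<noteq> c" "a \<noteq> c"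
      unfolding a_def b_def c_def BW_inj[OF BW_inv[OF w]] by simp_all
    note L = Lmul_apply[of _ r i, folded s_def] Lmul_apply[of _ r "i+1", folded t_def]
    consider "a < b" "b < c" "a < c" | "a < c" "c < b" "a < b" | "b < a" "a < c" "b < c"
      | "b < c" "c < a" "b < a" | "c < a" "a < b" "c < b" | "c < b" "b < a" "c < a"
      using ne by linarith
    then show ?thesis
      unfolding L(1)[OF w] L(2)[OF w] L(1)[OF c1(1)] L(1)[OF c1(2)] L(2)[OF c1(1)] L(2)[OF c1(2)]
        L(1)[OF c2(1)] L(1)[OF c2(2)] L(2)[OF c2(1)] L(2)[OF c2(2)] d' can br
      by cases (simp_all add: not_less_iff_gr_or_eq algebra_simps del: o_apply)
  qed (simp add: Lmul_out)
qed

text \<open>With \<open>a\<close> and \<open>b\<close> measured from the middle, the four conditions read \<open>b < a\<close>, \<open>0 < a + b\<close>, \<open>0 < b\<close> and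
  \<open>0 < a\<close>.\<close>

lemma ldesc_last:
  assumes r: "2 \<le> r" and w: "w \<in> BW r"
  defines "a \<equiv> pinv w (r-1)" and "b \<equiv> pinv w r"
    and "s \<equiv> B_refl r (r-1)" and "t \<equiv> B_refl r r"
  defines "p \<equiv> b < a" and "x \<equiv> 2*r+2 < a + b" and "f \<equiv> r + 1 < b" and "g \<equiv> r + 1 < a"
  shows "ldesc r (r-1) w \<longleftrightarrow> p" "ldesc r r w \<longleftrightarrow> f"
    "ldesc r (r-1) (s \<circ> w) \<longleftrightarrow> \<not> p" "ldesc r r (s \<circ> w) \<longleftrightarrow> g"
    "ldesc r (r-1) (t \<circ> w) \<longleftrightarrow> x" "ldesc r r (t \<circ> w) \<longleftrightarrow> \<not> f"
    "ldesc r (r-1) (t \<circ> (s \<circ> w)) \<longleftrightarrow> x" "ldesc r r (t \<circ> (s \<circ> w)) \<longleftrightarrow> \<not> g"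
    "ldesc r (r-1) (s \<circ> (t \<circ> w)) \<longleftrightarrow> \<not> x" "ldesc r r (s \<circ> (t \<circ> w)) \<longleftrightarrow> g"
    "ldesc r (r-1) (s \<circ> (t \<circ> (s \<circ> w))) \<longleftrightarrow> \<not> x" "ldesc r r (s \<circ> (t \<circ> (s \<circ> w))) \<longleftrightarrow> f"
    "ldesc r (r-1) (t \<circ> (s \<circ> (t \<circ> w))) \<longleftrightarrow> p" "ldesc r r (t \<circ> (s \<circ> (t \<circ> w))) \<longleftrightarrow> \<not> g"
    and "(p \<and> x \<and> g) \<or> (p \<and> \<not> x \<and> \<not> f) \<or> (\<not> p \<and> x \<and> f) \<or> (\<not> p \<and> \<not> x \<and> \<not> g)"
proof -
  have i: "r-1 \<in> {1..r}" "r \<in> {1..r}" using assms by auto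
  note n = refl_last[OF r, folded s_def t_def]
  have cl: "s \<circ> y \<in> BW r" "t \<circ> y \<in> BW r" if "y \<in> BW r" for y
    using that i unfolding s_def t_def by (blast intro: refl_comp_in)+
  have u: "pinv (s \<circ> y) k = pinv y (s k)" "pinv (t \<circ> y) k = pinv y (t k)" if "y \<in> BW r" for k y
    using inv_refl_comp[OF that i(1)] inv_refl_comp[OF that i(2)] unfolding s_def t_def by simp_all
  note c1 = cl[OF w]
  note c2 = cl(2)[OF c1(1)] cl(1)[OF c1(2)]
  note U = u[OF w] u(2)[OF c1(1)] u(1)[OF c1(2)] u(1)[OF c2(1)] u(2)[OF c2(2)]
  define a' b' where "a' = 2*r+2 - a" and "b' = 2*r+2 - b"
  have rg: "a + a' = 2*r+2" "b + b' = 2*r+2" "a \<noteq> b" "a + b \<noteq> 2*r+2" "b \<noteq> r+1" "a \<noteq> r+1"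
    using pinv_last_range[OF w r, folded a_def b_def] unfolding a'_def b'_def by auto
  have x: "pinv w (r-1) = a" "pinv w r = b" "pinv w (r+2) = b'" "pinv w (r+3) = a'"
    unfolding pinv_last[OF w r] a_def b_def a'_def b'_def by simp_all
  have l: "ldesc r (r-1) y \<longleftrightarrow> pinv y r < pinv y (r-1)" "ldesc r r y \<longleftrightarrow> pinv y (r+2) < pinv y r" for y
    unfolding ldesc_def n by (rule refl)+
  show "ldesc r (r-1) w \<longleftrightarrow> p" "ldesc r r w \<longleftrightarrow> f"
    "ldesc r (r-1) (s \<circ> w) \<longleftrightarrow> \<not> p" "ldesc r r (s \<circ> w) \<longleftrightarrow> g"
    "ldesc r (r-1) (t \<circ> w) \<longleftrightarrow> x" "ldesc r r (t \<circ> w) \<longleftrightarrow> \<not> f"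
    "ldesc r (r-1) (t \<circ> (s \<circ> w)) \<longleftrightarrow> x" "ldesc r r (t \<circ> (s \<circ> w)) \<longleftrightarrow> \<not> g"
    "ldesc r (r-1) (s \<circ> (t \<circ> w)) \<longleftrightarrow> \<not> x" "ldesc r r (s \<circ> (t \<circ> w)) \<longleftrightarrow> g"
    "ldesc r (r-1) (s \<circ> (t \<circ> (s \<circ> w))) \<longleftrightarrow> \<not> x" "ldesc r r (s \<circ> (t \<circ> (s \<circ> w))) \<longleftrightarrow> f"
    "ldesc r (r-1) (t \<circ> (s \<circ> (t \<circ> w))) \<longleftrightarrow> p" "ldesc r r (t \<circ> (s \<circ> (t \<circ> w))) \<longleftrightarrow> \<not> g"
    unfolding l U n x p_def x_def f_def g_def using rg by linarith+
  show "(p \<and> x \<and> g) \<or> (p \<and> \<not> x \<and> \<not> f) \<or> (\<not> p \<and> x \<and> f) \<or> (\<not> p \<and> \<not> x \<and> \<not> g)"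
    unfolding p_def x_def f_def g_def using rg(3-6) by linarith
qed

text \<open>Here the descents on a coset are determined by the relative order of two values \<open>a\<close>, \<open>b\<close> and their mirror
  images, which leaves eight cases.\<close>

lemma Lmul_last:
  assumes r: "2 \<le> r"
  shows "Lmul r (r-1) (Lmul r r (Lmul r (r-1) (Lmul r r v))) = Lmul r r (Lmul r (r-1) (Lmul r r (Lmul r (r-1) v)))"
proof
  fix w
  show "Lmul r (r-1) (Lmul r r (Lmul r (r-1) (Lmul r r v))) w = Lmul r r (Lmul r (r-1) (Lmul r r (Lmul r (r-1) v))) w"
  proof (cases "w \<in> BW r")
    case w: True
    define s t where "s = B_refl r (r-1)" and "t = B_refl r r"
    have i: "r-1 \<in> {1..r}" "r \<in> {1..r}" using assms by auto
    define p x f g where "p \<longleftrightarrow> pinv w r < pinv w (r-1)" and "x \<longleftrightarrow> 2*r+2 < pinv w (r-1) + pinv w r"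
      and "f \<longleftrightarrow> r + 1 < pinv w r" and "g \<longleftrightarrow> r + 1 < pinv w (r-1)"
    note d = ldesc_last[OF r w, folded s_def t_def, folded p_def x_def f_def g_def]
    have cl: "s \<circ> y \<in> BW r" "t \<circ> y \<in> BW r" if "y \<in> BW r" for y
      using that i unfolding s_def t_def by (blast intro: refl_comp_in)+
    note c1 = cl[OF w]
    note c2 = cl(2)[OF c1(1)] cl(1)[OF c1(2)]
    note c3 = cl(1)[OF c2(1)] cl(2)[OF c2(2)]
    have can: "s \<circ> (s \<circ> y) = y" "t \<circ> (t \<circ> y) = y" for y :: "nat \<Rightarrow> nat"
      using B_refl_comp_left i unfolding s_def t_def by blast+
    have br: "s \<circ> (t \<circ> (s \<circ> (t \<circ> w))) = t \<circ> (s \<circ> (t \<circ> (s \<circ> w)))"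
      using refl_last_braid[OF assms, folded s_def t_def] by (metis comp_assoc)
    note L = Lmul_apply[of _ r "r-1", folded s_def] Lmul_apply[of _ r r, folded t_def]
    from d(15) consider "p" "x" "g" "f" | "p" "x" "g" "\<not> f" | "p" "\<not> x" "\<not> f" "g" | "p" "\<not> x" "\<not> f" "\<not> g"
      | "\<not> p" "x" "f" "g" | "\<not> p" "x" "f" "\<not> g" | "\<not> p" "\<not> x" "\<not> g" "f" | "\<not> p" "\<not> x" "\<not> g" "\<not> f"
      by blast
    then show ?thesis
      unfolding L(1)[OF w] L(2)[OF w] L(1)[OF c1(1)] L(1)[OF c1(2)] L(2)[OF c1(1)] L(2)[OF c1(2)]
        L(1)[OF c2(1)] L(1)[OF c2(2)] L(2)[OF c2(1)] L(2)[OF c2(2)]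
        L(1)[OF c3(1)] L(1)[OF c3(2)] L(2)[OF c3(1)] L(2)[OF c3(2)] d(1-14) can br
      by cases (simp_all add: algebra_simps del: o_apply)
  qed (simp add: Lmul_out)
qed

subsection \<open>The Hecke algebra acting on functions on the group\<close>

definition Lmul_word :: "nat \<Rightarrow> nat list \<Rightarrow> wfun \<Rightarrow> wfun" where
  "Lmul_word r is v = foldr (Lmul r) is v"

lemma Lmul_word_simps [simp]: "Lmul_word r [] v = v" "Lmul_word r (i # is) v = Lmul r i (Lmul_word r is v)"
  by (simp_all add: Lmul_word_def)

lemma Lmul_word_append: "Lmul_word r (is @ js) v = Lmul_word r is (Lmul_word r js v)"
  by (simp add: Lmul_word_def)

lemma Lmul_word_add: "Lmul_word r is (\<lambda>w. u w + v w) = (\<lambda>w. Lmul_word r is u w + Lmul_word r is v w)"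
  by (induction "is") (simp_all add: Lmul_add)

lemma Lmul_word_smult: "Lmul_word r is (\<lambda>w. a * v w) = (\<lambda>w. a * Lmul_word r is v w)"
  by (induction "is") (simp_all add: Lmul_smult)

lemma Lmul_word_zero [simp]: "Lmul_word r is (\<lambda>w. 0) = (\<lambda>w. 0)"
  by (induction "is") simp_all

definition supp :: "nat \<Rightarrow> wfun \<Rightarrow> bool" where
  "supp r v \<longleftrightarrow> (\<forall>w. w \<notin> BW r \<longrightarrow> v w = 0)"

lemma supp_Lmul_word: "supp r v \<Longrightarrow> supp r (Lmul_word r is v)"
  by (cases "is") (auto simp: supp_def Lmul_def)

lemma supp_Rmul: "supp r (Rmul r i v)"
  by (auto simp: supp_def Rmul_def)

definition word_act :: "nat \<Rightarrow> (nat list \<Rightarrow>\<^sub>0 laurent) \<Rightarrow> wfun \<Rightarrow> wfun" where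
  "word_act r F v = (\<lambda>w. lin_ext (\<lambda>is a. a * Lmul_word r is v w) F)"

lemma word_act_simps [simp]:
  "word_act r 0 v = (\<lambda>w. 0)"
  "word_act r (F + G) v = (\<lambda>w. word_act r F v w + word_act r G v w)"
  "word_act r (F - G) v = (\<lambda>w. word_act r F v w - word_act r G v w)"
  "word_act r (- F) v = (\<lambda>w. - word_act r F v w)"
  "word_act r (Poly_Mapping.single is a) v = (\<lambda>w. a * Lmul_word r is v w)"
  unfolding word_act_def
  by (simp_all add: lin_ext_add lin_ext_diff lin_ext_uminus lin_ext_single ring_distribs)

lemma word_act_zero_right [simp]: "word_act r F (\<lambda>w. 0) = (\<lambda>w. 0)"
  by (simp add: word_act_def lin_ext_def)

abbreviation words :: "nat \<Rightarrow> nat list monoid" where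
  "words r \<equiv> \<lparr>carrier = lists {1..r}, mult = (@), one = []\<rparr>"

lemma monoid_words: "monoid (words r)"
  by (rule monoidI) auto

lemma free_alg_eq: "free_alg r = monoid_ring (words r)"
  by (simp add: free_alg_def)

lemma free_alg_ring: "ring (free_alg r)"
  unfolding free_alg_eq by (rule monoid.monoid_ring_is_ring[OF monoid_words])

lemma free_alg_carrier: "F \<in> carrier (free_alg r) \<longleftrightarrow> Poly_Mapping.keys F \<subseteq> lists {1..r}"
  by (simp add: free_alg_eq monoid_ring_carrier)

lemma single_free_alg [simp]: "is \<in> lists {1..r} \<Longrightarrow> Poly_Mapping.single is a \<in> carrier (free_alg r)"
  by (simp add: free_alg_eq)

lemma free_alg_single_mult [simp]:
  "Poly_Mapping.single is a \<otimes>\<^bsub>free_alg r\<^esub> Poly_Mapping.single js b = Poly_Mapping.single (is @ js) (a * b)"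
  by (simp add: free_alg_eq)

lemma free_alg_add [simp]: "F \<oplus>\<^bsub>free_alg r\<^esub> G = F + G" by (simp add: free_alg_eq)
lemma free_alg_zero [simp]: "\<zero>\<^bsub>free_alg r\<^esub> = 0" by (simp add: free_alg_eq)
lemma free_alg_one: "\<one>\<^bsub>free_alg r\<^esub> = Poly_Mapping.single [] 1" by (simp add: free_alg_eq monoid_ring_one)

lemma free_alg_distrib:
  "(F + G) \<otimes>\<^bsub>free_alg r\<^esub> H = F \<otimes>\<^bsub>free_alg r\<^esub> H + G \<otimes>\<^bsub>free_alg r\<^esub> H"
  "F \<otimes>\<^bsub>free_alg r\<^esub> (G + H) = F \<otimes>\<^bsub>free_alg r\<^esub> G + F \<otimes>\<^bsub>free_alg r\<^esub> H"
  "0 \<otimes>\<^bsub>free_alg r\<^esub> H = 0" "F \<otimes>\<^bsub>free_alg r\<^esub> 0 = 0"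
  by (simp_all add: free_alg_eq monoid_ring_mult_add_left monoid_ring_mult_add_right)

lemma free_alg_induct [consumes 1, case_names zero single add]:
  assumes "F \<in> carrier (free_alg r)" "P 0"
    and "\<And>is a. is \<in> lists {1..r} \<Longrightarrow> P (Poly_Mapping.single is a)"
    and "\<And>F G. F \<in> carrier (free_alg r) \<Longrightarrow> G \<in> carrier (free_alg r) \<Longrightarrow> P F \<Longrightarrow> P G \<Longrightarrow> P (F + G)"
  shows "P F"
  using assms unfolding free_alg_carrier by (rule monoid_ring_induct)

lemma Lmul_word_word_act:
  assumes "G \<in> carrier (free_alg r)"
  shows "Lmul_word r is (word_act r G v) w = word_act r (Poly_Mapping.single is 1 \<otimes>\<^bsub>free_alg r\<^esub> G) v w"
  using assms
  by (induction arbitrary: w rule: free_alg_induct)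
    (simp_all add: free_alg_distrib Lmul_word_smult Lmul_word_append Lmul_word_add)

lemma word_act_mult:
  assumes "F \<in> carrier (free_alg r)" "G \<in> carrier (free_alg r)"
  shows "word_act r (F \<otimes>\<^bsub>free_alg r\<^esub> G) v = word_act r F (word_act r G v)"
  using assms(1)
proof (induction rule: free_alg_induct)
  case (single "is" a)
  have "word_act r (Poly_Mapping.single is a \<otimes>\<^bsub>free_alg r\<^esub> G) v w
      = a * word_act r (Poly_Mapping.single is 1 \<otimes>\<^bsub>free_alg r\<^esub> G) v w" for w
    using assms(2) by (induction rule: free_alg_induct) (simp_all add: free_alg_distrib algebra_simps)
  then show ?case using Lmul_word_word_act[OF assms(2)] by simp
qed (simp_all add: free_alg_distrib)

lemma supp_word_act: "supp r v \<Longrightarrow> supp r (word_act r F v)"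
  using supp_Lmul_word by (auto simp: word_act_def supp_def lin_ext_def)

text \<open>The elements that act as zero form an ideal; it contains the Hecke relations because these hold
  for the operators.  So the action descends to the Hecke algebra.\<close>

lemma word_act_kernel_ideal: "ideal {F \<in> carrier (free_alg r). \<forall>v. supp r v \<longrightarrow> word_act r F v = (\<lambda>w. 0)} (free_alg r)"
  unfolding free_alg_eq
proof (rule monoid.monoid_ring_idealI[OF monoid_words], fold free_alg_eq)
  interpret FA: ring "free_alg r" by (rule free_alg_ring)
  let ?J = "{F \<in> carrier (free_alg r). \<forall>v. supp r v \<longrightarrow> word_act r F v = (\<lambda>w. 0)}"
  fix F G assume F: "F \<in> ?J" and G: "G \<in> ?J"
  show "F + G \<in> ?J" using F G FA.a_closed[of F G] by simp
  show "- F \<in> ?J" using F by (auto simp: free_alg_carrier)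
  fix "is" :: "nat list" and a assume "is \<in> carrier (words r)"
  then have s: "Poly_Mapping.single is a \<in> carrier (free_alg r)" by simp
  show "Poly_Mapping.single is a \<otimes>\<^bsub>free_alg r\<^esub> F \<in> ?J"
    using F s by (auto simp: word_act_mult simp del: word_act_simps(5))
  show "F \<otimes>\<^bsub>free_alg r\<^esub> Poly_Mapping.single is a \<in> ?J"
    using F s supp_word_act[of r _ "Poly_Mapping.single is a"] by (auto simp: word_act_mult simp del: word_act_simps(5))
qed (auto simp: free_alg_carrier)

lemma hecke_rels_carrier: "hecke_rels r \<subseteq> carrier (free_alg r)"
proof -
  interpret FA: ring "free_alg r" by (rule free_alg_ring)
  have d: "F - G \<in> carrier (free_alg r)" if "F \<in> carrier (free_alg r)" "G \<in> carrier (free_alg r)" for F G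
    using that keys_diff[of F G] by (auto simp: free_alg_carrier)
  have a: "F + G \<in> carrier (free_alg r)" if "F \<in> carrier (free_alg r)" "G \<in> carrier (free_alg r)" for F G
    using FA.a_closed[OF that] by simp
  show ?thesis
    unfolding hecke_rels_def Let_def by (auto intro!: d a single_free_alg split: if_splits)
qed

lemma word_act_rels:
  assumes "F \<in> hecke_rels r" "supp r v"
  shows "word_act r F v = (\<lambda>w. 0)"
proof -
  consider i where "1 \<le> i" "i \<le> r"
      "F = Poly_Mapping.single [i, i] 1 - (Poly_Mapping.single [i] (q_laurent - 1) + Poly_Mapping.single [] q_laurent)"
    | i j where "i \<in> {1..r}" "j \<in> {1..r}" "i + 1 < j \<or> j + 1 < i"
      "F = Poly_Mapping.single [i, j] 1 - Poly_Mapping.single [j, i] 1"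
    | i where "1 \<le> i" "i + 1 < r" "F = Poly_Mapping.single [i, i+1, i] 1 - Poly_Mapping.single [i+1, i, i+1] 1"
    | "2 \<le> r" "F = Poly_Mapping.single [r-1, r, r-1, r] 1 - Poly_Mapping.single [r, r-1, r, r-1] 1"
  proof -
    have a: "1 < \<bar>int i - int j\<bar> \<longleftrightarrow> i + 1 < j \<or> j + 1 < i" for i j by linarith
    show thesis
      using assms(1) that unfolding hecke_rels_def Let_def a
      by (auto split: if_splits)
  qed
  then show ?thesis
  proof cases
    case (1 i)
    have "Lmul r i (Lmul r i v) w = (q_laurent - 1) * Lmul r i v w + q_laurent * v w" for w
    proof (cases "w \<in> BW r")
      case True then show ?thesis using 1 by (intro Lmul_quadratic) auto
    next
      case False then show ?thesis using assms(2) by (simp add: Lmul_out supp_def)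
    qed
    then show ?thesis by (simp add: 1)
  next
    case (2 i j)
    have "Lmul r i (Lmul r j v) = Lmul r j (Lmul r i v)"
      using 2(3) Lmul_far[OF 2(1,2)] Lmul_far[OF 2(2,1)] by metis
    then show ?thesis by (simp add: 2)
  next
    case (3 i)
    show ?thesis using Lmul_near[OF 3(1,2), of v] by (simp add: 3)
  next
    case 4
    show ?thesis using Lmul_last[OF 4(1), of v] by (simp add: 4)
  qed
qed

lemma hecke_ideal_ideal: "ideal (hecke_ideal r) (free_alg r)"
  unfolding hecke_ideal_def by (rule ring.genideal_ideal[OF free_alg_ring hecke_rels_carrier])

lemma hecke_ideal_rel: "F \<in> hecke_rels r \<Longrightarrow> F \<in> hecke_ideal r"
  unfolding hecke_ideal_def using ring.genideal_self[OF free_alg_ring hecke_rels_carrier] by auto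

lemma hecke_ideal_word_act:
  assumes "F \<in> hecke_ideal r" "supp r v"
  shows "word_act r F v = (\<lambda>w. 0)"
proof -
  have "hecke_ideal r \<subseteq> {F \<in> carrier (free_alg r). \<forall>v. supp r v \<longrightarrow> word_act r F v = (\<lambda>w. 0)}"
    unfolding hecke_ideal_def
    by (rule ring.genideal_minimal[OF free_alg_ring word_act_kernel_ideal])
      (use word_act_rels hecke_rels_carrier in blast)
  then show ?thesis using assms by auto
qed

lemma hecke_ring: "ring (hecke r)"
  unfolding hecke_def by (rule ideal.quotient_is_ring[OF hecke_ideal_ideal])

abbreviation hecke_class :: "nat \<Rightarrow> (nat list \<Rightarrow>\<^sub>0 laurent) \<Rightarrow> hecke_elt" where
  "hecke_class r F \<equiv> hecke_ideal r +>\<^bsub>free_alg r\<^esub> F"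

lemma hecke_class_hom: "ring_hom_ring (free_alg r) (hecke r) (hecke_class r)"
  unfolding hecke_def by (rule ideal.rcos_ring_hom_ring[OF hecke_ideal_ideal])

lemma hecke_class_closed [simp]: "F \<in> carrier (free_alg r) \<Longrightarrow> hecke_class r F \<in> carrier (hecke r)"
  using ring_hom_ring.homh[OF hecke_class_hom] ring_hom_closed by metis

lemma hecke_class_mult: "F \<in> carrier (free_alg r) \<Longrightarrow> G \<in> carrier (free_alg r) \<Longrightarrow>
    hecke_class r F \<otimes>\<^bsub>hecke r\<^esub> hecke_class r G = hecke_class r (F \<otimes>\<^bsub>free_alg r\<^esub> G)"
  using ring_hom_ring.homh[OF hecke_class_hom] ring_hom_mult by metis

lemma hecke_class_add: "F \<in> carrier (free_alg r) \<Longrightarrow> G \<in> carrier (free_alg r) \<Longrightarrow>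
    hecke_class r F \<oplus>\<^bsub>hecke r\<^esub> hecke_class r G = hecke_class r (F + G)"
  using ring_hom_add[OF ring_hom_ring.homh[OF hecke_class_hom], where x = F and y = G] by simp

lemma hecke_class_one: "\<one>\<^bsub>hecke r\<^esub> = hecke_class r (Poly_Mapping.single [] 1)"
  using ring_hom_ring.homh[OF hecke_class_hom] ring_hom_one by (metis free_alg_one)

lemma hecke_class_zero: "\<zero>\<^bsub>hecke r\<^esub> = hecke_class r 0"
  using ring_hom_zero[OF ring_hom_ring.homh[OF hecke_class_hom] free_alg_ring hecke_ring] by simp

lemma hecke_carrierE:
  assumes "h \<in> carrier (hecke r)"
  obtains F where "F \<in> carrier (free_alg r)" "h = hecke_class r F"
  using assms by (auto simp: hecke_def FactRing_def A_RCOSETS_def' a_r_coset_def)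

lemma hecke_class_eq_iff:
  assumes "F \<in> carrier (free_alg r)" "G \<in> carrier (free_alg r)"
  shows "hecke_class r F = hecke_class r G \<longleftrightarrow> F - G \<in> hecke_ideal r"
proof -
  have "F \<ominus>\<^bsub>free_alg r\<^esub> G = F - G"
    using assms monoid.monoid_ring_minus[OF monoid_words] by (simp add: free_alg_eq)
  then show ?thesis
    using ring.quotient_eq_iff_same_a_r_cos[OF free_alg_ring hecke_ideal_ideal assms] by simp
qed

section \<open>The standard basis of the Hecke algebra\<close>

subsection \<open>Reduced words\<close>

lemma length_le_word:
  assumes "set is \<subseteq> {1..r}"
  shows "B_length r (B_word r is) \<le> length is"
  using inv_stat_word[OF assms] B_length_inv_stat[OF B_word_in[OF assms]] by simp

lemma B_reduced_Cons:
  assumes w: "w \<in> BW r"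
  shows "B_reduced r w (i # is) \<longleftrightarrow> i \<in> {1..r} \<and> ldesc r i w \<and> B_reduced r (B_refl r i \<circ> w) is"
proof
  assume red: "B_reduced r w (i # is)"
  then have i: "i \<in> {1..r}" and s: "set is \<subseteq> {1..r}" and e: "B_refl r i \<circ> B_word r is = w"
    and l: "length is + 1 = B_length r w"
    by (auto simp: B_reduced_def)
  have e': "B_word r is = B_refl r i \<circ> w" using B_refl_comp_left[OF i, of "B_word r is"] e by simp
  have le: "B_length r (B_refl r i \<circ> w) \<le> length is" using length_le_word[OF s] e' by simp
  have d: "ldesc r i w"
    using length_left_ascent[OF w i] le l by (cases "ldesc r i w") auto
  then show "i \<in> {1..r} \<and> ldesc r i w \<and> B_reduced r (B_refl r i \<circ> w) is"
    using i s e' l length_left_descent[OF w i d] by (simp add: B_reduced_def)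
next
  assume a: "i \<in> {1..r} \<and> ldesc r i w \<and> B_reduced r (B_refl r i \<circ> w) is"
  then have i: "i \<in> {1..r}" and d: "ldesc r i w" by auto
  have "B_refl r i \<circ> B_word r is = w" using a B_refl_comp_left[OF i, of w] by (simp add: B_reduced_def)
  then show "B_reduced r w (i # is)"
    using a length_left_descent[OF w i d] by (simp add: B_reduced_def)
qed

lemma B_length_id: "B_length r id = 0"
  using length_le_word[of "[]" r] by simp

lemma B_reduced_Nil: "B_reduced r w [] \<longleftrightarrow> w = id"
  by (auto simp: B_reduced_def B_length_id)

definition T_word :: "nat \<Rightarrow> nat list \<Rightarrow> hecke_elt" where
  "T_word r is = hecke_class r (Poly_Mapping.single is 1)"

lemma T_word_closed [simp]: "set is \<subseteq> {1..r} \<Longrightarrow> T_word r is \<in> carrier (hecke r)"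
  unfolding T_word_def by (intro hecke_class_closed single_free_alg) auto

lemma T_word_append: "set is \<subseteq> {1..r} \<Longrightarrow> set js \<subseteq> {1..r} \<Longrightarrow>
    T_word r (is @ js) = T_word r is \<otimes>\<^bsub>hecke r\<^esub> T_word r js"
  unfolding T_word_def by (subst hecke_class_mult) (auto simp: lists_eq_set)

lemma T_word_Cons: "i \<in> {1..r} \<Longrightarrow> set is \<subseteq> {1..r} \<Longrightarrow>
    T_word r (i # is) = T_word r [i] \<otimes>\<^bsub>hecke r\<^esub> T_word r is"
  using T_word_append[of "[i]" r "is"] by simp

lemma T_word_braid_eqI:
  assumes "set is \<subseteq> {1..r}" "set js \<subseteq> {1..r}"
    "Poly_Mapping.single is 1 - Poly_Mapping.single js 1 \<in> hecke_rels r"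
  shows "T_word r is = T_word r js"
  unfolding T_word_def
  using assms(1,2) hecke_ideal_rel[OF assms(3)] by (subst hecke_class_eq_iff) (auto simp: lists_eq_set)

lemma T_word_far: "i \<in> {1..r} \<Longrightarrow> j \<in> {1..r} \<Longrightarrow> i + 1 < j \<Longrightarrow> T_word r [i, j] = T_word r [j, i]"
proof (rule T_word_braid_eqI)
  assume a: "i \<in> {1..r}" "j \<in> {1..r}" "i + 1 < j"
  then have "1 \<le> i" "i \<le> r" "1 \<le> j" "j \<le> r" "1 < \<bar>int i - int j\<bar>" by auto
  then show "Poly_Mapping.single [i, j] 1 - Poly_Mapping.single [j, i] 1 \<in> hecke_rels r"
    unfolding hecke_rels_def Let_def by blast
qed auto

lemma T_word_near: "1 \<le> i \<Longrightarrow> i + 1 < r \<Longrightarrow> T_word r [i, i+1, i] = T_word r [i+1, i, i+1]"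
  by (rule T_word_braid_eqI) (auto simp: hecke_rels_def Let_def)

lemma T_word_last: "2 \<le> r \<Longrightarrow> T_word r [r-1, r, r-1, r] = T_word r [r, r-1, r, r-1]"
  by (rule T_word_braid_eqI) (auto simp: hecke_rels_def Let_def)

lemma dihedral_words_less:
  assumes w: "w \<in> BW r" and i: "i \<in> {1..r}" and j: "j \<in> {1..r}" and ij: "i < j"
    and d: "ldesc r i w" "ldesc r j w"
  shows "\<exists>xs ys u. set xs \<subseteq> {1..r} \<and> set ys \<subseteq> {1..r} \<and> u \<in> BW r \<and> T_word r (i # xs) = T_word r (j # ys) \<and>
    (\<forall>zs. B_reduced r u zs \<longrightarrow> B_reduced r w (i # xs @ zs) \<and> B_reduced r w (j # ys @ zs))"
proof -
  let ?s = "B_refl r i" and ?t = "B_refl r j"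
  have cl: "?s \<circ> y \<in> BW r" "?t \<circ> y \<in> BW r" if "y \<in> BW r" for y
    using that i j by (blast intro: refl_comp_in)+
  note c1 = cl[OF w]
  note c2 = cl(2)[OF c1(1)] cl(1)[OF c1(2)]
  note c3 = cl(1)[OF c2(1)] cl(2)[OF c2(2)]
  note c4 = cl(2)[OF c3(1)] cl(1)[OF c3(2)]
  consider "i + 1 < j" | "j = i + 1" "i + 1 < r" | "i = r - 1" "j = r" "2 \<le> r"
    using ij i j by fastforce
  then show ?thesis
  proof cases
    case 1
    have f: "ldesc r i (?t \<circ> w)" "ldesc r j (?s \<circ> w)"
      unfolding ldesc_refl[OF w i] ldesc_refl[OF w j] refl_far[OF i j 1]
      using d by (simp_all add: ldesc_def)
    have e: "?s \<circ> (?t \<circ> w) = ?t \<circ> (?s \<circ> w)"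
      using refl_far_commute[OF i j 1] by (simp only: comp_assoc[symmetric])
    show ?thesis
      by (rule exI[of _ "[j]"], rule exI[of _ "[i]"], rule exI[of _ "?t \<circ> (?s \<circ> w)"])
        (use i j d f c1 c2 e T_word_far[OF i j 1] in \<open>simp add: B_reduced_Cons w del: o_apply\<close>)
  next
    case 2
    have ii: "1 \<le> i" using i by simp
    note g = ldesc_near[OF ii 2(2) w, folded 2(1)]
    have f: "ldesc r j (?s \<circ> w)" "ldesc r i (?t \<circ> (?s \<circ> w))" "ldesc r i (?t \<circ> w)" "ldesc r j (?s \<circ> (?t \<circ> w))"
      unfolding g using d unfolding g(1,2) by linarith+
    have e: "?s \<circ> (?t \<circ> (?s \<circ> w)) = ?t \<circ> (?s \<circ> (?t \<circ> w))"
      using refl_near_braid[OF ii 2(2), folded 2(1)] by (metis comp_assoc)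
    show ?thesis
      by (rule exI[of _ "[j, i]"], rule exI[of _ "[i, j]"], rule exI[of _ "?t \<circ> (?s \<circ> (?t \<circ> w))"])
        (use i j d f c1 c2 c3 e T_word_near[OF ii 2(2), folded 2(1)] in \<open>simp add: B_reduced_Cons w del: o_apply\<close>)
  next
    case 3
    note g = ldesc_last[OF 3(3) w, folded 3(1)]
    have f: "ldesc r j (?s \<circ> w)" "ldesc r i (?t \<circ> (?s \<circ> w))" "ldesc r j (?s \<circ> (?t \<circ> (?s \<circ> w)))"
      "ldesc r i (?t \<circ> w)" "ldesc r j (?s \<circ> (?t \<circ> w))" "ldesc r i (?t \<circ> (?s \<circ> (?t \<circ> w)))"
      using g(15) d unfolding 3(2) g(1-14) by blast+
    have e: "?s \<circ> (?t \<circ> (?s \<circ> (?t \<circ> w))) = ?t \<circ> (?s \<circ> (?t \<circ> (?s \<circ> w)))"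
      using refl_last_braid[OF 3(3), folded 3(1)] unfolding 3(2) by (metis comp_assoc)
    have br: "T_word r [i, j, i, j] = T_word r [j, i, j, i]"
      using T_word_last[OF 3(3), folded 3(1)] unfolding 3(2) .
    show ?thesis
      by (rule exI[of _ "[j, i, j]"], rule exI[of _ "[i, j, i]"], rule exI[of _ "?t \<circ> (?s \<circ> (?t \<circ> (?s \<circ> w)))"])
        (use i j d f c1 c2 c3 c4 e br in \<open>simp add: B_reduced_Cons w del: o_apply\<close>)
  qed
qed

text \<open>If \<open>w\<close> has two left descents, then it is the product, with lengths adding up, of the longest element of the
  dihedral group that they generate and some \<open>u\<close>.  The two reduced words of this longest element
  are the two sides of a braid relation.\<close>

lemma dihedral_words:
  assumes w: "w \<in> BW r" and i: "i \<in> {1..r}" and j: "j \<in> {1..r}" and ij: "i \<noteq> j"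
    and d: "ldesc r i w" "ldesc r j w"
  shows "\<exists>xs ys u. set xs \<subseteq> {1..r} \<and> set ys \<subseteq> {1..r} \<and> u \<in> BW r \<and> T_word r (i # xs) = T_word r (j # ys) \<and>
    (\<forall>zs. B_reduced r u zs \<longrightarrow> B_reduced r w (i # xs @ zs) \<and> B_reduced r w (j # ys @ zs))"
proof (cases "i < j")
  case True
  then show ?thesis using dihedral_words_less[OF w i j _ d] by blast
next
  case False
  then have "j < i" using ij by simp
  from dihedral_words_less[OF w j i this d(2,1)] show ?thesis by metis
qed

text \<open>Induction on the length.  Two reduced words of \<open>w\<close> that begin with different letters are compared
  through two words that begin with the same letters and differ by one braid relation.\<close>

lemma matsumoto:
  assumes "w \<in> BW r" "B_reduced r w is" "B_reduced r w js"
  shows "T_word r is = T_word r js"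
  using assms
proof (induction "length is" arbitrary: w "is" js rule: less_induct)
  case less
  note w = less.prems(1)
  have len: "length is = length js" using less.prems by (simp add: B_reduced_def)
  show ?case
  proof (cases "is")
    case Nil
    then show ?thesis using len by simp
  next
    case (Cons i us)
    then obtain j vs where js: "js = j # vs" using len by (cases js) auto
    note ri = less.prems(2)[unfolded Cons] and rj = less.prems(3)[unfolded js]
    have i: "i \<in> {1..r}" "ldesc r i w" "B_reduced r (B_refl r i \<circ> w) us"
      and j: "j \<in> {1..r}" "ldesc r j w" "B_reduced r (B_refl r j \<circ> w) vs"
      using ri rj by (simp_all add: B_reduced_Cons w)
    have cl: "B_refl r i \<circ> w \<in> BW r" "B_refl r j \<circ> w \<in> BW r" using w i(1) j(1) by simp_all
    have su: "set us \<subseteq> {1..r}" "set vs \<subseteq> {1..r}" using i j by (auto simp: B_reduced_def)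
    show ?thesis
    proof (cases "i = j")
      case True
      have "T_word r us = T_word r vs"
        using less.hyps[OF _ cl(1) i(3)] j(3) True Cons by simp
      then have "T_word r (i # us) = T_word r (i # vs)"
        by (simp only: T_word_Cons[OF i(1) su(1)] T_word_Cons[OF i(1) su(2)])
      then show ?thesis using True Cons js by simp
    next
      case False
      obtain xs ys u where xy: "set xs \<subseteq> {1..r}" "set ys \<subseteq> {1..r}" "u \<in> BW r"
        "T_word r (i # xs) = T_word r (j # ys)"
        "\<And>zs. B_reduced r u zs \<Longrightarrow> B_reduced r w (i # xs @ zs) \<and> B_reduced r w (j # ys @ zs)"
        using dihedral_words[OF w i(1) j(1) False i(2) j(2)] by blast
      obtain zs where zs: "B_reduced r u zs" using B_reduced_exists[OF xy(3)] by blast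
      have z: "set zs \<subseteq> {1..r}" using zs by (simp add: B_reduced_def)
      have "B_reduced r (B_refl r i \<circ> w) (xs @ zs)" "B_reduced r (B_refl r j \<circ> w) (ys @ zs)"
        using xy(5)[OF zs] by (simp_all add: B_reduced_Cons w)
      then have e: "T_word r us = T_word r (xs @ zs)" "T_word r vs = T_word r (ys @ zs)"
        using less.hyps[OF _ cl(1) i(3)] less.hyps[OF _ cl(2) j(3)] Cons js len by simp_all
      have "T_word r is = T_word r ((i # xs) @ zs)"
        using Cons i(1) su xy(1) z e by (simp add: T_word_Cons[of i r us] T_word_Cons[of i r "xs @ zs"])
      also have "\<dots> = T_word r (i # xs) \<otimes>\<^bsub>hecke r\<^esub> T_word r zs"
        by (rule T_word_append) (use i(1) xy(1) z in auto)
      also have "\<dots> = T_word r (j # ys) \<otimes>\<^bsub>hecke r\<^esub> T_word r zs" by (simp only: xy(4))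
      also have "\<dots> = T_word r ((j # ys) @ zs)"
        by (rule T_word_append[symmetric]) (use j(1) xy(2) z in auto)
      also have "\<dots> = T_word r js"
        using js j(1) su xy(2) z e by (simp add: T_word_Cons[of j r vs] T_word_Cons[of j r "ys @ zs"])
      finally show ?thesis .
    qed
  qed
qed

subsection \<open>The standard basis\<close>

definition red_word :: "nat \<Rightarrow> (nat \<Rightarrow> nat) \<Rightarrow> nat list" where
  "red_word r w = (SOME is. B_reduced r w is)"

lemma red_word_reduced: "w \<in> BW r \<Longrightarrow> B_reduced r w (red_word r w)"
  unfolding red_word_def using B_reduced_exists by (rule someI_ex)

lemma red_word_set: "w \<in> BW r \<Longrightarrow> set (red_word r w) \<subseteq> {1..r}"
  using red_word_reduced by (simp add: B_reduced_def)

lemma red_word_lists: "w \<in> BW r \<Longrightarrow> red_word r w \<in> lists {1..r}"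
  using red_word_set by (auto simp: lists_eq_set)

lemma single_red_word_closed [simp]: "w \<in> BW r \<Longrightarrow> Poly_Mapping.single (red_word r w) a \<in> carrier (free_alg r)"
  by (intro single_free_alg red_word_lists)

lemma hecke_T_eq: assumes "w \<in> BW r" shows "hecke_T r w = T_word r (red_word r w)"
proof -
  have "foldr (\<otimes>\<^bsub>hecke r\<^esub>) (map (hecke_gen r) is) \<one>\<^bsub>hecke r\<^esub> = T_word r is" if "set is \<subseteq> {1..r}" for "is"
    using that
  proof (induction "is")
    case Nil then show ?case by (simp add: hecke_class_one T_word_def)
  next
    case (Cons i "is")
    then show ?case using T_word_Cons[of i r "is"] by (simp add: hecke_gen_def T_word_def)
  qed
  then show ?thesis using red_word_set[OF assms] by (simp add: hecke_T_def red_word_def)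
qed

lemma T_word_ascent:
  assumes w: "w \<in> BW r" and i: "i \<in> {1..r}" and "\<not> ldesc r i w"
  shows "T_word r (i # red_word r w) = T_word r (red_word r (B_refl r i \<circ> w))"
proof (rule matsumoto)
  have c: "B_refl r i \<circ> w \<in> BW r" using w i by simp
  show "B_refl r i \<circ> w \<in> BW r" by (rule c)
  show "B_reduced r (B_refl r i \<circ> w) (red_word r (B_refl r i \<circ> w))" by (rule red_word_reduced[OF c])
  show "B_reduced r (B_refl r i \<circ> w) (i # red_word r w)"
    unfolding B_reduced_Cons[OF c] ldesc_comp[OF w i] B_refl_comp_left[OF i]
    using assms red_word_reduced[OF w] by simp
qed

definition delta :: "(nat \<Rightarrow> nat) \<Rightarrow> wfun" where
  "delta u = (\<lambda>w. if w = u then 1 else 0)"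

lemma supp_delta: "u \<in> BW r \<Longrightarrow> supp r (delta u)"
  by (auto simp: supp_def delta_def)

lemma Lmul_delta_ascent:
  assumes w: "w \<in> BW r" and i: "i \<in> {1..r}" and nd: "\<not> ldesc r i w"
  shows "Lmul r i (delta w) = delta (B_refl r i \<circ> w)"
proof
  fix u
  have c: "B_refl r i \<circ> w \<in> BW r" using w i by simp
  have e: "B_refl r i \<circ> u = w \<longleftrightarrow> u = B_refl r i \<circ> w"
    using B_refl_comp_left[OF i] by metis
  show "Lmul r i (delta w) u = delta (B_refl r i \<circ> w) u"
  proof (cases "u \<in> BW r")
    case True
    have "ldesc r i u" if "u = B_refl r i \<circ> w" using that ldesc_comp[OF w i] nd by simp
    moreover have "u \<noteq> w" if "ldesc r i u" using that nd by auto
    ultimately show ?thesis using e by (auto simp: Lmul_apply[OF True] delta_def simp del: o_apply)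
  next
    case False
    then show ?thesis using c by (auto simp: Lmul_out delta_def)
  qed
qed

lemma Lmul_word_reduced:
  assumes "w \<in> BW r" "B_reduced r w is"
  shows "Lmul_word r is (delta id) = delta w"
  using assms
proof (induction "is" arbitrary: w)
  case Nil then show ?case by (simp add: B_reduced_Nil)
next
  case (Cons i "is")
  note w = Cons.prems(1)
  have i: "i \<in> {1..r}" "ldesc r i w" "B_reduced r (B_refl r i \<circ> w) is"
    using Cons.prems by (simp_all add: B_reduced_Cons)
  have c: "B_refl r i \<circ> w \<in> BW r" using w i by simp
  have "\<not> ldesc r i (B_refl r i \<circ> w)" using ldesc_comp[OF w i(1)] i(2) by simp
  from Lmul_delta_ascent[OF c i(1) this] show ?case
    by (simp only: Lmul_word_simps Cons.IH[OF c i(3)] B_refl_comp_left[OF i(1)])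
qed

text \<open>The element of the free algebra with prescribed coefficients at the chosen reduced words.  Every element of
  the free algebra turns out to be congruent to such an element.\<close>

definition normal_form :: "nat \<Rightarrow> wfun \<Rightarrow> (nat list \<Rightarrow>\<^sub>0 laurent)" where
  "normal_form r v = (\<Sum>w\<in>BW r. Poly_Mapping.single (red_word r w) (v w))"

lemma sum_free_alg: "(\<And>s. s \<in> S \<Longrightarrow> f s \<in> carrier (free_alg r)) \<Longrightarrow> sum f S \<in> carrier (free_alg r)"
proof (induction S rule: infinite_finite_induct)
  case (insert s S)
  interpret FA: ring "free_alg r" by (rule free_alg_ring)
  show ?case using insert FA.a_closed[of "f s" "sum f S"] by simp
qed (auto simp: free_alg_carrier)

lemma normal_form_closed [simp]: "normal_form r v \<in> carrier (free_alg r)"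
  unfolding normal_form_def by (rule sum_free_alg) simp

lemma normal_form_add: "normal_form r (\<lambda>w. u w + v w) = normal_form r u + normal_form r v"
  by (simp add: normal_form_def single_add sum.distrib)

lemma hecke_ideal_zero: "0 \<in> hecke_ideal r"
  using additive_subgroup.zero_closed[OF ideal.axioms(1)[OF hecke_ideal_ideal]] by simp

lemma hecke_ideal_add: "F \<in> hecke_ideal r \<Longrightarrow> G \<in> hecke_ideal r \<Longrightarrow> F + G \<in> hecke_ideal r"
  using additive_subgroup.a_closed[OF ideal.axioms(1)[OF hecke_ideal_ideal]] by (metis free_alg_add)

lemma hecke_ideal_sum: "(\<And>s. s \<in> S \<Longrightarrow> f s \<in> hecke_ideal r) \<Longrightarrow> sum f S \<in> hecke_ideal r"
  by (induction S rule: infinite_finite_induct) (simp_all add: hecke_ideal_zero hecke_ideal_add)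

lemma hecke_class_single:
  assumes "is \<in> lists {1..r}"
  shows "hecke_class r (Poly_Mapping.single is a) = hecke_class r (Poly_Mapping.single [] a) \<otimes>\<^bsub>hecke r\<^esub> T_word r is"
  unfolding T_word_def by (subst hecke_class_mult) (use assms in auto)

lemma hecke_class_sum_cong:
  assumes "\<And>s. s \<in> S \<Longrightarrow> f s \<in> carrier (free_alg r)" "\<And>s. s \<in> S \<Longrightarrow> g s \<in> carrier (free_alg r)"
    "\<And>s. s \<in> S \<Longrightarrow> hecke_class r (f s) = hecke_class r (g s)"
  shows "hecke_class r (sum f S) = hecke_class r (sum g S)"
proof (subst hecke_class_eq_iff)
  have "(\<Sum>s\<in>S. f s - g s) \<in> hecke_ideal r"
    by (rule hecke_ideal_sum) (use assms hecke_class_eq_iff in blast)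
  then show "sum f S - sum g S \<in> hecke_ideal r" by (simp add: sum_subtractf)
qed (use assms in \<open>auto intro: sum_free_alg\<close>)

text \<open>Modulo the relations, \<open>T\<^sub>i T\<^sub>w\<close> is \<open>T\<^sub>s\<^sub>w\<close> for an ascent, because the reduced word does not matter, and
  \<open>(q - 1) T\<^sub>w + q T\<^sub>s\<^sub>w\<close> for a descent.  Collecting the coefficients of each \<open>T\<^sub>u\<close> gives the operator.\<close>

lemma gen_times_normal_form:
  assumes i: "i \<in> {1..r}"
  shows "hecke_class r (Poly_Mapping.single [i] 1 \<otimes>\<^bsub>free_alg r\<^esub> normal_form r v) = hecke_class r (normal_form r (Lmul r i v))"
proof -
  let ?s = "B_refl r i"
  interpret H: ring "hecke r" by (rule hecke_ring)
  have mul: "Poly_Mapping.single [i] 1 \<otimes>\<^bsub>free_alg r\<^esub> (\<Sum>w\<in>S. Poly_Mapping.single (red_word r w) (v w))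
      = (\<Sum>w\<in>S. Poly_Mapping.single (i # red_word r w) (v w))" if "finite S" for S
    using that by (induction S rule: finite_induct) (simp_all add: free_alg_distrib)
  define D where "D w = (if ldesc r i w
      then Poly_Mapping.single (red_word r w) ((q_laurent - 1) * v w) + Poly_Mapping.single (red_word r (?s \<circ> w)) (q_laurent * v w)
      else Poly_Mapping.single (red_word r (?s \<circ> w)) (v w))" for w
  have c: "?s \<circ> w \<in> BW r" if "w \<in> BW r" for w using that i by simp
  have Dc: "D w \<in> carrier (free_alg r)" if "w \<in> BW r" for w
  proof -
    interpret FA: ring "free_alg r" by (rule free_alg_ring)
    show ?thesis unfolding D_def
      using FA.a_closed[of "Poly_Mapping.single (red_word r w) ((q_laurent - 1) * v w)" "Poly_Mapping.single (red_word r (?s \<circ> w)) (q_laurent * v w)"]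
        that c[OF that] by simp
  qed
  have e: "hecke_class r (Poly_Mapping.single (i # red_word r w) (v w)) = hecke_class r (D w)" if w: "w \<in> BW r" for w
  proof (cases "ldesc r i w")
    case False
    have l: "i # red_word r w \<in> lists {1..r}" "red_word r (?s \<circ> w) \<in> lists {1..r}"
      using red_word_lists[OF w] red_word_lists[OF c[OF w]] i by auto
    show ?thesis using False T_word_ascent[OF w i False]
      unfolding D_def hecke_class_single[OF l(1)] by (simp add: hecke_class_single[OF l(2)])
  next
    case True
    let ?u = "red_word r (?s \<circ> w)"
    have l: "i # red_word r w \<in> lists {1..r}" "?u \<in> lists {1..r}" "red_word r w \<in> lists {1..r}"
      using red_word_lists[OF w] red_word_lists[OF c[OF w]] i by auto
    have lu: "set ?u \<subseteq> {1..r}" by (rule red_word_set[OF c[OF w]])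
    have l2: "[i] \<in> lists {1..r}" "[i,i] \<in> lists {1..r}" "i # ?u \<in> lists {1..r}"
      "[] \<in> lists {1..r}" using i l by auto
    have "\<not> ldesc r i (?s \<circ> w)" using ldesc_comp[OF w i] True by simp
    from T_word_ascent[OF c[OF w] i this] have a: "T_word r (i # ?u) = T_word r (red_word r w)"
      using B_refl_comp_left[OF i, of w] by simp
    have rel: "T_word r [i, i] = hecke_class r (Poly_Mapping.single [i] (q_laurent - 1) + Poly_Mapping.single [] q_laurent)"
    proof -
      have "Poly_Mapping.single [i, i] 1 - (Poly_Mapping.single [i] (q_laurent - 1) + Poly_Mapping.single [] q_laurent)
          \<in> hecke_rels r" using i by (auto simp: hecke_rels_def Let_def)
      moreover have "Poly_Mapping.single [i] (q_laurent - 1) + Poly_Mapping.single [] q_laurent \<in> carrier (free_alg r)"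
        using sum_free_alg[of "UNIV::bool set" "\<lambda>b. if b then Poly_Mapping.single [i] (q_laurent - 1) else Poly_Mapping.single [] q_laurent" r] l2
        by (simp add: UNIV_bool add.commute)
      ultimately show ?thesis
        unfolding T_word_def using hecke_ideal_rel l2 by (subst hecke_class_eq_iff) auto
    qed
    have sum2: "F + G \<in> carrier (free_alg r)" if "F \<in> carrier (free_alg r)" "G \<in> carrier (free_alg r)" for F G
      using ring.ring_simprules(1)[OF free_alg_ring that] by simp
    have "hecke_class r (Poly_Mapping.single (i # red_word r w) (v w))
        = hecke_class r (Poly_Mapping.single [] (v w)) \<otimes>\<^bsub>hecke r\<^esub> (T_word r [i] \<otimes>\<^bsub>hecke r\<^esub> T_word r (red_word r w))"
      unfolding hecke_class_single[OF l(1)] using T_word_Cons[OF i red_word_set[OF w]] by simp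
    also have "T_word r [i] \<otimes>\<^bsub>hecke r\<^esub> T_word r (red_word r w) = T_word r [i, i] \<otimes>\<^bsub>hecke r\<^esub> T_word r ?u"
      unfolding a[symmetric] using T_word_append[of "[i]" r "i # ?u"] T_word_append[of "[i,i]" r ?u] i lu by simp
    also have "\<dots> = hecke_class r (Poly_Mapping.single (i # ?u) (q_laurent - 1) + Poly_Mapping.single ?u q_laurent)"
      unfolding rel unfolding T_word_def
      by (subst hecke_class_mult) (use l l2 in \<open>simp_all add: sum2 free_alg_distrib\<close>)
    also have "hecke_class r (Poly_Mapping.single [] (v w)) \<otimes>\<^bsub>hecke r\<^esub> \<dots>
        = hecke_class r (Poly_Mapping.single (i # ?u) ((q_laurent - 1) * v w) + Poly_Mapping.single ?u (q_laurent * v w))"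
      by (subst hecke_class_mult) (use l l2 in \<open>simp_all add: sum2 free_alg_distrib mult.commute\<close>)
    also have "\<dots> = hecke_class r (Poly_Mapping.single (i # ?u) ((q_laurent - 1) * v w)) \<oplus>\<^bsub>hecke r\<^esub> hecke_class r (Poly_Mapping.single ?u (q_laurent * v w))"
      using l l2 by (simp add: hecke_class_add)
    also have "hecke_class r (Poly_Mapping.single (i # ?u) ((q_laurent - 1) * v w)) = hecke_class r (Poly_Mapping.single (red_word r w) ((q_laurent - 1) * v w))"
      by (simp only: hecke_class_single[OF l2(3)] hecke_class_single[OF l(3)] a)
    also have "\<dots> \<oplus>\<^bsub>hecke r\<^esub> hecke_class r (Poly_Mapping.single ?u (q_laurent * v w)) = hecke_class r (D w)"
      unfolding D_def using True l l2 by (simp add: hecke_class_add)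
    finally show ?thesis .
  qed
  have bij: "bij_betw (\<lambda>w. ?s \<circ> w) (BW r) (BW r)"
    by (rule bij_betwI[of _ _ _ "\<lambda>w. ?s \<circ> w"]) (use i in auto)
  have "sum D (BW r) = normal_form r (Lmul r i v)"
  proof -
    define A where "A w = Poly_Mapping.single (red_word r w) (if ldesc r i w then (q_laurent - 1) * v w else 0)" for w
    define B where "B w = Poly_Mapping.single (red_word r w) (if ldesc r i w then v (?s \<circ> w) else q_laurent * v (?s \<circ> w))" for w
    have "D w = A w + B (?s \<circ> w)" if "w \<in> BW r" for w
      unfolding D_def A_def B_def ldesc_comp[OF that i] B_refl_comp_left[OF i] by simp
    then have "sum D (BW r) = sum A (BW r) + (\<Sum>w\<in>BW r. B (?s \<circ> w))"
      by (simp add: sum.distrib)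
    also have "(\<Sum>w\<in>BW r. B (?s \<circ> w)) = sum B (BW r)"
      by (rule sum.reindex_bij_betw[OF bij])
    also have "sum A (BW r) + sum B (BW r) = (\<Sum>w\<in>BW r. A w + B w)" by (simp add: sum.distrib)
    also have "\<dots> = normal_form r (Lmul r i v)"
      unfolding normal_form_def A_def B_def by (rule sum.cong) (auto simp: Lmul_apply single_add[symmetric] add.commute)
    finally show ?thesis .
  qed
  moreover have "Poly_Mapping.single (i # red_word r w) (v w) \<in> carrier (free_alg r)" if "w \<in> BW r" for w
    using red_word_lists[OF that] i by (intro single_free_alg) auto
  then have "hecke_class r (\<Sum>w\<in>BW r. Poly_Mapping.single (i # red_word r w) (v w)) = hecke_class r (sum D (BW r))"
    using Dc e by (rule hecke_class_sum_cong)
  ultimately show ?thesis unfolding normal_form_def mul[OF finite_BW] by simp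
qed

lemma hecke_class_normal_form:
  assumes "F \<in> carrier (free_alg r)"
  shows "hecke_class r F = hecke_class r (normal_form r (word_act r F (delta id)))"
  using assms
proof (induction rule: free_alg_induct)
  case zero
  then show ?case by (simp add: normal_form_def)
next
  case (add F G)
  then show ?case by (simp add: normal_form_add hecke_class_add[symmetric])
next
  case (single "is" a)
  then show ?case
  proof (induction "is")
    case Nil
    have "red_word r id = []"
      using red_word_reduced[of id r] by (simp add: B_reduced_def B_length_id)
    have "normal_form r (\<lambda>w. a * delta id w) = (\<Sum>w\<in>BW r. if w = id then Poly_Mapping.single [] a else 0)"
      unfolding normal_form_def by (rule sum.cong) (auto simp: delta_def \<open>red_word r id = []\<close>)
    also have "\<dots> = Poly_Mapping.single [] a" using finite_BW[of r] by simp
    finally show ?case by (simp del: id_apply)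
  next
    case (Cons i "is")
    then have i: "i \<in> {1..r}" and l: "is \<in> lists {1..r}" by auto
    have l1: "[i] \<in> lists {1..r}" using i by simp
    have "hecke_class r (Poly_Mapping.single (i # is) a) = T_word r [i] \<otimes>\<^bsub>hecke r\<^esub> hecke_class r (Poly_Mapping.single is a)"
      unfolding T_word_def by (subst hecke_class_mult) (use l l1 in auto)
    also have "\<dots> = T_word r [i] \<otimes>\<^bsub>hecke r\<^esub> hecke_class r (normal_form r (\<lambda>w. a * Lmul_word r is (delta id) w))"
      using Cons.IH l by (simp del: id_apply)
    also have "\<dots> = hecke_class r (normal_form r (Lmul r i (\<lambda>w. a * Lmul_word r is (delta id) w)))"
      unfolding T_word_def by (subst hecke_class_mult) (use l1 gen_times_normal_form[OF i] in auto)
    finally show ?case by (simp add: Lmul_smult del: id_apply)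
  qed
qed

section \<open>Coefficients with respect to the standard basis\<close>

(* Group elements occur below as arguments of functions on the group; composites of them have to
   stay composites for the rules about reflections to apply. *)
declare o_apply [simp del] id_apply [simp del]

text \<open>The coefficients with respect to the basis \<open>T\<^sub>w\<close>: the image of \<open>T\<^sub>1\<close> under the action of the element.\<close>

definition T_coeff :: "nat \<Rightarrow> hecke_elt \<Rightarrow> wfun" where
  "T_coeff r h = word_act r (SOME F. F \<in> carrier (free_alg r) \<and> h = hecke_class r F) (delta id)"

lemma T_coeff_hecke_class:
  assumes "F \<in> carrier (free_alg r)"
  shows "T_coeff r (hecke_class r F) = word_act r F (delta id)"
proof -
  let ?G = "SOME G. G \<in> carrier (free_alg r) \<and> hecke_class r F = hecke_class r G"
  have "?G \<in> carrier (free_alg r) \<and> hecke_class r F = hecke_class r ?G"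
    by (rule someI[where x = F]) (use assms in simp)
  then have "F - ?G \<in> hecke_ideal r" using assms hecke_class_eq_iff[of F r ?G] by blast
  from hecke_ideal_word_act[OF this supp_delta[OF BW_id]]
  have "word_act r F (delta id) w = word_act r ?G (delta id) w" for w by (simp add: fun_eq_iff)
  then show ?thesis unfolding T_coeff_def by (simp add: fun_eq_iff)
qed

lemma supp_T_coeff: "h \<in> carrier (hecke r) \<Longrightarrow> supp r (T_coeff r h)"
  by (metis T_coeff_hecke_class hecke_carrierE supp_word_act supp_delta BW_id)

text \<open>The coefficients of an element determine its normal form, and the element is the class of its
  normal form.\<close>

lemma T_coeff_inj:
  assumes "x \<in> carrier (hecke r)" "y \<in> carrier (hecke r)" "T_coeff r x = T_coeff r y"
  shows "x = y"
proof -
  obtain F G where *: "F \<in> carrier (free_alg r)" "x = hecke_class r F" "G \<in> carrier (free_alg r)" "y = hecke_class r G"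
    using assms hecke_carrierE by metis
  have "x = hecke_class r (normal_form r (T_coeff r x))" using hecke_class_normal_form[OF *(1)] unfolding *(2) T_coeff_hecke_class[OF *(1)] .
  moreover have "y = hecke_class r (normal_form r (T_coeff r y))" using hecke_class_normal_form[OF *(3)] unfolding *(4) T_coeff_hecke_class[OF *(3)] .
  ultimately show ?thesis using assms(3) by simp
qed

lemma T_coeff_add:
  assumes "x \<in> carrier (hecke r)" "y \<in> carrier (hecke r)"
  shows "T_coeff r (x \<oplus>\<^bsub>hecke r\<^esub> y) = (\<lambda>w. T_coeff r x w + T_coeff r y w)"
proof -
  interpret FA: ring "free_alg r" by (rule free_alg_ring)
  obtain F G where *: "F \<in> carrier (free_alg r)" "x = hecke_class r F" "G \<in> carrier (free_alg r)" "y = hecke_class r G"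
    using assms hecke_carrierE by metis
  then show ?thesis using FA.a_closed[of F G] by (simp add: hecke_class_add T_coeff_hecke_class)
qed

lemma T_coeff_zero: "T_coeff r \<zero>\<^bsub>hecke r\<^esub> = (\<lambda>w. 0)"
  unfolding hecke_class_zero by (subst T_coeff_hecke_class) (auto simp: free_alg_carrier)

lemma T_coeff_mult_left:
  assumes "F \<in> carrier (free_alg r)" "x \<in> carrier (hecke r)"
  shows "T_coeff r (hecke_class r F \<otimes>\<^bsub>hecke r\<^esub> x) = word_act r F (T_coeff r x)"
proof -
  obtain G where G: "G \<in> carrier (free_alg r)" "x = hecke_class r G" using assms hecke_carrierE by metis
  interpret FA: ring "free_alg r" by (rule free_alg_ring)
  show ?thesis using assms G by (simp add: hecke_class_mult T_coeff_hecke_class word_act_mult)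
qed

lemma T_coeff_finsum:
  assumes "finite S" "f \<in> S \<rightarrow> carrier (hecke r)"
  shows "T_coeff r (finsum (hecke r) f S) = (\<lambda>w. \<Sum>s\<in>S. T_coeff r (f s) w)"
proof -
  interpret H: ring "hecke r" by (rule hecke_ring)
  show ?thesis using assms
    by (induction S rule: finite_induct) (simp_all add: T_coeff_zero T_coeff_add Pi_iff)
qed

lemma hecke_T_closed [simp]: "w \<in> BW r \<Longrightarrow> hecke_T r w \<in> carrier (hecke r)"
  by (simp only: hecke_T_eq T_word_closed red_word_set)

lemma T_coeff_T: "w \<in> BW r \<Longrightarrow> T_coeff r (hecke_T r w) = delta w"
  unfolding hecke_T_eq T_word_def
  by (subst T_coeff_hecke_class) (simp_all add: Lmul_word_reduced[OF _ red_word_reduced])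

lemma hecke_T_sum_closed [simp]: "D \<subseteq> BW r \<Longrightarrow> hecke_T_sum r D \<in> carrier (hecke r)"
  unfolding hecke_T_sum_def
  by (rule abelian_monoid.finsum_closed[OF ring.axioms(1)[OF hecke_ring, THEN abelian_group.axioms(1)]]) auto

definition indic :: "(nat \<Rightarrow> nat) set \<Rightarrow> wfun" where
  "indic D = (\<lambda>w. if w \<in> D then 1 else 0)"

lemma supp_indic: "D \<subseteq> BW r \<Longrightarrow> supp r (indic D)"
  by (auto simp: supp_def indic_def)

lemma T_coeff_T_sum:
  assumes "D \<subseteq> BW r"
  shows "T_coeff r (hecke_T_sum r D) = indic D"
proof -
  have fin: "finite D" using assms finite_BW finite_subset by blast
  have "T_coeff r (hecke_T_sum r D) = (\<lambda>w. \<Sum>u\<in>D. T_coeff r (hecke_T r u) w)"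
    unfolding hecke_T_sum_def by (rule T_coeff_finsum) (use assms fin in auto)
  also have "\<dots> = (\<lambda>w. \<Sum>u\<in>D. if u = w then 1 else 0)"
    by (intro ext sum.cong refl) (use assms in \<open>auto simp: T_coeff_T delta_def\<close>)
  finally show ?thesis using fin by (simp add: indic_def)
qed

lemma hecke_scalar_closed [simp]: "hecke_scalar r a \<in> carrier (hecke r)"
  unfolding hecke_scalar_def by (intro hecke_class_closed single_free_alg) simp

lemma hecke_scalar_commute:
  assumes "x \<in> carrier (hecke r)"
  shows "hecke_scalar r a \<otimes>\<^bsub>hecke r\<^esub> x = x \<otimes>\<^bsub>hecke r\<^esub> hecke_scalar r a"
proof -
  obtain F where F: "F \<in> carrier (free_alg r)" "x = hecke_class r F" using assms hecke_carrierE by metis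
  have "Poly_Mapping.single [] a \<otimes>\<^bsub>free_alg r\<^esub> F = F \<otimes>\<^bsub>free_alg r\<^esub> Poly_Mapping.single [] a"
    using F(1) by (induction rule: free_alg_induct) (simp_all add: free_alg_distrib mult.commute)
  then show ?thesis using F by (simp add: hecke_scalar_def hecke_class_mult)
qed

lemma T_coeff_scalar: "x \<in> carrier (hecke r) \<Longrightarrow> T_coeff r (hecke_scalar r a \<otimes>\<^bsub>hecke r\<^esub> x) = (\<lambda>w. a * T_coeff r x w)"
  unfolding hecke_scalar_def by (subst T_coeff_mult_left) simp_all

lemma T_coeff_scalar_right: "x \<in> carrier (hecke r) \<Longrightarrow> T_coeff r (x \<otimes>\<^bsub>hecke r\<^esub> hecke_scalar r a) = (\<lambda>w. a * T_coeff r x w)"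
  using T_coeff_scalar hecke_scalar_commute by metis

lemma T_coeff_gen: "i \<in> {1..r} \<Longrightarrow> x \<in> carrier (hecke r) \<Longrightarrow> T_coeff r (T_word r [i] \<otimes>\<^bsub>hecke r\<^esub> x) = Lmul r i (T_coeff r x)"
  unfolding T_word_def by (subst T_coeff_mult_left) simp_all

lemma Lmul_word_Rmul_commute:
  "set is \<subseteq> {1..r} \<Longrightarrow> i \<in> {1..r} \<Longrightarrow> Lmul_word r is (Rmul r i v) = Rmul r i (Lmul_word r is v)"
  by (induction "is") (simp_all add: Lmul_Rmul_commute del: atLeastAtMost_iff)

lemma word_act_Rmul:
  assumes "F \<in> carrier (free_alg r)" "i \<in> {1..r}"
  shows "word_act r F (Rmul r i v) = Rmul r i (word_act r F v)"
  using assms(1)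
  by (induction rule: free_alg_induct)
    (simp_all add: Rmul_add Rmul_smult Lmul_word_Rmul_commute[OF _ assms(2)] lists_eq_set)

lemma Lmul_Rmul_one:
  assumes i: "i \<in> {1..r}"
  shows "Lmul r i (delta id) = delta (B_refl r i)" "Rmul r i (delta id) = delta (B_refl r i)"
proof -
  have nd: "\<not> ldesc r i id" "\<not> rdesc r id i"
    using i by (auto simp: ldesc_def rdesc_def next_pos_def id_def)
  show "Lmul r i (delta id) = delta (B_refl r i)"
    using Lmul_delta_ascent[OF BW_id i nd(1)] by simp
  show "Rmul r i (delta id) = delta (B_refl r i)"
  proof
    fix u
    have e: "u \<circ> B_refl r i = id \<longleftrightarrow> u = B_refl r i"
      using B_refl_comp_right[OF i, of u] B_refl_comp[OF i] by (metis id_comp)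
    show "Rmul r i (delta id) u = delta (B_refl r i) u"
    proof (cases "u \<in> BW r")
      case True
      have "rdesc r u i" if "u = B_refl r i" using that rdesc_comp[OF BW_id i] nd by simp
      moreover have "u \<noteq> id" if "rdesc r u i" using that nd by auto
      ultimately show ?thesis using e by (auto simp: Rmul_apply[OF True] delta_def)
    next
      case False
      then show ?thesis using B_refl_in[OF i] by (auto simp: Rmul_out delta_def)
    qed
  qed
qed

text \<open>The action of a generator on \<open>T\<^sub>1\<close> is the same from the left and from the right, and right operators
  commute with the action.\<close>

lemma T_coeff_gen_right:
  assumes i: "i \<in> {1..r}" and x: "x \<in> carrier (hecke r)"
  shows "T_coeff r (x \<otimes>\<^bsub>hecke r\<^esub> T_word r [i]) = Rmul r i (T_coeff r x)"
proof -
  obtain F where F: "F \<in> carrier (free_alg r)" "x = hecke_class r F" using x hecke_carrierE by metis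
  have l: "[i] \<in> lists {1..r}" using i by auto
  have s: "Poly_Mapping.single [i] 1 \<in> carrier (free_alg r)" using l by (rule single_free_alg)
  have "T_coeff r (x \<otimes>\<^bsub>hecke r\<^esub> T_word r [i]) = word_act r (F \<otimes>\<^bsub>free_alg r\<^esub> Poly_Mapping.single [i] 1) (delta id)"
    unfolding T_word_def F(2) hecke_class_mult[OF F(1) s]
    by (rule T_coeff_hecke_class) (rule ring.ring_simprules(5)[OF free_alg_ring F(1) s])
  also have "\<dots> = word_act r F (Lmul r i (delta id))" using word_act_mult[OF F(1) s] by simp
  also have "\<dots> = word_act r F (Rmul r i (delta id))" by (simp only: Lmul_Rmul_one[OF i])
  also have "\<dots> = Rmul r i (T_coeff r x)" using word_act_Rmul[OF F(1) i] F by (simp add: T_coeff_hecke_class)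
  finally show ?thesis .
qed

definition Rmul_word :: "nat \<Rightarrow> nat list \<Rightarrow> wfun \<Rightarrow> wfun" where
  "Rmul_word r is v = fold (Rmul r) is v"

lemma Rmul_word_simps: "Rmul_word r [] v = v" "Rmul_word r (i # is) v = Rmul_word r is (Rmul r i v)"
  "Rmul_word r (is @ [i]) v = Rmul r i (Rmul_word r is v)"
  by (simp_all add: Rmul_word_def o_apply id_apply)

lemma T_coeff_T_word_right:
  assumes "set is \<subseteq> {1..r}" "x \<in> carrier (hecke r)"
  shows "T_coeff r (x \<otimes>\<^bsub>hecke r\<^esub> T_word r is) = Rmul_word r is (T_coeff r x)"
  using assms
proof (induction "is" arbitrary: x)
  case Nil
  interpret H: ring "hecke r" by (rule hecke_ring)
  show ?case using Nil by (simp add: T_word_def Rmul_word_simps flip: hecke_class_one)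
next
  case (Cons i "is")
  interpret H: ring "hecke r" by (rule hecke_ring)
  have i: "i \<in> {1..r}" "set is \<subseteq> {1..r}" using Cons by auto
  have c: "T_word r [i] \<in> carrier (hecke r)" using i by (intro T_word_closed) auto
  have "x \<otimes>\<^bsub>hecke r\<^esub> T_word r (i # is) = (x \<otimes>\<^bsub>hecke r\<^esub> T_word r [i]) \<otimes>\<^bsub>hecke r\<^esub> T_word r is"
    unfolding T_word_Cons[OF i] using H.m_assoc[OF Cons.prems(2) c T_word_closed[OF i(2)]] by simp
  then show ?case
    using Cons.IH[OF i(2) H.m_closed[OF Cons.prems(2) c]] T_coeff_gen_right[OF i(1) Cons.prems(2)]
    by (simp add: Rmul_word_simps)
qed

lemma T_coeff_T_word_left:
  assumes "set is \<subseteq> {1..r}" "x \<in> carrier (hecke r)"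
  shows "T_coeff r (T_word r is \<otimes>\<^bsub>hecke r\<^esub> x) = Lmul_word r is (T_coeff r x)"
  unfolding T_word_def
  by (subst T_coeff_mult_left) (use assms in \<open>auto simp: lists_eq_set\<close>)

section \<open>Parabolic sums and invariant elements\<close>

definition parab :: "nat \<Rightarrow> nat set \<Rightarrow> (nat \<Rightarrow> nat) set" where
  "parab r J = generate (B_group r) (B_refl r ` J)"

definition left_invariant :: "nat \<Rightarrow> nat set \<Rightarrow> wfun \<Rightarrow> bool" where
  "left_invariant r J v \<longleftrightarrow> (\<forall>i\<in>J. \<forall>w\<in>BW r. v (B_refl r i \<circ> w) = v w)"

definition right_invariant :: "nat \<Rightarrow> nat set \<Rightarrow> wfun \<Rightarrow> bool" where
  "right_invariant r J v \<longleftrightarrow> (\<forall>i\<in>J. \<forall>w\<in>BW r. v (w \<circ> B_refl r i) = v w)"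

text \<open>Pulling back along inversion interchanges left and right operators, so that the statements on one side
  follow from those on the other.\<close>

definition inv_pull :: "nat \<Rightarrow> wfun \<Rightarrow> wfun" where
  "inv_pull r v = (\<lambda>w. if w \<in> BW r then v (pinv w) else 0)"

definition parab_coset :: "nat \<Rightarrow> nat set \<Rightarrow> (nat \<Rightarrow> nat) \<Rightarrow> (nat \<Rightarrow> nat) set" where
  "parab_coset r J d = (\<lambda>u. u \<circ> d) ` parab r J"

lemma inv_pull_inv_pull: "supp r v \<Longrightarrow> inv_pull r (inv_pull r v) = v"
  by (auto simp: inv_pull_def supp_def fun_eq_iff BW_inv)

lemma supp_inv_pull: "supp r (inv_pull r v)"
  by (simp add: inv_pull_def supp_def)

lemma Lmul_inv_pull: assumes i: "i \<in> {1..r}" shows "Lmul r i (inv_pull r v) = inv_pull r (Rmul r i v)"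
proof
  fix w
  show "Lmul r i (inv_pull r v) w = inv_pull r (Rmul r i v) w"
  proof (cases "w \<in> BW r")
    case True
    note iw = BW_inv[OF True]
    show ?thesis
      using refl_comp_in(1)[OF True i] inv_refl_comp[OF True i] True
      by (simp add: Lmul_apply[OF True] inv_pull_def Rmul_apply[OF iw] rdesc_inv)
  qed (simp add: Lmul_out inv_pull_def)
qed

lemma Lmul_word_inv_pull: "set is \<subseteq> {1..r} \<Longrightarrow> Lmul_word r (rev is) (inv_pull r v) = inv_pull r (Rmul_word r is v)"
  by (induction "is" arbitrary: v) (simp_all add: Rmul_word_simps Lmul_word_append Lmul_inv_pull del: atLeastAtMost_iff)

text \<open>An eigenvector of left multiplication by \<open>T\<^sub>i\<close> for the eigenvalue \<open>q\<close> has equal coefficients at \<open>w\<close> and \<open>s\<^sub>i w\<close>: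
  compare coefficients at the longer of the two.\<close>

lemma left_invariant_iff_eigen:
  assumes "supp r v" "J \<subseteq> {1..r}"
  shows "left_invariant r J v \<longleftrightarrow> (\<forall>i\<in>J. Lmul r i v = (\<lambda>w. q_laurent * v w))"
proof
  assume l: "left_invariant r J v"
  show "\<forall>i\<in>J. Lmul r i v = (\<lambda>w. q_laurent * v w)"
  proof (intro ballI ext)
    fix i w assume i: "i \<in> J"
    show "Lmul r i v w = q_laurent * v w"
      using l i assms(1) by (cases "w \<in> BW r") (simp_all add: Lmul_apply Lmul_out supp_def left_invariant_def algebra_simps)
  qed
next
  assume e: "\<forall>i\<in>J. Lmul r i v = (\<lambda>w. q_laurent * v w)"
  have a: "v (B_refl r i \<circ> w) = v w" if "i \<in> J" "w \<in> BW r" "ldesc r i w" for i w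
    using fun_cong[OF bspec[OF e that(1)], of w] that by (simp add: Lmul_apply algebra_simps)
  show "left_invariant r J v"
    unfolding left_invariant_def
  proof (intro ballI)
    fix i w assume i: "i \<in> J" and w: "w \<in> BW r"
    have i': "i \<in> {1..r}" using i assms(2) by blast
    show "v (B_refl r i \<circ> w) = v w"
    proof (cases "ldesc r i w")
      case False
      then have "ldesc r i (B_refl r i \<circ> w)" using ldesc_comp[OF w i'] by simp
      from a[OF i refl_comp_in(1)[OF w i'] this] show ?thesis
        unfolding B_refl_comp_left[OF i'] by simp
    qed (use a i w in blast)
  qed
qed

lemma right_invariant_inv_pull:
  assumes "J \<subseteq> {1..r}"
  shows "right_invariant r J v \<longleftrightarrow> left_invariant r J (inv_pull r v)"
proof
  assume r: "right_invariant r J v"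
  show "left_invariant r J (inv_pull r v)"
    unfolding left_invariant_def
  proof (intro ballI)
    fix i w assume i: "i \<in> J" and w: "w \<in> BW r"
    have i': "i \<in> {1..r}" using i assms by blast
    show "inv_pull r v (B_refl r i \<circ> w) = inv_pull r v w"
      using r i BW_inv[OF w] w refl_comp_in(1)[OF w i'] by (simp add: inv_pull_def inv_refl_comp[OF w i'] right_invariant_def)
  qed
next
  assume l: "left_invariant r J (inv_pull r v)"
  show "right_invariant r J v"
    unfolding right_invariant_def
  proof (intro ballI)
    fix i w assume i: "i \<in> J" and w: "w \<in> BW r"
    have i': "i \<in> {1..r}" using i assms by blast
    have "inv_pull r v (B_refl r i \<circ> pinv w) = inv_pull r v (pinv w)"
      using l i BW_inv[OF w] by (simp add: left_invariant_def)
    then show "v (w \<circ> B_refl r i) = v w"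
      using refl_comp_in(1)[OF BW_inv[OF w] i'] BW_inv[OF w] w
      by (simp add: inv_pull_def inv_refl_comp[OF BW_inv[OF w] i'])
  qed
qed

lemma right_invariant_iff_eigen:
  assumes "supp r v" "J \<subseteq> {1..r}"
  shows "right_invariant r J v \<longleftrightarrow> (\<forall>i\<in>J. Rmul r i v = (\<lambda>w. q_laurent * v w))"
proof -
  have "Lmul r i (inv_pull r v) = (\<lambda>w. q_laurent * inv_pull r v w) \<longleftrightarrow> Rmul r i v = (\<lambda>w. q_laurent * v w)"
    if "i \<in> J" for i
  proof -
    have i: "i \<in> {1..r}" using that assms by blast
    have f: "(\<lambda>w. q_laurent * inv_pull r v w) = inv_pull r (\<lambda>w. q_laurent * v w)" by (auto simp: inv_pull_def)
    have s: "supp r (\<lambda>w. q_laurent * v w)" using assms(1) by (simp add: supp_def)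
    show ?thesis
      unfolding Lmul_inv_pull[OF i] f using inv_pull_inv_pull[OF s] inv_pull_inv_pull[OF supp_Rmul[of r i v]] by metis
  qed
  then show ?thesis
    unfolding right_invariant_inv_pull[OF assms(2)] left_invariant_iff_eigen[OF supp_inv_pull assms(2)] by simp
qed

lemma q_ne_one: "q_laurent - 1 \<noteq> 0"
proof
  assume "q_laurent - 1 = 0"
  then have "Poly_Mapping.lookup q_laurent (2::int) = Poly_Mapping.lookup (1 :: laurent) 2" by simp
  then show False by (simp add: q_laurent_def ups_pow_def lookup_one)
qed

lemma parab_subgroup: "J \<subseteq> {1..r} \<Longrightarrow> subgroup (parab r J) (B_group r)"
  unfolding parab_def by (rule group.generate_is_subgroup[OF group_B]) (auto intro!: B_refl_in simp del: atLeastAtMost_iff)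

lemma parab_in: "J \<subseteq> {1..r} \<Longrightarrow> u \<in> parab r J \<Longrightarrow> u \<in> BW r"
  using subgroup.subset[OF parab_subgroup] by blast

lemma parab_subset: "J \<subseteq> {1..r} \<Longrightarrow> parab r J \<subseteq> BW r"
  using subgroup.subset[OF parab_subgroup] by blast

lemma parab_id: "id \<in> parab r J"
  unfolding parab_def using generate.one[of "B_group r"] by simp

lemma parab_comp: "J \<subseteq> {1..r} \<Longrightarrow> u \<in> parab r J \<Longrightarrow> v \<in> parab r J \<Longrightarrow> u \<circ> v \<in> parab r J"
  using subgroup.m_closed[OF parab_subgroup] by fastforce

lemma parab_inv: "J \<subseteq> {1..r} \<Longrightarrow> u \<in> parab r J \<Longrightarrow> pinv u \<in> parab r J"
  using subgroup.m_inv_closed[OF parab_subgroup] B_group_inv parab_in by metis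

lemma parab_refl: "i \<in> J \<Longrightarrow> B_refl r i \<in> parab r J"
  unfolding parab_def by (rule generate.incl) simp

lemma left_invariant_parab:
  assumes J: "J \<subseteq> {1..r}" and l: "left_invariant r J v" and u: "u \<in> parab r J" and w: "w \<in> BW r"
  shows "v (u \<circ> w) = v w"
proof -
  have r: "v (B_refl r i \<circ> w) = v w" if "i \<in> J" "w \<in> BW r" for i w
    using l that by (simp add: left_invariant_def)
  from u have "u \<in> generate (B_group r) (B_refl r ` J)" by (simp add: parab_def)
  then show ?thesis using w
  proof (induction arbitrary: w rule: generate.induct)
    case (inv h)
    then obtain i where i: "i \<in> J" "h = B_refl r i" by auto
    then have "i \<in> {1..r}" using J by blast
    then have "inv\<^bsub>B_group r\<^esub> h = h" using i by (simp only: B_group_inv B_refl_in B_refl_inv)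
    then show ?case using r i inv by simp
  next
    case (eng h1 h2)
    have "h2 \<in> BW r" using eng(2) parab_in[OF J] by (simp add: parab_def)
    then show ?case using eng by (simp add: comp_assoc BW_comp)
  qed (use r in auto)
qed

lemma parab_coset_subset: "J \<subseteq> {1..r} \<Longrightarrow> d \<in> BW r \<Longrightarrow> parab_coset r J d \<subseteq> BW r"
  unfolding parab_coset_def using parab_in by blast

lemma parab_coset_self: "d \<in> parab_coset r J d"
  unfolding parab_coset_def using parab_id[of r J] by (metis id_comp image_eqI)

lemma parab_coset_comp:
  assumes J: "J \<subseteq> {1..r}" and u: "u \<in> parab r J" and w: "w \<in> BW r"
  shows "u \<circ> w \<in> parab_coset r J d \<longleftrightarrow> w \<in> parab_coset r J d"
proof
  assume "u \<circ> w \<in> parab_coset r J d"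
  then obtain u' where u': "u' \<in> parab r J" "u \<circ> w = u' \<circ> d" by (auto simp: parab_coset_def)
  have ub: "u \<in> BW r" using parab_in[OF J u] .
  have "w = pinv u \<circ> (u \<circ> w)" using BW_inv_comp(2)[OF ub] by (simp add: comp_assoc[symmetric])
  also have "\<dots> = (pinv u \<circ> u') \<circ> d" unfolding u'(2) by (simp only: comp_assoc)
  finally show "w \<in> parab_coset r J d" using parab_comp[OF J parab_inv[OF J u] u'(1)] unfolding parab_coset_def by (metis image_eqI)
next
  assume "w \<in> parab_coset r J d"
  then obtain u' where u': "u' \<in> parab r J" "w = u' \<circ> d" by (auto simp: parab_coset_def)
  then have "u \<circ> w = (u \<circ> u') \<circ> d" by (simp only: comp_assoc)
  then show "u \<circ> w \<in> parab_coset r J d" using parab_comp[OF J u u'(1)] unfolding parab_coset_def by (metis image_eqI)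
qed

lemma parab_coset_eq:
  assumes J: "J \<subseteq> {1..r}" and d: "d \<in> BW r" and w: "w \<in> parab_coset r J d"
  shows "parab_coset r J w = parab_coset r J d"
proof -
  obtain u where u: "u \<in> parab r J" "w = u \<circ> d" using w by (auto simp: parab_coset_def)
  have wb: "w \<in> BW r" using parab_coset_subset[OF J d] w by blast
  have "u \<circ> d \<in> parab_coset r J w" using parab_coset_self u(2) by metis
  then have dw: "d \<in> parab_coset r J w" using parab_coset_comp[OF J u(1) d] by simp
  have sub: "parab_coset r J a \<subseteq> parab_coset r J b" if "a \<in> parab_coset r J b" "a \<in> BW r" for a b
  proof
    fix x assume "x \<in> parab_coset r J a"
    then obtain u where "u \<in> parab r J" "x = u \<circ> a" by (auto simp: parab_coset_def)
    then show "x \<in> parab_coset r J b" using parab_coset_comp[OF J _ that(2)] that(1) by simp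
  qed
  show ?thesis using sub[OF w wb] sub[OF dw d] by blast
qed

lemma left_invariant_indic_parab_coset:
  assumes J: "J \<subseteq> {1..r}"
  shows "left_invariant r J (indic (parab_coset r J d))"
  unfolding left_invariant_def indic_def using parab_coset_comp[OF J parab_refl] by auto

lemma left_invariant_Rmul:
  assumes J: "J \<subseteq> {1..r}" and l: "left_invariant r J v" and v: "supp r v" and j: "j \<in> {1..r}"
  shows "left_invariant r J (Rmul r j v)"
proof -
  have "Lmul r i (Rmul r j v) = (\<lambda>w. q_laurent * Rmul r j v w)" if "i \<in> J" for i
  proof -
    have "i \<in> {1..r}" using that J by blast
    then have "Lmul r i (Rmul r j v) = Rmul r j (Lmul r i v)" using Lmul_Rmul_commute j by blast
    also have "Lmul r i v = (\<lambda>w. q_laurent * v w)" using left_invariant_iff_eigen[OF v J] l that by blast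
    finally show ?thesis by (simp only: Rmul_smult)
  qed
  then show ?thesis using left_invariant_iff_eigen[OF supp_Rmul J] by blast
qed

text \<open>Multiplying the sum over a parabolic subgroup from the right along a reduced word of a shortest coset
  representative gives the sum over the coset.  The left invariance of the product does the work
  usually done by the additivity of lengths: if some element of the previous coset had the next
  generator as a descent, then a coefficient \<open>q - 1\<close> would appear there, while the coefficient at
  the representative is zero.\<close>

lemma Rmul_word_min_coset:
  assumes J: "J \<subseteq> {1..r}"
  shows "d \<in> BW r \<Longrightarrow> \<forall>u\<in>parab r J. B_length r d \<le> B_length r (u \<circ> d) \<Longrightarrow>
    \<exists>is. set is \<subseteq> {1..r} \<and> Rmul_word r is (indic (parab r J)) = indic (parab_coset r J d)"
proof (induction "B_length r d" arbitrary: d)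
  case 0
  have "d = id"
  proof (rule no_rdesc_imp_id[OF 0(2)])
    show "\<not> rdesc r d i" if "i \<in> {1..r}" for i
      using length_right_descent[OF 0(2) that] 0(1) by auto
  qed
  then show ?case by (intro exI[of _ "[]"]) (simp add: Rmul_word_simps parab_coset_def)
next
  case (Suc k)
  have "d \<noteq> id" using Suc(2) B_length_id by force
  then obtain j where j: "j \<in> {1..r}" "rdesc r d j" using no_rdesc_imp_id[OF Suc(3)] by blast
  define d' where "d' = d \<circ> B_refl r j"
  have d': "d' \<in> BW r" "B_length r d = B_length r d' + 1" "d' \<circ> B_refl r j = d"
    unfolding d'_def using Suc(3) j length_right_descent[OF Suc(3) j] by simp_all
  have step: "B_length r (w \<circ> B_refl r j) \<le> B_length r w + 1" if "w \<in> BW r" for w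
    using length_right_ascent[OF that j(1)] length_right_descent[OF that j(1)] by (cases "rdesc r w j") auto
  have min': "\<forall>u\<in>parab r J. B_length r d' \<le> B_length r (u \<circ> d')"
  proof
    fix u assume u: "u \<in> parab r J"
    have ub: "u \<circ> d' \<in> BW r" using parab_in[OF J u] d'(1) by blast
    have "(u \<circ> d') \<circ> B_refl r j = u \<circ> d" by (simp only: comp_assoc d'(3))
    then have "B_length r (u \<circ> d) \<le> B_length r (u \<circ> d') + 1" using step[OF ub] by simp
    then show "B_length r d' \<le> B_length r (u \<circ> d')" using Suc(4) u d'(2) by fastforce
  qed
  obtain "is" where "is": "set is \<subseteq> {1..r}" "Rmul_word r is (indic (parab r J)) = indic (parab_coset r J d')"
    using Suc(1)[OF _ d'(1) min'] Suc(2) d'(2) by auto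
  let ?C = "parab_coset r J d'"
  let ?v = "Rmul r j (indic ?C)"
  have Cs: "?C \<subseteq> BW r" by (rule parab_coset_subset[OF J d'(1)])
  have dn: "d \<notin> ?C"
  proof
    assume "d \<in> ?C"
    then obtain u where u: "u \<in> parab r J" "d = u \<circ> d'" by (auto simp: parab_coset_def)
    have "pinv u \<circ> d = (pinv u \<circ> u) \<circ> d'" unfolding u(2) by (simp only: comp_assoc)
    then have "pinv u \<circ> d = d'" using BW_inv_comp(2)[OF parab_in[OF J u(1)]] by simp
    then show False using Suc(4) parab_inv[OF J u(1)] d'(2) by fastforce
  qed
  have out: "w \<circ> B_refl r j \<notin> ?C" if wC: "w \<in> ?C" for w
  proof
    assume a: "w \<circ> B_refl r j \<in> ?C"
    obtain u where u: "u \<in> parab r J" "w = u \<circ> d'" using wC by (auto simp: parab_coset_def)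
    have "w \<circ> B_refl r j = u \<circ> d" unfolding u(2) by (simp only: comp_assoc d'(3))
    then show False using a parab_coset_comp[OF J u(1) Suc(3)] dn by simp
  qed
  have lv: "left_invariant r J ?v"
    by (rule left_invariant_Rmul[OF J left_invariant_indic_parab_coset[OF J] supp_indic[OF Cs] j(1)])
  have nd': "\<not> rdesc r d' j" using rdesc_comp[OF Suc(3) j(1)] j(2) unfolding d'_def by simp
  have v0: "?v d' = 0"
    using nd' out[OF parab_coset_self] by (simp add: Rmul_apply[OF d'(1)] indic_def)
  have nd: "\<not> rdesc r w j" if wC: "w \<in> ?C" for w
  proof
    assume d: "rdesc r w j"
    obtain u where u: "u \<in> parab r J" "w = u \<circ> d'" using wC by (auto simp: parab_coset_def)
    have "?v w = 0" using left_invariant_parab[OF J lv u(1) d'(1)] v0 u(2) by simp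
    moreover have "?v w = q_laurent - 1"
      using wC d out[OF wC] Cs by (simp add: Rmul_apply subset_iff indic_def)
    ultimately show False using q_ne_one by simp
  qed
  have mem: "w \<in> parab_coset r J d \<longleftrightarrow> w \<circ> B_refl r j \<in> ?C" if "w \<in> BW r" for w
  proof
    assume "w \<in> parab_coset r J d"
    then obtain u where u: "u \<in> parab r J" "w = u \<circ> d" by (auto simp: parab_coset_def)
    have "w \<circ> B_refl r j = u \<circ> d'" unfolding u(2) d'_def by (simp only: comp_assoc)
    then show "w \<circ> B_refl r j \<in> ?C" using u(1) by (auto simp: parab_coset_def)
  next
    assume "w \<circ> B_refl r j \<in> ?C"
    then obtain u where u: "u \<in> parab r J" "w \<circ> B_refl r j = u \<circ> d'" by (auto simp: parab_coset_def)
    have "w = (w \<circ> B_refl r j) \<circ> B_refl r j" using j by simp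
    also have "\<dots> = u \<circ> d" unfolding u(2) by (simp only: comp_assoc d'(3))
    finally show "w \<in> parab_coset r J d" using u(1) by (auto simp: parab_coset_def)
  qed
  have "?v = indic (parab_coset r J d)"
  proof
    fix w
    show "?v w = indic (parab_coset r J d) w"
    proof (cases "w \<in> BW r")
      case False
      then show ?thesis using parab_coset_subset[OF J Suc(3)] by (auto simp: Rmul_out indic_def)
    next
      case w: True
      consider "w \<in> ?C" | "w \<notin> ?C" "w \<circ> B_refl r j \<in> ?C" | "w \<notin> ?C" "w \<circ> B_refl r j \<notin> ?C" by blast
      then show ?thesis
      proof cases
        case 1
        then show ?thesis using out[OF 1] nd[OF 1] mem[OF w] by (simp add: Rmul_apply[OF w] indic_def)
      next
        case 2
        have "rdesc r w j" using nd[OF 2(2)] rdesc_comp[OF w j(1)] by simp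
        then show ?thesis using 2 mem[OF w] by (simp add: Rmul_apply[OF w] indic_def)
      next
        case 3
        then show ?thesis using mem[OF w] by (simp add: Rmul_apply[OF w] indic_def)
      qed
    qed
  qed
  then have "Rmul_word r (is @ [j]) (indic (parab r J)) = indic (parab_coset r J d)"
    using "is"(2) by (simp add: Rmul_word_simps)
  moreover have "set (is @ [j]) \<subseteq> {1..r}" using "is"(1) j(1) by simp
  ultimately show ?case by blast
qed

lemma Rmul_word_coset:
  assumes J: "J \<subseteq> {1..r}" and d: "d \<in> BW r"
  shows "\<exists>is. set is \<subseteq> {1..r} \<and> Rmul_word r is (indic (parab r J)) = indic (parab_coset r J d)"
proof -
  obtain m where m: "m \<in> parab_coset r J d" "\<And>w. w \<in> parab_coset r J d \<Longrightarrow> B_length r m \<le> B_length r w"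
    using ex_has_least_nat[of "\<lambda>w. w \<in> parab_coset r J d" d "B_length r"] parab_coset_self by blast
  have mb: "m \<in> BW r" using m(1) parab_coset_subset[OF J d] by blast
  have e: "parab_coset r J m = parab_coset r J d" by (rule parab_coset_eq[OF J d m(1)])
  have "\<forall>u\<in>parab r J. B_length r m \<le> B_length r (u \<circ> m)"
    using m(2) e by (auto simp: parab_coset_def)
  from Rmul_word_min_coset[OF J mb this] show ?thesis unfolding e .
qed

text \<open>An invariant function is a combination of indicator functions of cosets; they are removed one at a
  time, each time reducing the support.\<close>

lemma left_invariant_induct [consumes 3, case_names zero add]:
  assumes J: "J \<subseteq> {1..r}" and "left_invariant r J v" "supp r v"
    and zero: "P (\<lambda>w. 0)"
    and add: "\<And>v a d. d \<in> BW r \<Longrightarrow> P v \<Longrightarrow> P (\<lambda>w. v w + a * indic (parab_coset r J d) w)"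
  shows "P v"
  using assms(2,3)
proof (induction "card {w \<in> BW r. v w \<noteq> 0}" arbitrary: v rule: less_induct)
  case less
  show ?case
  proof (cases "\<exists>d\<in>BW r. v d \<noteq> 0")
    case False
    then have "v = (\<lambda>w. 0)" using less.prems(2) by (auto simp: supp_def fun_eq_iff)
    then show ?thesis using zero by simp
  next
    case True
    then obtain d where d: "d \<in> BW r" "v d \<noteq> 0" by blast
    let ?C = "parab_coset r J d"
    define v' where "v' = (\<lambda>w. v w - v d * indic ?C w)"
    have Cs: "?C \<subseteq> BW r" by (rule parab_coset_subset[OF J d(1)])
    have vC: "v w = v d" if "w \<in> ?C" for w
      using that left_invariant_parab[OF J less.prems(1) _ d(1)] by (auto simp: parab_coset_def)
    have "{w \<in> BW r. v' w \<noteq> 0} \<subset> {w \<in> BW r. v w \<noteq> 0}"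
    proof
      show "{w \<in> BW r. v' w \<noteq> 0} \<subseteq> {w \<in> BW r. v w \<noteq> 0}"
        using vC by (auto simp: v'_def indic_def)
      have "v' d = 0" using parab_coset_self[of d r J] by (simp add: v'_def indic_def)
      then show "{w \<in> BW r. v' w \<noteq> 0} \<noteq> {w \<in> BW r. v w \<noteq> 0}" using d by blast
    qed
    then have "card {w \<in> BW r. v' w \<noteq> 0} < card {w \<in> BW r. v w \<noteq> 0}"
      using finite_BW by (intro psubset_card_mono) auto
    moreover have "left_invariant r J v'"
      using less.prems(1) left_invariant_indic_parab_coset[OF J, of d] by (simp add: left_invariant_def v'_def)
    moreover have "supp r v'" using less.prems(2) supp_indic[OF Cs] by (simp add: supp_def v'_def)
    ultimately have "P v'" by (rule less.hyps)
    from add[OF d(1) this, of "v d"] show ?thesis by (simp add: v'_def)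
  qed
qed

definition parab_sum :: "nat \<Rightarrow> nat set \<Rightarrow> hecke_elt" where
  "parab_sum r J = hecke_T_sum r (parab r J)"

lemma parab_sum_closed [simp]: "J \<subseteq> {1..r} \<Longrightarrow> parab_sum r J \<in> carrier (hecke r)"
  unfolding parab_sum_def by (rule hecke_T_sum_closed[OF parab_subset])

lemma T_coeff_parab_sum: "J \<subseteq> {1..r} \<Longrightarrow> T_coeff r (parab_sum r J) = indic (parab r J)"
  unfolding parab_sum_def by (rule T_coeff_T_sum[OF parab_subset])

lemma parab_coset_id: "parab_coset r J id = parab r J"
  by (simp add: parab_coset_def)

lemma gen_parab_sum:
  assumes J: "J \<subseteq> {1..r}" and i: "i \<in> J"
  shows "T_word r [i] \<otimes>\<^bsub>hecke r\<^esub> parab_sum r J = hecke_scalar r q_laurent \<otimes>\<^bsub>hecke r\<^esub> parab_sum r J"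
    and "parab_sum r J \<otimes>\<^bsub>hecke r\<^esub> T_word r [i] = hecke_scalar r q_laurent \<otimes>\<^bsub>hecke r\<^esub> parab_sum r J"
proof -
  interpret H: ring "hecke r" by (rule hecke_ring)
  have i': "i \<in> {1..r}" using J i by blast
  have l: "left_invariant r J (indic (parab r J))" using left_invariant_indic_parab_coset[OF J, of id] unfolding parab_coset_id .
  have s: "supp r (indic (parab r J))" by (rule supp_indic[OF parab_subset[OF J]])
  have f: "inv_pull r (indic (parab r J)) = indic (parab r J)"
  proof
    fix w show "inv_pull r (indic (parab r J)) w = indic (parab r J) w"
      using parab_inv[OF J, of w] parab_inv[OF J, of "pinv w"] parab_in[OF J, of w]
      by (auto simp: inv_pull_def indic_def)
  qed
  have r: "right_invariant r J (indic (parab r J))" unfolding right_invariant_inv_pull[OF J] f by (rule l)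
  have c: "T_word r [i] \<in> carrier (hecke r)" using i' by (intro T_word_closed) auto
  note x = parab_sum_closed[OF J]
  show "T_word r [i] \<otimes>\<^bsub>hecke r\<^esub> parab_sum r J = hecke_scalar r q_laurent \<otimes>\<^bsub>hecke r\<^esub> parab_sum r J"
  proof (rule T_coeff_inj)
    show "T_coeff r (T_word r [i] \<otimes>\<^bsub>hecke r\<^esub> parab_sum r J) = T_coeff r (hecke_scalar r q_laurent \<otimes>\<^bsub>hecke r\<^esub> parab_sum r J)"
      unfolding T_coeff_gen[OF i' x] T_coeff_scalar[OF x] T_coeff_parab_sum[OF J] using l left_invariant_iff_eigen[OF s J] i by blast
  qed (use c x in simp_all)
  show "parab_sum r J \<otimes>\<^bsub>hecke r\<^esub> T_word r [i] = hecke_scalar r q_laurent \<otimes>\<^bsub>hecke r\<^esub> parab_sum r J"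
  proof (rule T_coeff_inj)
    show "T_coeff r (parab_sum r J \<otimes>\<^bsub>hecke r\<^esub> T_word r [i]) = T_coeff r (hecke_scalar r q_laurent \<otimes>\<^bsub>hecke r\<^esub> parab_sum r J)"
      unfolding T_coeff_gen_right[OF i' x] T_coeff_scalar[OF x] T_coeff_parab_sum[OF J] using r right_invariant_iff_eigen[OF s J] i by blast
  qed (use c x in simp_all)
qed

lemma parab_sum_mult_left_invariant:
  assumes J: "J \<subseteq> {1..r}" and h: "h \<in> carrier (hecke r)"
  shows "left_invariant r J (T_coeff r (parab_sum r J \<otimes>\<^bsub>hecke r\<^esub> h))"
proof -
  interpret H: ring "hecke r" by (rule hecke_ring)
  note x = parab_sum_closed[OF J]
  have xh: "parab_sum r J \<otimes>\<^bsub>hecke r\<^esub> h \<in> carrier (hecke r)" using x h by simp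
  have "Lmul r i (T_coeff r (parab_sum r J \<otimes>\<^bsub>hecke r\<^esub> h)) = (\<lambda>w. q_laurent * T_coeff r (parab_sum r J \<otimes>\<^bsub>hecke r\<^esub> h) w)" if i: "i \<in> J" for i
  proof -
    have i': "i \<in> {1..r}" using J i by blast
    have c: "T_word r [i] \<in> carrier (hecke r)" using i' by (intro T_word_closed) auto
    have "T_word r [i] \<otimes>\<^bsub>hecke r\<^esub> (parab_sum r J \<otimes>\<^bsub>hecke r\<^esub> h) = hecke_scalar r q_laurent \<otimes>\<^bsub>hecke r\<^esub> (parab_sum r J \<otimes>\<^bsub>hecke r\<^esub> h)"
      using gen_parab_sum(1)[OF J i] c x h by (simp add: H.m_assoc[symmetric])
    then show ?thesis using T_coeff_gen[OF i' xh] T_coeff_scalar[OF xh] by metis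
  qed
  then show ?thesis using left_invariant_iff_eigen[OF supp_T_coeff[OF xh] J] by blast
qed

text \<open>By induction along cosets, since the sum over each coset is a right multiple of the sum over the
  parabolic subgroup.\<close>

lemma left_invariant_parab_sum_mult:
  assumes J: "J \<subseteq> {1..r}" and y: "y \<in> carrier (hecke r)" and l: "left_invariant r J (T_coeff r y)"
  shows "\<exists>h\<in>carrier (hecke r). y = parab_sum r J \<otimes>\<^bsub>hecke r\<^esub> h"
proof -
  interpret H: ring "hecke r" by (rule hecke_ring)
  note x = parab_sum_closed[OF J]
  have "\<exists>h\<in>carrier (hecke r). T_coeff r (parab_sum r J \<otimes>\<^bsub>hecke r\<^esub> h) = T_coeff r y"
    using J l supp_T_coeff[OF y]
  proof (induction rule: left_invariant_induct)
    case zero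
    then show ?case using x T_coeff_zero[of r] by (intro bexI[of _ "\<zero>\<^bsub>hecke r\<^esub>"]) simp_all
  next
    case (add v a d)
    then obtain h where h: "h \<in> carrier (hecke r)" "T_coeff r (parab_sum r J \<otimes>\<^bsub>hecke r\<^esub> h) = v" by blast
    obtain "is" where "is": "set is \<subseteq> {1..r}" "Rmul_word r is (indic (parab r J)) = indic (parab_coset r J d)"
      using Rmul_word_coset[OF J add(1)] by blast
    note c = T_word_closed[OF "is"(1)]
    have "T_coeff r (parab_sum r J \<otimes>\<^bsub>hecke r\<^esub> T_word r is) = indic (parab_coset r J d)"
      unfolding T_coeff_T_word_right[OF "is"(1) x] T_coeff_parab_sum[OF J] by (rule "is"(2))
    moreover have "parab_sum r J \<otimes>\<^bsub>hecke r\<^esub> (h \<oplus>\<^bsub>hecke r\<^esub> T_word r is \<otimes>\<^bsub>hecke r\<^esub> hecke_scalar r a)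
        = parab_sum r J \<otimes>\<^bsub>hecke r\<^esub> h \<oplus>\<^bsub>hecke r\<^esub> (parab_sum r J \<otimes>\<^bsub>hecke r\<^esub> T_word r is) \<otimes>\<^bsub>hecke r\<^esub> hecke_scalar r a"
      using x h c by (simp add: H.r_distr H.m_assoc)
    ultimately have "T_coeff r (parab_sum r J \<otimes>\<^bsub>hecke r\<^esub> (h \<oplus>\<^bsub>hecke r\<^esub> T_word r is \<otimes>\<^bsub>hecke r\<^esub> hecke_scalar r a))
        = (\<lambda>w. v w + a * indic (parab_coset r J d) w)"
      using x h c by (simp add: T_coeff_add T_coeff_scalar_right)
    then show ?case using h c by (intro bexI[of _ "h \<oplus>\<^bsub>hecke r\<^esub> T_word r is \<otimes>\<^bsub>hecke r\<^esub> hecke_scalar r a"]) simp_all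
  qed
  then show ?thesis using T_coeff_inj[of _ r y] x y by (metis H.m_closed)
qed

lemma right_invariant_mult_parab_sum:
  assumes J: "J \<subseteq> {1..r}" and y: "y \<in> carrier (hecke r)" and l: "right_invariant r J (T_coeff r y)"
  shows "\<exists>h\<in>carrier (hecke r). y = h \<otimes>\<^bsub>hecke r\<^esub> parab_sum r J"
proof -
  interpret H: ring "hecke r" by (rule hecke_ring)
  note x = parab_sum_closed[OF J]
  have fx: "inv_pull r (indic (parab r J)) = indic (parab r J)"
  proof
    fix w show "inv_pull r (indic (parab r J)) w = indic (parab r J) w"
      using parab_inv[OF J, of w] parab_inv[OF J, of "pinv w"] parab_in[OF J, of w]
      by (auto simp: inv_pull_def indic_def)
  qed
  have fl: "inv_pull r (\<lambda>w. v w + a * u w) = (\<lambda>w. inv_pull r v w + a * inv_pull r u w)" for v a u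
    by (auto simp: inv_pull_def)
  have "left_invariant r J (inv_pull r (T_coeff r y))" using l right_invariant_inv_pull[OF J] by simp
  with J have "\<exists>h\<in>carrier (hecke r). T_coeff r (h \<otimes>\<^bsub>hecke r\<^esub> parab_sum r J) = inv_pull r (inv_pull r (T_coeff r y))"
    using supp_inv_pull
  proof (induction rule: left_invariant_induct)
    case zero
    then show ?case using x T_coeff_zero[of r] by (intro bexI[of _ "\<zero>\<^bsub>hecke r\<^esub>"]) (auto simp: inv_pull_def)
  next
    case (add v a d)
    then obtain h where h: "h \<in> carrier (hecke r)" "T_coeff r (h \<otimes>\<^bsub>hecke r\<^esub> parab_sum r J) = inv_pull r v" by blast
    obtain "is" where "is": "set is \<subseteq> {1..r}" "Rmul_word r is (indic (parab r J)) = indic (parab_coset r J d)"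
      using Rmul_word_coset[OF J add(1)] by blast
    have sr: "set (rev is) \<subseteq> {1..r}" using "is" by simp
    note c = T_word_closed[OF sr]
    have "T_coeff r (T_word r (rev is) \<otimes>\<^bsub>hecke r\<^esub> parab_sum r J) = Lmul_word r (rev is) (inv_pull r (indic (parab r J)))"
      unfolding T_coeff_T_word_left[OF sr x] T_coeff_parab_sum[OF J] fx ..
    also have "\<dots> = inv_pull r (indic (parab_coset r J d))" unfolding Lmul_word_inv_pull[OF "is"(1)] "is"(2) ..
    finally have e: "T_coeff r (T_word r (rev is) \<otimes>\<^bsub>hecke r\<^esub> parab_sum r J) = inv_pull r (indic (parab_coset r J d))" .
    have "(h \<oplus>\<^bsub>hecke r\<^esub> hecke_scalar r a \<otimes>\<^bsub>hecke r\<^esub> T_word r (rev is)) \<otimes>\<^bsub>hecke r\<^esub> parab_sum r J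
        = h \<otimes>\<^bsub>hecke r\<^esub> parab_sum r J \<oplus>\<^bsub>hecke r\<^esub> hecke_scalar r a \<otimes>\<^bsub>hecke r\<^esub> (T_word r (rev is) \<otimes>\<^bsub>hecke r\<^esub> parab_sum r J)"
      using x h c by (simp add: H.l_distr H.m_assoc)
    with e have "T_coeff r ((h \<oplus>\<^bsub>hecke r\<^esub> hecke_scalar r a \<otimes>\<^bsub>hecke r\<^esub> T_word r (rev is)) \<otimes>\<^bsub>hecke r\<^esub> parab_sum r J)
        = inv_pull r (\<lambda>w. v w + a * indic (parab_coset r J d) w)"
      using x h c by (simp add: T_coeff_add T_coeff_scalar fl)
    then show ?case using h c by (intro bexI[of _ "h \<oplus>\<^bsub>hecke r\<^esub> hecke_scalar r a \<otimes>\<^bsub>hecke r\<^esub> T_word r (rev is)"]) simp_all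
  qed
  then show ?thesis using T_coeff_inj[of _ r y] x y inv_pull_inv_pull[OF supp_T_coeff[OF y]] by (metis H.m_closed)
qed

lemma mult_parab_sum_right_invariant:
  assumes J: "J \<subseteq> {1..r}" and y: "y \<in> carrier (hecke r)"
    and e: "\<And>i. i \<in> J \<Longrightarrow> y \<otimes>\<^bsub>hecke r\<^esub> T_word r [i] = hecke_scalar r q_laurent \<otimes>\<^bsub>hecke r\<^esub> y"
  shows "right_invariant r J (T_coeff r y)"
proof -
  have "Rmul r i (T_coeff r y) = (\<lambda>w. q_laurent * T_coeff r y w)" if i: "i \<in> J" for i
  proof -
    have i': "i \<in> {1..r}" using J i by blast
    show ?thesis using e[OF i] T_coeff_gen_right[OF i' y] T_coeff_scalar[OF y] by metis
  qed
  then show ?thesis using right_invariant_iff_eigen[OF supp_T_coeff[OF y] J] by blast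
qed

section \<open>Endomorphisms of the tensor space\<close>

definition parab_gens :: "nat \<Rightarrow> nat \<Rightarrow> nat list \<Rightarrow> nat set" where
  "parab_gens n r lam = {1..r} - {sum_list (take i lam) | i. 1 \<le> i \<and> i \<le> n}"

lemma parab_gens_subset: "parab_gens n r lam \<subseteq> {1..r}"
  by (auto simp: parab_gens_def)

lemma parabolic_eq: "parabolic n r lam = parab r (parab_gens n r lam)"
  by (simp add: parabolic_def parab_def parab_gens_def)

lemma x_tilde_eq: "x_tilde n r lam = parab_sum r (parab_gens n r lam)"
  by (simp add: x_tilde_def parab_sum_def parabolic_eq)

lemma x_tilde_closed [simp]: "x_tilde n r lam \<in> carrier (hecke r)"
  unfolding x_tilde_eq by (rule parab_sum_closed[OF parab_gens_subset])

definition xmod :: "nat \<Rightarrow> nat \<Rightarrow> nat list \<Rightarrow> hecke_elt set" where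
  "xmod n r lam = {x_tilde n r lam \<otimes>\<^bsub>hecke r\<^esub> h | h. h \<in> carrier (hecke r)}"

lemma xmod_iff: "y \<in> xmod n r lam \<longleftrightarrow> y \<in> carrier (hecke r) \<and> left_invariant r (parab_gens n r lam) (T_coeff r y)"
proof -
  interpret H: ring "hecke r" by (rule hecke_ring)
  show ?thesis
  proof
    assume "y \<in> xmod n r lam"
    then obtain h where h: "h \<in> carrier (hecke r)" "y = parab_sum r (parab_gens n r lam) \<otimes>\<^bsub>hecke r\<^esub> h"
      unfolding xmod_def x_tilde_eq by blast
    show "y \<in> carrier (hecke r) \<and> left_invariant r (parab_gens n r lam) (T_coeff r y)"
      unfolding h(2) using parab_sum_mult_left_invariant[OF parab_gens_subset h(1)] H.m_closed[OF parab_sum_closed[OF parab_gens_subset] h(1)] by blast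
  next
    assume "y \<in> carrier (hecke r) \<and> left_invariant r (parab_gens n r lam) (T_coeff r y)"
    then obtain h where h: "h \<in> carrier (hecke r)" "y = parab_sum r (parab_gens n r lam) \<otimes>\<^bsub>hecke r\<^esub> h"
      using left_invariant_parab_sum_mult[OF parab_gens_subset] by blast
    then show "y \<in> xmod n r lam" unfolding xmod_def x_tilde_eq by blast
  qed
qed

lemma xmod_closed: "y \<in> xmod n r lam \<Longrightarrow> y \<in> carrier (hecke r)"
  by (simp add: xmod_iff)

lemma xmod_zero: "\<zero>\<^bsub>hecke r\<^esub> \<in> xmod n r lam"
proof -
  interpret H: ring "hecke r" by (rule hecke_ring)
  show ?thesis by (simp add: xmod_iff T_coeff_zero left_invariant_def)
qed

lemma xmod_add: "x \<in> xmod n r lam \<Longrightarrow> y \<in> xmod n r lam \<Longrightarrow> x \<oplus>\<^bsub>hecke r\<^esub> y \<in> xmod n r lam"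
proof -
  interpret H: ring "hecke r" by (rule hecke_ring)
  show "x \<in> xmod n r lam \<Longrightarrow> y \<in> xmod n r lam \<Longrightarrow> x \<oplus>\<^bsub>hecke r\<^esub> y \<in> xmod n r lam"
    by (simp add: xmod_iff T_coeff_add left_invariant_def)
qed

lemma xmod_mult:
  assumes "y \<in> xmod n r lam" "h \<in> carrier (hecke r)"
  shows "y \<otimes>\<^bsub>hecke r\<^esub> h \<in> xmod n r lam"
proof -
  interpret H: ring "hecke r" by (rule hecke_ring)
  obtain g where g: "g \<in> carrier (hecke r)" "y = x_tilde n r lam \<otimes>\<^bsub>hecke r\<^esub> g"
    using assms by (auto simp: xmod_def)
  then have "y \<otimes>\<^bsub>hecke r\<^esub> h = x_tilde n r lam \<otimes>\<^bsub>hecke r\<^esub> (g \<otimes>\<^bsub>hecke r\<^esub> h)"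
    using assms by (simp add: H.m_assoc)
  then show ?thesis unfolding xmod_def using g assms by blast
qed

lemma x_tilde_mult_xmod: "h \<in> carrier (hecke r) \<Longrightarrow> x_tilde n r lam \<otimes>\<^bsub>hecke r\<^esub> h \<in> xmod n r lam"
  by (auto simp: xmod_def)

lemma x_tilde_xmod: "x_tilde n r lam \<in> xmod n r lam"
proof -
  interpret H: ring "hecke r" by (rule hecke_ring)
  show ?thesis using x_tilde_mult_xmod[of "\<one>\<^bsub>hecke r\<^esub>" r n lam] by simp
qed

lemma finite_Lambda: "finite (Lambda n r)"
proof (rule finite_subset)
  show "Lambda n r \<subseteq> {xs. set xs \<subseteq> {0..r} \<and> length xs = n + 1}"
  proof
    fix xs assume xs: "xs \<in> Lambda n r"
    have "x \<le> sum_list ys" if "x \<in> set ys" for x and ys :: "nat list"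
      using that by (induction ys) auto
    then show "xs \<in> {xs. set xs \<subseteq> {0..r} \<and> length xs = n + 1}"
      using xs by (auto simp: Lambda_def)
  qed
  show "finite {xs. set xs \<subseteq> {0..r} \<and> length xs = n + 1}"
    by (rule finite_lists_length_eq) simp
qed

subsection \<open>The tensor space\<close>

lemma tspace_eq: "tspace n r = (\<Pi>\<^sub>E lam\<in>Lambda n r. xmod n r lam)"
  by (simp add: tspace_def xmod_def)

lemma tspace_mem: "u \<in> tspace n r \<Longrightarrow> lam \<in> Lambda n r \<Longrightarrow> u lam \<in> xmod n r lam"
  unfolding tspace_eq by (rule PiE_mem)

lemma tspace_mem_carrier: "u \<in> tspace n r \<Longrightarrow> lam \<in> Lambda n r \<Longrightarrow> u lam \<in> carrier (hecke r)"
  using tspace_mem xmod_closed by blast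

lemma tspaceI: "(\<And>lam. lam \<in> Lambda n r \<Longrightarrow> u lam \<in> xmod n r lam) \<Longrightarrow> restrict u (Lambda n r) \<in> tspace n r"
  unfolding tspace_eq by auto

lemma tspace_eqI:
  "u \<in> tspace n r \<Longrightarrow> v \<in> tspace n r \<Longrightarrow> (\<And>lam. lam \<in> Lambda n r \<Longrightarrow> u lam = v lam) \<Longrightarrow> u = v"
  unfolding tspace_eq by (rule PiE_ext)

lemma tspace_add_closed [simp]: "u \<in> tspace n r \<Longrightarrow> v \<in> tspace n r \<Longrightarrow> tspace_add n r u v \<in> tspace n r"
  unfolding tspace_add_def by (intro tspaceI xmod_add tspace_mem)

lemma tspace_act_closed [simp]: "u \<in> tspace n r \<Longrightarrow> h \<in> carrier (hecke r) \<Longrightarrow> tspace_act n r u h \<in> tspace n r"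
  unfolding tspace_act_def by (intro tspaceI xmod_mult tspace_mem)

lemma tspace_zero_closed [simp]: "tspace_zero n r \<in> tspace n r"
  unfolding tspace_zero_def by (intro tspaceI xmod_zero)

lemma tspace_inj_closed [simp]: "x \<in> xmod n r mu \<Longrightarrow> tspace_inj n r mu x \<in> tspace n r"
  unfolding tspace_inj_def by (intro tspaceI) (simp add: xmod_zero)

lemma tspace_apply [simp]:
  assumes "lam \<in> Lambda n r"
  shows "tspace_add n r u v lam = u lam \<oplus>\<^bsub>hecke r\<^esub> v lam"
    "tspace_act n r u h lam = u lam \<otimes>\<^bsub>hecke r\<^esub> h"
    "tspace_zero n r lam = \<zero>\<^bsub>hecke r\<^esub>"
    "tspace_inj n r mu x lam = (if lam = mu then x else \<zero>\<^bsub>hecke r\<^esub>)"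
  using assms by (simp_all add: tspace_add_def tspace_act_def tspace_zero_def tspace_inj_def)

lemma tspace_inj_act:
  assumes "x \<in> xmod n r mu" "h \<in> carrier (hecke r)"
  shows "tspace_act n r (tspace_inj n r mu x) h = tspace_inj n r mu (x \<otimes>\<^bsub>hecke r\<^esub> h)"
proof -
  interpret H: ring "hecke r" by (rule hecke_ring)
  show ?thesis
    by (rule tspace_eqI[of _ n r]) (use assms in \<open>simp_all add: xmod_mult\<close>)
qed

lemma tspace_inj_add:
  assumes "x \<in> xmod n r mu" "y \<in> xmod n r mu"
  shows "tspace_add n r (tspace_inj n r mu x) (tspace_inj n r mu y) = tspace_inj n r mu (x \<oplus>\<^bsub>hecke r\<^esub> y)"
proof -
  interpret H: ring "hecke r" by (rule hecke_ring)
  show ?thesis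
    by (rule tspace_eqI[of _ n r]) (use assms in \<open>simp_all add: xmod_add\<close>)
qed

subsection \<open>The endomorphism ring\<close>

lemma schur_carrier: "f \<in> carrier (schur n r) \<longleftrightarrow> f \<in> tspace n r \<rightarrow>\<^sub>E tspace n r \<and>
    (\<forall>u\<in>tspace n r. \<forall>v\<in>tspace n r. f (tspace_add n r u v) = tspace_add n r (f u) (f v)) \<and>
    (\<forall>u\<in>tspace n r. \<forall>h\<in>carrier (hecke r). f (tspace_act n r u h) = tspace_act n r (f u) h)"
  by (simp add: schur_def)

lemma schur_mem [simp]: "f \<in> carrier (schur n r) \<Longrightarrow> u \<in> tspace n r \<Longrightarrow> f u \<in> tspace n r"
  using PiE_mem[of f "tspace n r" "\<lambda>_. tspace n r" u] by (simp add: schur_carrier)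

lemma schur_hom_add: "f \<in> carrier (schur n r) \<Longrightarrow> u \<in> tspace n r \<Longrightarrow> v \<in> tspace n r \<Longrightarrow>
    f (tspace_add n r u v) = tspace_add n r (f u) (f v)"
  unfolding schur_carrier by blast

lemma schur_hom_act: "f \<in> carrier (schur n r) \<Longrightarrow> u \<in> tspace n r \<Longrightarrow> h \<in> carrier (hecke r) \<Longrightarrow>
    f (tspace_act n r u h) = tspace_act n r (f u) h"
  unfolding schur_carrier by blast

lemma schur_eqI: "f \<in> carrier (schur n r) \<Longrightarrow> g \<in> carrier (schur n r) \<Longrightarrow>
    (\<And>u. u \<in> tspace n r \<Longrightarrow> f u = g u) \<Longrightarrow> f = g"
  unfolding schur_carrier
  by (rule PiE_ext[of f "tspace n r" "\<lambda>_. tspace n r" g]) simp_all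

lemma schurI:
  assumes "\<And>u. u \<in> tspace n r \<Longrightarrow> f u \<in> tspace n r"
    and "\<And>u v. u \<in> tspace n r \<Longrightarrow> v \<in> tspace n r \<Longrightarrow> f (tspace_add n r u v) = tspace_add n r (f u) (f v)"
    and "\<And>u h. u \<in> tspace n r \<Longrightarrow> h \<in> carrier (hecke r) \<Longrightarrow> f (tspace_act n r u h) = tspace_act n r (f u) h"
  shows "restrict f (tspace n r) \<in> carrier (schur n r)"
  unfolding schur_carrier using assms by simp

lemma schur_mult_apply: "u \<in> tspace n r \<Longrightarrow> (f \<otimes>\<^bsub>schur n r\<^esub> g) u = f (g u)"
  by (simp add: schur_def compose_def)

lemma schur_add_apply: "u \<in> tspace n r \<Longrightarrow> (f \<oplus>\<^bsub>schur n r\<^esub> g) u = tspace_add n r (f u) (g u)"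
  by (simp add: schur_def)

lemma schur_one_apply: "u \<in> tspace n r \<Longrightarrow> \<one>\<^bsub>schur n r\<^esub> u = u"
  by (simp add: schur_def)

lemma schur_zero_apply: "u \<in> tspace n r \<Longrightarrow> \<zero>\<^bsub>schur n r\<^esub> u = tspace_zero n r"
  by (simp add: schur_def)

lemma schur_smult_apply: "u \<in> tspace n r \<Longrightarrow> schur_smult n r a f u = tspace_act n r (f u) (hecke_scalar r a)"
  by (simp add: schur_smult_def)

lemmas schur_apply = schur_mult_apply schur_add_apply schur_one_apply schur_zero_apply schur_smult_apply

lemma schur_mult_closed:
  assumes "f \<in> carrier (schur n r)" "g \<in> carrier (schur n r)"
  shows "f \<otimes>\<^bsub>schur n r\<^esub> g \<in> carrier (schur n r)"
proof -
  have "f \<otimes>\<^bsub>schur n r\<^esub> g = restrict (\<lambda>u. f (g u)) (tspace n r)"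
    by (simp add: schur_def compose_def)
  also have "\<dots> \<in> carrier (schur n r)"
    by (rule schurI) (use assms in \<open>simp_all add: schur_hom_add schur_hom_act\<close>)
  finally show ?thesis .
qed

lemma schur_add_closed:
  assumes "f \<in> carrier (schur n r)" "g \<in> carrier (schur n r)"
  shows "f \<oplus>\<^bsub>schur n r\<^esub> g \<in> carrier (schur n r)"
proof -
  interpret H: ring "hecke r" by (rule hecke_ring)
  have "f \<oplus>\<^bsub>schur n r\<^esub> g = restrict (\<lambda>u. tspace_add n r (f u) (g u)) (tspace n r)"
    by (simp add: schur_def)
  also have "\<dots> \<in> carrier (schur n r)"
  proof (rule schurI)
    fix u v assume uv: "u \<in> tspace n r" "v \<in> tspace n r"
    have "tspace_add n r (tspace_add n r a b) (tspace_add n r c d) = tspace_add n r (tspace_add n r a c) (tspace_add n r b d)"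
      if "a \<in> tspace n r" "b \<in> tspace n r" "c \<in> tspace n r" "d \<in> tspace n r" for a b c d
      by (rule tspace_eqI[of _ n r])
        (use that in \<open>simp_all add: H.a_assoc H.a_lcomm tspace_mem_carrier[where n=n]\<close>)
    then show "tspace_add n r (f (tspace_add n r u v)) (g (tspace_add n r u v))
        = tspace_add n r (tspace_add n r (f u) (g u)) (tspace_add n r (f v) (g v))"
      using assms uv by (simp add: schur_hom_add)
  next
    fix u h assume uh: "u \<in> tspace n r" "h \<in> carrier (hecke r)"
    have "tspace_add n r (tspace_act n r a h) (tspace_act n r b h) = tspace_act n r (tspace_add n r a b) h"
      if "a \<in> tspace n r" "b \<in> tspace n r" for a b
      by (rule tspace_eqI[of _ n r])
        (use that uh in \<open>simp_all add: H.l_distr tspace_mem_carrier[where n=n]\<close>)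
    then show "tspace_add n r (f (tspace_act n r u h)) (g (tspace_act n r u h)) = tspace_act n r (tspace_add n r (f u) (g u)) h"
      using assms uh by (simp add: schur_hom_act)
  qed (use assms in simp)
  finally show ?thesis .
qed

lemma schur_smult_closed:
  assumes "f \<in> carrier (schur n r)"
  shows "schur_smult n r a f \<in> carrier (schur n r)"
proof -
  interpret H: ring "hecke r" by (rule hecke_ring)
  have "schur_smult n r a f = restrict (\<lambda>u. tspace_act n r (f u) (hecke_scalar r a)) (tspace n r)"
    by (simp add: schur_smult_def)
  also have "\<dots> \<in> carrier (schur n r)"
  proof (rule schurI)
    fix u v assume uv: "u \<in> tspace n r" "v \<in> tspace n r"
    show "tspace_act n r (f (tspace_add n r u v)) (hecke_scalar r a)
        = tspace_add n r (tspace_act n r (f u) (hecke_scalar r a)) (tspace_act n r (f v) (hecke_scalar r a))"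
      by (rule tspace_eqI[of _ n r])
        (use assms uv in \<open>simp_all add: schur_hom_add H.l_distr tspace_mem_carrier[where n=n]\<close>)
  next
    fix u h assume uh: "u \<in> tspace n r" "h \<in> carrier (hecke r)"
    show "tspace_act n r (f (tspace_act n r u h)) (hecke_scalar r a)
        = tspace_act n r (tspace_act n r (f u) (hecke_scalar r a)) h"
      by (rule tspace_eqI[of _ n r])
        (use assms uh in \<open>simp_all add: schur_hom_act H.m_assoc hecke_scalar_commute[of h] tspace_mem_carrier[where n=n]\<close>)
  qed (use assms in simp)
  finally show ?thesis .
qed

lemma schur_one_closed: "\<one>\<^bsub>schur n r\<^esub> \<in> carrier (schur n r)"
proof -
  have "\<one>\<^bsub>schur n r\<^esub> = restrict (\<lambda>u. u) (tspace n r)" by (simp add: schur_def)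
  also have "\<dots> \<in> carrier (schur n r)" by (rule schurI) simp_all
  finally show ?thesis .
qed

lemma schur_zero_closed: "\<zero>\<^bsub>schur n r\<^esub> \<in> carrier (schur n r)"
proof -
  interpret H: ring "hecke r" by (rule hecke_ring)
  have "\<zero>\<^bsub>schur n r\<^esub> = restrict (\<lambda>u. tspace_zero n r) (tspace n r)" by (simp add: schur_def)
  also have "\<dots> \<in> carrier (schur n r)"
  proof (rule schurI)
    show "tspace_zero n r = tspace_add n r (tspace_zero n r) (tspace_zero n r)"
      by (rule tspace_eqI[of _ n r]) simp_all
    show "tspace_zero n r = tspace_act n r (tspace_zero n r) h" if "h \<in> carrier (hecke r)" for h
      by (rule tspace_eqI[of _ n r]) (use that in simp_all)
  qed simp
  finally show ?thesis .
qed

lemmas schur_closed = schur_mult_closed schur_add_closed schur_smult_closed schur_one_closed schur_zero_closed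

lemma scalar_minus_one:
  assumes "y \<in> carrier (hecke r)"
  shows "y \<otimes>\<^bsub>hecke r\<^esub> hecke_scalar r (-1) \<oplus>\<^bsub>hecke r\<^esub> y = \<zero>\<^bsub>hecke r\<^esub>"
proof -
  interpret H: ring "hecke r" by (rule hecke_ring)
  show ?thesis
    by (rule T_coeff_inj[of _ r]) (use assms in \<open>simp_all add: T_coeff_add T_coeff_scalar_right T_coeff_zero\<close>)
qed

lemma schur_ring: "ring (schur n r)"
proof (rule ringI)
  interpret H: ring "hecke r" by (rule hecke_ring)
  show "abelian_group (schur n r)"
  proof (rule abelian_groupI)
    fix f g h assume fgh: "f \<in> carrier (schur n r)" "g \<in> carrier (schur n r)" "h \<in> carrier (schur n r)"
    show "f \<oplus>\<^bsub>schur n r\<^esub> g \<oplus>\<^bsub>schur n r\<^esub> h = f \<oplus>\<^bsub>schur n r\<^esub> (g \<oplus>\<^bsub>schur n r\<^esub> h)"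
    proof (rule schur_eqI)
      fix u assume u: "u \<in> tspace n r"
      show "(f \<oplus>\<^bsub>schur n r\<^esub> g \<oplus>\<^bsub>schur n r\<^esub> h) u = (f \<oplus>\<^bsub>schur n r\<^esub> (g \<oplus>\<^bsub>schur n r\<^esub> h)) u"
        by (rule tspace_eqI[of _ n r])
          (use u fgh in \<open>simp_all add: schur_closed schur_apply H.a_assoc tspace_mem_carrier[where n=n]\<close>)
    qed (use fgh in \<open>simp_all add: schur_closed\<close>)
  next
    fix f g assume fg: "f \<in> carrier (schur n r)" "g \<in> carrier (schur n r)"
    show "f \<oplus>\<^bsub>schur n r\<^esub> g = g \<oplus>\<^bsub>schur n r\<^esub> f"
    proof (rule schur_eqI)
      fix u assume u: "u \<in> tspace n r"
      show "(f \<oplus>\<^bsub>schur n r\<^esub> g) u = (g \<oplus>\<^bsub>schur n r\<^esub> f) u"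
        by (rule tspace_eqI[of _ n r])
          (use u fg in \<open>simp_all add: schur_closed schur_apply H.a_comm tspace_mem_carrier[where n=n]\<close>)
    qed (use fg in \<open>simp_all add: schur_closed\<close>)
  next
    fix f assume f: "f \<in> carrier (schur n r)"
    show "\<zero>\<^bsub>schur n r\<^esub> \<oplus>\<^bsub>schur n r\<^esub> f = f"
    proof (rule schur_eqI)
      fix u assume u: "u \<in> tspace n r"
      show "(\<zero>\<^bsub>schur n r\<^esub> \<oplus>\<^bsub>schur n r\<^esub> f) u = f u"
        by (rule tspace_eqI[of _ n r])
          (use u f in \<open>simp_all add: schur_closed schur_apply tspace_mem_carrier[where n=n]\<close>)
    qed (use f in \<open>simp_all add: schur_closed\<close>)
    have "schur_smult n r (-1) f \<oplus>\<^bsub>schur n r\<^esub> f = \<zero>\<^bsub>schur n r\<^esub>"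
    proof (rule schur_eqI)
      fix u assume u: "u \<in> tspace n r"
      show "(schur_smult n r (-1) f \<oplus>\<^bsub>schur n r\<^esub> f) u = \<zero>\<^bsub>schur n r\<^esub> u"
        by (rule tspace_eqI[of _ n r])
          (use u f in \<open>simp_all add: schur_closed schur_apply tspace_mem_carrier[where n=n] scalar_minus_one\<close>)
    qed (use f in \<open>simp_all add: schur_closed\<close>)
    then show "\<exists>g\<in>carrier (schur n r). g \<oplus>\<^bsub>schur n r\<^esub> f = \<zero>\<^bsub>schur n r\<^esub>"
      using schur_smult_closed[OF f] by blast
  qed (simp_all add: schur_closed)
  show "monoid (schur n r)"
  proof (rule monoidI)
    fix f g h assume fgh: "f \<in> carrier (schur n r)" "g \<in> carrier (schur n r)" "h \<in> carrier (schur n r)"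
    show "f \<otimes>\<^bsub>schur n r\<^esub> g \<otimes>\<^bsub>schur n r\<^esub> h = f \<otimes>\<^bsub>schur n r\<^esub> (g \<otimes>\<^bsub>schur n r\<^esub> h)"
      by (rule schur_eqI[of _ n r]) (use fgh in \<open>simp_all add: schur_closed schur_apply\<close>)
  next
    fix f assume f: "f \<in> carrier (schur n r)"
    show "\<one>\<^bsub>schur n r\<^esub> \<otimes>\<^bsub>schur n r\<^esub> f = f" "f \<otimes>\<^bsub>schur n r\<^esub> \<one>\<^bsub>schur n r\<^esub> = f"
      by (rule schur_eqI[of _ n r]; use f in \<open>simp add: schur_closed schur_apply\<close>)+
  qed (simp_all add: schur_closed)
next
  fix f g h assume fgh: "f \<in> carrier (schur n r)" "g \<in> carrier (schur n r)" "h \<in> carrier (schur n r)"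
  show "(f \<oplus>\<^bsub>schur n r\<^esub> g) \<otimes>\<^bsub>schur n r\<^esub> h = f \<otimes>\<^bsub>schur n r\<^esub> h \<oplus>\<^bsub>schur n r\<^esub> g \<otimes>\<^bsub>schur n r\<^esub> h"
    by (rule schur_eqI[of _ n r]) (use fgh in \<open>simp_all add: schur_closed schur_apply\<close>)
  show "h \<otimes>\<^bsub>schur n r\<^esub> (f \<oplus>\<^bsub>schur n r\<^esub> g) = h \<otimes>\<^bsub>schur n r\<^esub> f \<oplus>\<^bsub>schur n r\<^esub> h \<otimes>\<^bsub>schur n r\<^esub> g"
    by (rule schur_eqI[of _ n r]) (use fgh in \<open>simp_all add: schur_closed schur_apply schur_hom_add\<close>)
qed

lemma schur_smult_mult:
  assumes f: "f \<in> carrier (schur n r)" and g: "g \<in> carrier (schur n r)"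
  shows "schur_smult n r a f \<otimes>\<^bsub>schur n r\<^esub> g = schur_smult n r a (f \<otimes>\<^bsub>schur n r\<^esub> g)"
    "f \<otimes>\<^bsub>schur n r\<^esub> schur_smult n r a g = schur_smult n r a (f \<otimes>\<^bsub>schur n r\<^esub> g)"
  by (rule schur_eqI[of _ n r]; use f g in \<open>simp add: schur_closed schur_apply schur_hom_act\<close>)+

lemma schur_hom_zero:
  assumes "f \<in> carrier (schur n r)"
  shows "f (tspace_zero n r) = tspace_zero n r"
proof -
  interpret H: ring "hecke r" by (rule hecke_ring)
  have "tspace_act n r u \<zero>\<^bsub>hecke r\<^esub> = tspace_zero n r" if "u \<in> tspace n r" for u
    by (rule tspace_eqI[of _ n r]) (use that in \<open>simp_all add: tspace_mem_carrier[where n=n]\<close>)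
  then show ?thesis
    using schur_hom_act[OF assms tspace_zero_closed, of "\<zero>\<^bsub>hecke r\<^esub>"] assms by simp
qed

subsection \<open>Matrix entries of endomorphisms\<close>

lemma schur_eqI_inj:
  assumes f: "f \<in> carrier (schur n r)" and g: "g \<in> carrier (schur n r)"
    and eq: "\<And>mu x. mu \<in> Lambda n r \<Longrightarrow> x \<in> xmod n r mu \<Longrightarrow> f (tspace_inj n r mu x) = g (tspace_inj n r mu x)"
  shows "f = g"
proof (rule schur_eqI[OF f g])
  interpret H: ring "hecke r" by (rule hecke_ring)
  fix u assume u: "u \<in> tspace n r"
  define cut where "cut S = (\<lambda>lam\<in>Lambda n r. if lam \<in> S then u lam else \<zero>\<^bsub>hecke r\<^esub>)" for S
  have cutT: "cut S \<in> tspace n r" for S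
    unfolding cut_def by (rule tspaceI) (use u in \<open>simp add: tspace_mem xmod_zero\<close>)
  have "f (cut S) = g (cut S)" if "finite S" "S \<subseteq> Lambda n r" for S
    using that
  proof (induction S rule: finite_induct)
    case empty
    have "cut {} = tspace_zero n r" by (simp add: cut_def tspace_zero_def)
    then show ?case using f g by (simp add: schur_hom_zero)
  next
    case (insert mu S)
    then have mu: "mu \<in> Lambda n r" and x: "u mu \<in> xmod n r mu" using u tspace_mem by auto
    have "cut (insert mu S) = tspace_add n r (cut S) (tspace_inj n r mu (u mu))"
    proof (rule tspace_eqI[of _ n r])
      fix lam assume lam: "lam \<in> Lambda n r"
      show "cut (insert mu S) lam = tspace_add n r (cut S) (tspace_inj n r mu (u mu)) lam"
        using lam u insert(2) by (auto simp: cut_def tspace_mem_carrier[where n=n])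
    qed (use cutT x in simp_all)
    then show ?case using insert f g cutT x eq[OF mu x] by (simp add: schur_hom_add)
  qed
  from this[OF finite_Lambda order_refl] have "f (cut (Lambda n r)) = g (cut (Lambda n r))" .
  moreover have "cut (Lambda n r) = u"
    by (rule tspace_eqI[OF cutT u]) (simp add: cut_def)
  ultimately show "f u = g u" by simp
qed

text \<open>The component in the summand of \<open>lam\<close> of the image of the generator of the summand of \<open>mu\<close>, in coordinates.\<close>

definition entry :: "nat \<Rightarrow> nat \<Rightarrow> (tspace_elt \<Rightarrow> tspace_elt) \<Rightarrow> nat list \<Rightarrow> nat list \<Rightarrow> wfun" where
  "entry n r f lam mu = T_coeff r (f (tspace_inj n r mu (x_tilde n r mu)) lam)"

lemma gen_in_tspace [simp]: "tspace_inj n r mu (x_tilde n r mu) \<in> tspace n r"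
  by (simp add: x_tilde_xmod)

text \<open>The tensor space is generated by the elements \<open>x\<^sub>\<mu>\<close> in its summands.\<close>

lemma schur_eqI_entry:
  assumes f: "f \<in> carrier (schur n r)" and g: "g \<in> carrier (schur n r)"
    and eq: "\<And>lam mu. lam \<in> Lambda n r \<Longrightarrow> mu \<in> Lambda n r \<Longrightarrow> entry n r f lam mu = entry n r g lam mu"
  shows "f = g"
proof (rule schur_eqI_inj[OF f g])
  fix mu x assume mu: "mu \<in> Lambda n r" and x: "x \<in> xmod n r mu"
  obtain h where h: "h \<in> carrier (hecke r)" "x = x_tilde n r mu \<otimes>\<^bsub>hecke r\<^esub> h"
    using x by (auto simp: xmod_def)
  let ?u = "tspace_inj n r mu (x_tilde n r mu)"
  have "f ?u = g ?u"
  proof (rule tspace_eqI[of _ n r])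
    fix lam assume lam: "lam \<in> Lambda n r"
    show "f ?u lam = g ?u lam"
      using T_coeff_inj[of "f ?u lam" r "g ?u lam"] eq[OF lam mu] f g lam
      by (simp add: entry_def tspace_mem_carrier[where n=n])
  qed (use f g in simp_all)
  moreover have "tspace_inj n r mu x = tspace_act n r ?u h"
    unfolding h(2) by (rule tspace_inj_act[OF x_tilde_xmod h(1), symmetric])
  ultimately show "f (tspace_inj n r mu x) = g (tspace_inj n r mu x)"
    using f g h by (simp add: schur_hom_act)
qed

text \<open>The entry lies in \<open>x\<^sub>\<lambda> \<H>\<close>, and the relation \<open>x\<^sub>\<mu> T\<^sub>i = q x\<^sub>\<mu>\<close> is carried over to it by the endomorphism.\<close>

lemma entry_invariant:
  assumes f: "f \<in> carrier (schur n r)" and lam: "lam \<in> Lambda n r" and mu: "mu \<in> Lambda n r"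
  shows "left_invariant r (parab_gens n r lam) (entry n r f lam mu)" "right_invariant r (parab_gens n r mu) (entry n r f lam mu)"
    "supp r (entry n r f lam mu)"
proof -
  interpret H: ring "hecke r" by (rule hecke_ring)
  let ?u = "tspace_inj n r mu (x_tilde n r mu)"
  have y: "f ?u lam \<in> xmod n r lam" using f lam by (simp add: tspace_mem)
  then show "left_invariant r (parab_gens n r lam) (entry n r f lam mu)" "supp r (entry n r f lam mu)"
    unfolding entry_def by (simp_all add: xmod_iff supp_T_coeff)
  show "right_invariant r (parab_gens n r mu) (entry n r f lam mu)"
    unfolding entry_def
  proof (rule mult_parab_sum_right_invariant[OF parab_gens_subset])
    show "f ?u lam \<in> carrier (hecke r)" using y by (rule xmod_closed)
    fix i assume i: "i \<in> parab_gens n r mu"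
    then have i': "i \<in> {1..r}" using parab_gens_subset by blast
    have c: "T_word r [i] \<in> carrier (hecke r)" using i' by (intro T_word_closed) auto
    have "tspace_act n r ?u (T_word r [i]) = tspace_act n r ?u (hecke_scalar r q_laurent)"
    proof -
      have "x_tilde n r mu \<otimes>\<^bsub>hecke r\<^esub> T_word r [i] = x_tilde n r mu \<otimes>\<^bsub>hecke r\<^esub> hecke_scalar r q_laurent"
        unfolding x_tilde_eq gen_parab_sum(2)[OF parab_gens_subset i]
        by (rule hecke_scalar_commute[OF parab_sum_closed[OF parab_gens_subset]])
      then show ?thesis using c by (simp add: tspace_inj_act x_tilde_xmod)
    qed
    then have "tspace_act n r (f ?u) (T_word r [i]) = tspace_act n r (f ?u) (hecke_scalar r q_laurent)"
      using f c by (metis schur_hom_act gen_in_tspace hecke_scalar_closed)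
    then have "tspace_act n r (f ?u) (T_word r [i]) lam = tspace_act n r (f ?u) (hecke_scalar r q_laurent) lam"
      by simp
    then show "f ?u lam \<otimes>\<^bsub>hecke r\<^esub> T_word r [i] = hecke_scalar r q_laurent \<otimes>\<^bsub>hecke r\<^esub> f ?u lam"
      using lam y by (simp add: hecke_scalar_commute xmod_closed)
  qed
qed

lemma entry_add:
  "f \<in> carrier (schur n r) \<Longrightarrow> g \<in> carrier (schur n r) \<Longrightarrow> lam \<in> Lambda n r \<Longrightarrow>
    entry n r (f \<oplus>\<^bsub>schur n r\<^esub> g) lam mu = (\<lambda>w. entry n r f lam mu w + entry n r g lam mu w)"
  by (simp add: entry_def schur_apply T_coeff_add tspace_mem_carrier[where n=n])

lemma entry_smult:
  "f \<in> carrier (schur n r) \<Longrightarrow> lam \<in> Lambda n r \<Longrightarrow>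
    entry n r (schur_smult n r a f) lam mu = (\<lambda>w. a * entry n r f lam mu w)"
  by (simp add: entry_def schur_apply T_coeff_scalar_right tspace_mem_carrier[where n=n])

lemma entry_zero: "lam \<in> Lambda n r \<Longrightarrow> entry n r \<zero>\<^bsub>schur n r\<^esub> lam mu = (\<lambda>w. 0)"
  by (simp add: entry_def schur_apply T_coeff_zero)

lemma entry_finsum:
  assumes "finite S" "f \<in> S \<rightarrow> carrier (schur n r)" "lam \<in> Lambda n r"
  shows "entry n r (finsum (schur n r) f S) lam mu = (\<lambda>w. \<Sum>s\<in>S. entry n r (f s) lam mu w)"
proof -
  interpret S: ring "schur n r" by (rule schur_ring)
  show ?thesis using assms(1,2)
    by (induction S rule: finite_induct) (simp_all add: entry_zero entry_add Pi_iff assms(3))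
qed

definition proj :: "nat \<Rightarrow> nat \<Rightarrow> nat list \<Rightarrow> (tspace_elt \<Rightarrow> tspace_elt)" where
  "proj n r kap = (\<lambda>u\<in>tspace n r. tspace_inj n r kap (u kap))"

lemma proj_closed:
  assumes "kap \<in> Lambda n r"
  shows "proj n r kap \<in> carrier (schur n r)"
  unfolding proj_def
  by (rule schurI) (use assms in \<open>simp_all add: tspace_mem tspace_inj_add tspace_inj_act\<close>)

lemma entry_proj_left:
  assumes "kap \<in> Lambda n r" "f \<in> carrier (schur n r)" "lam \<in> Lambda n r"
  shows "entry n r (proj n r kap \<otimes>\<^bsub>schur n r\<^esub> f) lam mu = (if lam = kap then entry n r f lam mu else (\<lambda>w. 0))"
  using assms by (simp add: entry_def schur_apply proj_def T_coeff_zero)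

lemma entry_proj_right:
  assumes "kap \<in> Lambda n r" "f \<in> carrier (schur n r)" "lam \<in> Lambda n r" "mu \<in> Lambda n r"
  shows "entry n r (f \<otimes>\<^bsub>schur n r\<^esub> proj n r kap) lam mu = (if mu = kap then entry n r f lam mu else (\<lambda>w. 0))"
proof -
  let ?u = "tspace_inj n r mu (x_tilde n r mu)"
  have "proj n r kap ?u = (if mu = kap then ?u else tspace_zero n r)"
    by (rule tspace_eqI[of _ n r])
      (use assms in \<open>simp_all add: proj_def xmod_zero x_tilde_xmod\<close>)
  then show ?thesis using assms by (simp add: entry_def schur_apply schur_hom_zero T_coeff_zero)
qed

text \<open>An element that is invariant on both sides defines an endomorphism between two summands.  It is a
  left multiple \<open>g x\<^sub>\<mu>\<close> of the generator of the source, so left multiplication by \<open>g\<close> is a well-defined map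
  that sends this generator to it.\<close>

lemma elementary_exists:
  assumes lam: "lam \<in> Lambda n r" and mu: "mu \<in> Lambda n r" and y: "y \<in> carrier (hecke r)"
    and l: "left_invariant r (parab_gens n r lam) (T_coeff r y)" and ri: "right_invariant r (parab_gens n r mu) (T_coeff r y)"
  shows "\<exists>f\<in>carrier (schur n r). \<forall>nu\<in>Lambda n r. \<forall>h\<in>carrier (hecke r).
      f (tspace_inj n r nu (x_tilde n r nu \<otimes>\<^bsub>hecke r\<^esub> h)) =
        (if nu = mu then tspace_inj n r lam (y \<otimes>\<^bsub>hecke r\<^esub> h) else tspace_zero n r)"
proof -
  interpret H: ring "hecke r" by (rule hecke_ring)
  obtain g where g: "g \<in> carrier (hecke r)" "y = g \<otimes>\<^bsub>hecke r\<^esub> x_tilde n r mu"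
    using right_invariant_mult_parab_sum[OF parab_gens_subset y ri] unfolding x_tilde_eq by blast
  have ym: "y \<in> xmod n r lam" using y l by (simp add: xmod_iff)
  have gm: "g \<otimes>\<^bsub>hecke r\<^esub> x \<in> xmod n r lam" if xm: "x \<in> xmod n r mu" for x
  proof -
    obtain h where h: "h \<in> carrier (hecke r)" "x = x_tilde n r mu \<otimes>\<^bsub>hecke r\<^esub> h"
      using xm by (auto simp: xmod_def)
    then have "g \<otimes>\<^bsub>hecke r\<^esub> x = y \<otimes>\<^bsub>hecke r\<^esub> h" using g by (simp add: H.m_assoc)
    then show ?thesis using xmod_mult[OF ym h(1)] by simp
  qed
  let ?f = "restrict (\<lambda>u. tspace_inj n r lam (g \<otimes>\<^bsub>hecke r\<^esub> u mu)) (tspace n r)"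
  have "?f \<in> carrier (schur n r)"
    by (rule schurI)
      (use mu g gm in \<open>simp_all add: tspace_mem tspace_inj_add tspace_inj_act H.r_distr H.m_assoc tspace_mem_carrier[where n=n]\<close>)
  moreover have "?f (tspace_inj n r nu (x_tilde n r nu \<otimes>\<^bsub>hecke r\<^esub> h)) =
        (if nu = mu then tspace_inj n r lam (y \<otimes>\<^bsub>hecke r\<^esub> h) else tspace_zero n r)"
    if "nu \<in> Lambda n r" "h \<in> carrier (hecke r)" for nu h
  proof (cases "nu = mu")
    case True
    then show ?thesis using that mu g by (simp add: x_tilde_mult_xmod H.m_assoc)
  next
    case False
    then have "?f (tspace_inj n r nu (x_tilde n r nu \<otimes>\<^bsub>hecke r\<^esub> h)) = tspace_inj n r lam \<zero>\<^bsub>hecke r\<^esub>"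
      using that mu g by (simp add: x_tilde_mult_xmod)
    also have "\<dots> = tspace_zero n r" by (simp add: tspace_inj_def tspace_zero_def)
    finally show ?thesis using False by simp
  qed
  ultimately show ?thesis by blast
qed

text \<open>The description in the definition of \<open>e\<^sub>A\<close> determines a unique endomorphism: existence holds since the indicator
  function of a double coset is invariant on both sides, uniqueness since it prescribes the values on all summands.\<close>

lemma e_basis_spec:
  assumes lam: "row_weight n r A \<in> Lambda n r" and mu: "col_weight n r A \<in> Lambda n r"
    and D: "double_coset n r A \<subseteq> BW r"
    and l: "left_invariant r (parab_gens n r (row_weight n r A)) (indic (double_coset n r A))"
    and ri: "right_invariant r (parab_gens n r (col_weight n r A)) (indic (double_coset n r A))"
  shows "e_basis n r A \<in> carrier (schur n r)"
    and "\<And>lam' mu'. lam' \<in> Lambda n r \<Longrightarrow> mu' \<in> Lambda n r \<Longrightarrow>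
      entry n r (e_basis n r A) lam' mu' =
        (if lam' = row_weight n r A \<and> mu' = col_weight n r A then indic (double_coset n r A) else (\<lambda>w. 0))"
proof -
  interpret H: ring "hecke r" by (rule hecke_ring)
  let ?lam = "row_weight n r A" and ?mu = "col_weight n r A"
  let ?y = "hecke_T_sum r (double_coset n r A)"
  let ?P = "\<lambda>f. f \<in> carrier (schur n r) \<and> (\<forall>nu\<in>Lambda n r. \<forall>h\<in>carrier (hecke r).
      f (tspace_inj n r nu (x_tilde n r nu \<otimes>\<^bsub>hecke r\<^esub> h)) =
        (if nu = ?mu then tspace_inj n r ?lam (?y \<otimes>\<^bsub>hecke r\<^esub> h) else tspace_zero n r))"
  have y: "?y \<in> carrier (hecke r)" "T_coeff r ?y = indic (double_coset n r A)"
    using D by (simp_all add: T_coeff_T_sum)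
  have ex: "\<exists>f. ?P f"
    using elementary_exists[OF lam mu y(1), unfolded y(2), OF l ri] by blast
  moreover have uniq: "f = g" if f: "?P f" and g: "?P g" for f g
  proof (rule schur_eqI_inj)
    fix nu x assume nu: "nu \<in> Lambda n r" and x: "x \<in> xmod n r nu"
    obtain h where h: "h \<in> carrier (hecke r)" "x = x_tilde n r nu \<otimes>\<^bsub>hecke r\<^esub> h"
      using x by (auto simp: xmod_def)
    show "f (tspace_inj n r nu x) = g (tspace_inj n r nu x)"
      using f g nu h by simp
  qed (use f g in blast)+
  ultimately have P: "?P (THE f. ?P f)" by (rule ex_ex1I[THEN theI'])
  have e: "e_basis n r A = (THE f. ?P f)" by (simp add: e_basis_def Let_def)
  show "e_basis n r A \<in> carrier (schur n r)" unfolding e using P by blast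
  fix lam' mu' assume lm: "lam' \<in> Lambda n r" "mu' \<in> Lambda n r"
  have "e_basis n r A (tspace_inj n r mu' (x_tilde n r mu' \<otimes>\<^bsub>hecke r\<^esub> \<one>\<^bsub>hecke r\<^esub>))
      = (if mu' = ?mu then tspace_inj n r ?lam (?y \<otimes>\<^bsub>hecke r\<^esub> \<one>\<^bsub>hecke r\<^esub>) else tspace_zero n r)"
    unfolding e using P lm by blast
  then show "entry n r (e_basis n r A) lam' mu' =
        (if lam' = ?lam \<and> mu' = ?mu then indic (double_coset n r A) else (\<lambda>w. 0))"
    using lm y lam by (simp add: entry_def T_coeff_zero)
qed

section \<open>Parabolic subgroups as block stabilizers\<close>

subsection \<open>Equivariant matchings\<close>

lemma rank_bij:
  fixes F :: "'a::linorder set"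
  assumes "finite F"
  shows "bij_betw (\<lambda>x. card {y \<in> F. y \<le> x}) F {1..card F}"
proof -
  let ?rk = "\<lambda>x. card {y \<in> F. y \<le> x}"
  have mono: "?rk x < ?rk y" if "x \<in> F" "y \<in> F" "x < y" for x y
  proof (rule psubset_card_mono)
    have "y \<notin> {z \<in> F. z \<le> x}" "y \<in> {z \<in> F. z \<le> y}" using that by auto
    moreover have "{z \<in> F. z \<le> x} \<subseteq> {z \<in> F. z \<le> y}" using that by auto
    ultimately show "{z \<in> F. z \<le> x} \<subset> {z \<in> F. z \<le> y}" by blast
  qed (use assms in simp)
  have inj: "inj_on ?rk F"
  proof (rule inj_onI)
    fix x y assume xy: "x \<in> F" "y \<in> F" "?rk x = ?rk y"
    show "x = y"
      using mono[OF xy(1,2)] mono[OF xy(2,1)] xy(3) by (cases x y rule: linorder_cases) auto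
  qed
  have "?rk x \<in> {1..card F}" if "x \<in> F" for x
  proof -
    have "x \<in> {y \<in> F. y \<le> x}" using that by simp
    then have "?rk x \<noteq> 0" using assms by auto
    moreover have "?rk x \<le> card F" by (rule card_mono) (use assms in auto)
    ultimately show ?thesis by simp
  qed
  then have "?rk ` F \<subseteq> {1..card F}" by blast
  moreover have "card (?rk ` F) = card {1..card F}" using card_image[OF inj] by simp
  ultimately have "?rk ` F = {1..card F}" by (intro card_subset_eq) auto
  with inj show ?thesis by (simp add: bij_betw_def)
qed

text \<open>An order-reversing symmetry exchanges the elements below \<open>x\<close> in its fibre with those above its mirror image.\<close>

lemma rank_reversal:
  fixes X :: "'a::linorder set" and l :: "'a \<Rightarrow> 'l"
  assumes fin: "finite X"
    and s: "\<And>x. x \<in> X \<Longrightarrow> \<sigma> x \<in> X" "\<And>x. x \<in> X \<Longrightarrow> \<sigma> (\<sigma> x) = x"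
      "\<And>x y. x \<in> X \<Longrightarrow> y \<in> X \<Longrightarrow> x < y \<Longrightarrow> \<sigma> y < \<sigma> x"
    and l: "\<And>x. x \<in> X \<Longrightarrow> l (\<sigma> x) = \<kappa> (l x)"
    and x: "x \<in> X"
  shows "card {z \<in> X. l z = l (\<sigma> x) \<and> z \<le> \<sigma> x} + card {z \<in> X. l z = l x \<and> z \<le> x}
    = card {z \<in> X. l z = l x} + 1"
proof -
  let ?U = "{z \<in> X. l z = l x \<and> x \<le> z}" and ?D = "{z \<in> X. l z = l x \<and> z \<le> x}"
  have le: "\<sigma> z \<le> \<sigma> y \<longleftrightarrow> y \<le> z" if "y \<in> X" "z \<in> X" for y z
    using s(3)[OF that] s(3)[OF that(2,1)] by (cases y z rule: linorder_cases) auto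
  have "{z \<in> X. l z = l (\<sigma> x) \<and> z \<le> \<sigma> x} = \<sigma> ` ?U"
  proof (intro equalityI subsetI)
    fix z assume "z \<in> {z \<in> X. l z = l (\<sigma> x) \<and> z \<le> \<sigma> x}"
    then have z: "z \<in> X" "l z = \<kappa> (l x)" "z \<le> \<sigma> x" using l[OF x] by auto
    have "l (\<sigma> z) = \<kappa> (\<kappa> (l x))" using l[OF z(1)] z(2) by simp
    also have "\<dots> = l x" using l[OF s(1)[OF x]] l[OF x] s(2)[OF x] by simp
    finally have "l (\<sigma> z) = l x" .
    moreover have "x \<le> \<sigma> z" using le[OF x s(1)[OF z(1)]] s(2)[OF z(1)] z(3) by simp
    ultimately show "z \<in> \<sigma> ` ?U"
      using s(1,2)[OF z(1)] by (intro image_eqI[of _ _ "\<sigma> z"]) simp_all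
  next
    fix z assume "z \<in> \<sigma> ` ?U"
    then show "z \<in> {z \<in> X. l z = l (\<sigma> x) \<and> z \<le> \<sigma> x}" using s(1) l x le by auto
  qed
  moreover have "inj_on \<sigma> ?U" by (rule inj_on_inverseI[of _ \<sigma>]) (simp add: s(2))
  ultimately have "card {z \<in> X. l z = l (\<sigma> x) \<and> z \<le> \<sigma> x} = card ?U" by (simp add: card_image)
  moreover have "card ?U + card ?D = card (?U \<union> ?D) + card (?U \<inter> ?D)"
    by (rule card_Un_Int) (use fin in auto)
  moreover have "?U \<union> ?D = {z \<in> X. l z = l x}" "?U \<inter> ?D = {x}" using x by auto
  ultimately show ?thesis by simp
qed

text \<open>Match the fibres of the labellings in increasing order.  Both symmetries reverse the order, so they send the
  element of rank \<open>k\<close> in a fibre to the element of rank \<open>k\<close> from the top in the mirrored fibre.  Hence the matching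
  commutes with them, even on fibres that are mapped to themselves.\<close>

lemma equivariant_matching:
  fixes X :: "'a::linorder set" and Y :: "'b::linorder set" and l :: "'a \<Rightarrow> 'l" and l' :: "'b \<Rightarrow> 'l"
  assumes fin: "finite X" "finite Y"
    and sX: "\<And>x. x \<in> X \<Longrightarrow> \<sigma> x \<in> X" "\<And>x. x \<in> X \<Longrightarrow> \<sigma> (\<sigma> x) = x"
      "\<And>x y. x \<in> X \<Longrightarrow> y \<in> X \<Longrightarrow> x < y \<Longrightarrow> \<sigma> y < \<sigma> x"
    and sY: "\<And>x. x \<in> Y \<Longrightarrow> \<tau> x \<in> Y" "\<And>x. x \<in> Y \<Longrightarrow> \<tau> (\<tau> x) = x"
      "\<And>x y. x \<in> Y \<Longrightarrow> y \<in> Y \<Longrightarrow> x < y \<Longrightarrow> \<tau> y < \<tau> x"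
    and lX: "\<And>x. x \<in> X \<Longrightarrow> l (\<sigma> x) = \<kappa> (l x)" and lY: "\<And>y. y \<in> Y \<Longrightarrow> l' (\<tau> y) = \<kappa> (l' y)"
    and fib: "\<And>k. card {x \<in> X. l x = k} = card {y \<in> Y. l' y = k}"
  shows "\<exists>g. bij_betw g X Y \<and> (\<forall>x\<in>X. l' (g x) = l x \<and> g (\<sigma> x) = \<tau> (g x))"
proof -
  define F where "F k = {x \<in> X. l x = k}" for k
  define G where "G k = {y \<in> Y. l' y = k}" for k
  define rF where "rF x = card {z \<in> F (l x). z \<le> x}" for x
  define rG where "rG y = card {z \<in> G (l' y). z \<le> y}" for y
  have finFG: "finite (F k)" "finite (G k)" for k using fin by (simp_all add: F_def G_def)
  have cFG: "card (F k) = card (G k)" for k using fib by (simp add: F_def G_def)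
  have rFr: "rF x \<in> {1..card (F (l x))}" if "x \<in> X" for x
    using bij_betwE[OF rank_bij[OF finFG(1)[of "l x"]]] that unfolding rF_def by (simp add: F_def)
  have ex: "\<exists>y\<in>Y. l' y = l x \<and> rG y = rF x" if "x \<in> X" for x
  proof -
    have "rF x \<in> (\<lambda>y. card {z \<in> G (l x). z \<le> y}) ` G (l x)"
      using rFr[OF that] rank_bij[OF finFG(2)[of "l x"]] cFG[of "l x"] by (simp add: bij_betw_def)
    then show ?thesis by (auto simp: G_def rG_def)
  qed
  have uF: "x = x'" if "x \<in> X" "x' \<in> X" "l x = l x'" "rF x = rF x'" for x x'
    using bij_betw_imp_inj_on[OF rank_bij[OF finFG(1)[of "l x"]]] that
    by (auto simp: rF_def F_def dest!: inj_onD)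
  have uG: "y = y'" if "y \<in> Y" "y' \<in> Y" "l' y = l' y'" "rG y = rG y'" for y y'
    using bij_betw_imp_inj_on[OF rank_bij[OF finFG(2)[of "l' y"]]] that
    by (auto simp: rG_def G_def dest!: inj_onD)
  obtain g where g: "\<And>x. x \<in> X \<Longrightarrow> g x \<in> Y \<and> l' (g x) = l x \<and> rG (g x) = rF x"
    using ex by metis
  have inj: "inj_on g X"
  proof (rule inj_onI)
    fix x x' assume x: "x \<in> X" "x' \<in> X" "g x = g x'"
    show "x = x'" using uF[OF x(1,2)] g[OF x(1)] g[OF x(2)] x(3) by simp
  qed
  have "card X = card Y"
  proof -
    have "card X = (\<Sum>k\<in>l ` X \<union> l' ` Y. card (F k))"
      unfolding F_def using fin by (subst card_UN_disjoint[symmetric]) (auto intro!: arg_cong[of _ _ card])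
    also have "\<dots> = (\<Sum>k\<in>l ` X \<union> l' ` Y. card (G k))" by (simp only: cFG)
    also have "\<dots> = card Y"
      unfolding G_def using fin by (subst card_UN_disjoint[symmetric]) (auto intro!: arg_cong[of _ _ card])
    finally show ?thesis .
  qed
  then have "g ` X = Y" using g fin by (intro card_subset_eq) (auto simp: card_image[OF inj])
  with inj have bij: "bij_betw g X Y" by (simp add: bij_betw_def)
  have revF: "rF (\<sigma> x) + rF x = card (F (l x)) + 1" if "x \<in> X" for x
    using rank_reversal[where \<sigma> = \<sigma> and l = l and \<kappa> = \<kappa>, OF fin(1) sX lX that] by (simp add: rF_def F_def)
  have revG: "rG (\<tau> y) + rG y = card (G (l' y)) + 1" if "y \<in> Y" for y
    using rank_reversal[where \<sigma> = \<tau> and l = l' and \<kappa> = \<kappa>, OF fin(2) sY lY that] by (simp add: rG_def G_def)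
  have "g (\<sigma> x) = \<tau> (g x)" if x: "x \<in> X" for x
  proof (rule uG)
    have gx: "g x \<in> Y" "l' (g x) = l x" "rG (g x) = rF x" using g[OF x] by auto
    have gs: "g (\<sigma> x) \<in> Y" "l' (g (\<sigma> x)) = l (\<sigma> x)" "rG (g (\<sigma> x)) = rF (\<sigma> x)"
      using g[OF sX(1)[OF x]] by auto
    show "g (\<sigma> x) \<in> Y" "\<tau> (g x) \<in> Y" using gs sY(1) gx by auto
    show "l' (g (\<sigma> x)) = l' (\<tau> (g x))" using gs(2) lX[OF x] lY[OF gx(1)] gx(2) by simp
    show "rG (g (\<sigma> x)) = rG (\<tau> (g x))"
      using gs(3) revF[OF x] revG[OF gx(1)] gx cFG[of "l x"] by simp
  qed
  then show ?thesis using bij g by blast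
qed

subsection \<open>Blocks\<close>

lemma tilde_length: "lam \<in> Lambda n r \<Longrightarrow> length (tilde lam) = 2*n+1"
  by (simp add: tilde_def Lambda_def)

lemma tilde_rev: "rev (tilde lam) = tilde lam"
  by (simp add: tilde_def)

lemma Lambda_split: "lam \<in> Lambda n r \<Longrightarrow> butlast lam @ [last lam] = lam"
  by (rule append_butlast_last_id) (auto simp: Lambda_def)

lemma tilde_sum: assumes "lam \<in> Lambda n r" shows "sum_list (tilde lam) = 2*r+1"
proof -
  have "sum_list (butlast lam) + last lam = sum_list (butlast lam @ [last lam])" by simp
  also have "\<dots> = r" using assms Lambda_split[OF assms] by (simp add: Lambda_def)
  finally show ?thesis by (simp add: tilde_def)
qed

text \<open>The last point of the \<open>k\<close>-th block, counting blocks from 1.\<close>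

definition block_end :: "nat list \<Rightarrow> nat \<Rightarrow> nat" where
  "block_end lam k = sum_list (take k (tilde lam))"

lemma block_end_0 [simp]: "block_end lam 0 = 0" by (simp add: block_end_def)

lemma block_end_mono: "i \<le> j \<Longrightarrow> block_end lam i \<le> block_end lam j"
proof -
  assume "i \<le> j"
  then have "take j (tilde lam) = take i (tilde lam) @ take (j - i) (drop i (tilde lam))"
    by (metis le_add_diff_inverse take_add)
  then show ?thesis by (simp add: block_end_def)
qed

lemma block_end_end: "lam \<in> Lambda n r \<Longrightarrow> block_end lam (2*n+1) = 2*r+1"
  by (simp add: block_end_def tilde_length tilde_sum)

lemma block_end_star:
  assumes "lam \<in> Lambda n r" "k \<le> 2*n+1"
  shows "block_end lam (2*n+1-k) + block_end lam k = 2*r+1"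
proof -
  have "take (2*n+1-k) (tilde lam) = rev (drop k (tilde lam))"
    using tilde_rev[of lam] tilde_length[OF assms(1)] assms(2) by (metis rev_drop)
  then have "block_end lam (2*n+1-k) = sum_list (drop k (tilde lam))" by (simp add: block_end_def)
  then show ?thesis
    using tilde_sum[OF assms(1)] by (metis add.commute append_take_drop_id block_end_def sum_list_append)
qed

lemma block_end_low: "lam \<in> Lambda n r \<Longrightarrow> k \<le> n \<Longrightarrow> block_end lam k = sum_list (take k lam)"
proof -
  assume lam: "lam \<in> Lambda n r" and k: "k \<le> n"
  have "length (butlast lam) = n" using lam by (simp add: Lambda_def)
  then have "take k (tilde lam) = take k (butlast lam)" using k by (simp add: tilde_def)
  also have "\<dots> = take k lam" using k lam by (simp add: take_butlast Lambda_def)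
  finally show ?thesis by (simp add: block_end_def)
qed

lemma block_end_low_le: assumes "lam \<in> Lambda n r" "k \<le> n" shows "block_end lam k \<le> r"
proof -
  have "sum_list (take k lam) + sum_list (drop k lam) = r"
    using assms(1) by (metis (mono_tags, lifting) Lambda_def append_take_drop_id mem_Collect_eq sum_list_append)
  then show ?thesis using block_end_low[OF assms] by simp
qed

lemma block_iff: "x \<in> block lam k \<longleftrightarrow> block_end lam k < x \<and> x \<le> block_end lam (k+1)"
  by (auto simp: block_def block_end_def)

lemma card_block:
  assumes "lam \<in> Lambda n r" "k < 2*n+1"
  shows "card (block lam k) = tilde lam ! k"
proof -
  have "block_end lam (k+1) = block_end lam k + tilde lam ! k"
    using assms tilde_length[OF assms(1)] by (simp add: block_end_def take_Suc_conv_app_nth)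
  then show ?thesis by (simp add: block_def block_end_def[symmetric])
qed

lemma block_range:
  assumes "lam \<in> Lambda n r" "k < 2*n+1" "x \<in> block lam k"
  shows "x \<in> {1..2*r+1}"
  using assms block_end_mono[of "k+1" "2*n+1" lam] block_end_end[OF assms(1)] by (auto simp: block_iff)

lemma block_exists:
  assumes "lam \<in> Lambda n r" "x \<in> {1..2*r+1}"
  shows "\<exists>k<2*n+1. x \<in> block lam k"
proof -
  define k where "k = (LEAST k. x \<le> block_end lam k)"
  have e: "x \<le> block_end lam (2*n+1)" using assms block_end_end by simp
  have k: "x \<le> block_end lam k" "k \<le> 2*n+1"
    unfolding k_def
    by (rule LeastI[where P = "\<lambda>k. x \<le> block_end lam k", OF e], rule Least_le[where P = "\<lambda>k. x \<le> block_end lam k", OF e])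
  have "k \<noteq> 0" using k(1) assms(2) by (cases k) auto
  then obtain j where j: "k = Suc j" by (cases k) auto
  have "\<not> x \<le> block_end lam j" using not_less_Least[of j "\<lambda>k. x \<le> block_end lam k"] j by (simp add: k_def)
  then show ?thesis using k j by (intro exI[of _ j]) (simp add: block_iff)
qed

lemma block_less:
  assumes "x \<in> block lam j" "y \<in> block lam k" "j < k"
  shows "x < y"
  using assms block_end_mono[of "j+1" k lam] by (auto simp: block_iff)

lemma block_unique: "x \<in> block lam j \<Longrightarrow> x \<in> block lam k \<Longrightarrow> j = k"
  using block_less by (metis less_irrefl linorder_neqE_nat)

definition block_of :: "nat list \<Rightarrow> nat \<Rightarrow> nat" where
  "block_of lam x = (THE k. x \<in> block lam k)"

lemma block_of_eq: "x \<in> block lam k \<Longrightarrow> block_of lam x = k"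
  unfolding block_of_def using block_unique by blast

lemma block_of_block:
  assumes "lam \<in> Lambda n r" "x \<in> {1..2*r+1}"
  shows "x \<in> block lam (block_of lam x)" "block_of lam x < 2*n+1"
  using block_exists[OF assms] block_of_eq by auto

lemma block_conv_block_of:
  assumes "lam \<in> Lambda n r" "k < 2*n+1"
  shows "block lam k = {x \<in> {1..2*r+1}. block_of lam x = k}"
  using block_range[OF assms] block_of_eq block_of_block[OF assms(1)] by blast

lemma block_of_mono:
  assumes "lam \<in> Lambda n r" "x \<in> {1..2*r+1}" "y \<in> {1..2*r+1}" "x \<le> y"
  shows "block_of lam x \<le> block_of lam y"
  using block_less[OF block_of_block(1)[OF assms(1,3)] block_of_block(1)[OF assms(1,2)]] assms(4) by force

lemma block_of_star:
  assumes lam: "lam \<in> Lambda n r" and x: "x \<in> {1..2*r+1}"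
  shows "block_of lam (2*r+2-x) = 2*n - block_of lam x"
proof (rule block_of_eq)
  let ?k = "block_of lam x"
  have k: "block_end lam ?k < x" "x \<le> block_end lam (?k+1)" "?k < 2*n+1"
    using block_of_block[OF lam x] by (simp_all add: block_iff)
  have e: "2*n - ?k = 2*n+1-(?k+1)" "2*n - ?k + 1 = 2*n+1-?k" using k(3) by simp_all
  have "block_end lam (2*n - ?k) + block_end lam (?k+1) = 2*r+1"
    unfolding e(1) by (rule block_end_star[OF lam]) (use k(3) in simp)
  moreover have "block_end lam (2*n - ?k + 1) + block_end lam ?k = 2*r+1"
    unfolding e(2) by (rule block_end_star[OF lam]) (use k(3) in simp)
  ultimately show "2*r+2-x \<in> block lam (2*n - ?k)"
    unfolding block_iff using k(1,2) by linarith
qed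

lemma parab_gens_iff_block_of:
  assumes lam: "lam \<in> Lambda n r" and i: "i \<in> {1..r}"
  shows "i \<in> parab_gens n r lam \<longleftrightarrow> block_of lam i = block_of lam (next_pos r i)"
proof -
  have ir: "i \<in> {1..2*r+1}" "next_pos r i \<in> {1..2*r+1}" using i next_pos_range[OF i] by auto
  have J: "i \<in> parab_gens n r lam \<longleftrightarrow> (\<forall>k. 1 \<le> k \<longrightarrow> k \<le> n \<longrightarrow> i \<noteq> block_end lam k)"
    using i block_end_low[OF lam] by (auto simp: parab_gens_def)
  let ?k = "block_of lam i"
  have k: "block_end lam ?k < i" "i \<le> block_end lam (?k+1)" "?k < 2*n+1"
    using block_of_block[OF lam ir(1)] by (simp_all add: block_iff)
  have mid: "block_end lam (n+1) + block_end lam n = 2*r+1" using block_end_star[OF lam, of n] by simp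
  have kn: "?k \<le> n"
  proof (rule ccontr)
    assume "\<not> ?k \<le> n"
    then have "block_end lam (n+1) \<le> block_end lam ?k" by (intro block_end_mono) simp
    then show False using mid block_end_low_le[OF lam, of n] k(1) i by simp
  qed
  show ?thesis
  proof
    assume j: "i \<in> parab_gens n r lam"
    have "next_pos r i \<in> block lam ?k"
    proof (cases "?k = n")
      case False
      then have "i \<noteq> block_end lam (?k+1)" using j kn unfolding J by auto
      moreover have "block_end lam (?k+1) \<le> r" using False kn by (intro block_end_low_le[OF lam]) simp
      ultimately show ?thesis using k by (simp add: block_iff next_pos_def)
    next
      case True
      have "block_end lam n < i" using k True by simp
      then show ?thesis using True mid i by (auto simp: block_iff next_pos_def)
    qed
    then show "block_of lam i = block_of lam (next_pos r i)" using block_of_eq by metis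
  next
    assume e: "block_of lam i = block_of lam (next_pos r i)"
    then have n: "next_pos r i \<le> block_end lam (?k+1)" using block_of_block(1)[OF lam ir(2)] by (simp add: block_iff)
    show "i \<in> parab_gens n r lam"
      unfolding J
    proof (intro allI impI)
      fix m assume m: "1 \<le> m" "m \<le> n"
      show "i \<noteq> block_end lam m"
      proof
        assume a: "i = block_end lam m"
        have "?k < m" using k(1) a block_end_mono[of m ?k lam] by force
        then have "block_end lam (?k+1) \<le> block_end lam m" by (intro block_end_mono) simp
        then show False using n a i by (simp add: next_pos_def split: if_splits)
      qed
    qed
  qed
qed

lemma refl_preserves_blocks:
  assumes lam: "lam \<in> Lambda n r" and i: "i \<in> parab_gens n r lam" and x: "x \<in> {1..2*r+1}"
  shows "block_of lam (B_refl r i x) = block_of lam x"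
proof -
  have i': "i \<in> {1..r}" using i parab_gens_subset by blast
  then have ii: "1 \<le> i" "i \<le> r" by auto
  have ir: "i \<in> {1..2*r+1}" "next_pos r i \<in> {1..2*r+1}" using i' next_pos_range[OF i'] by auto
  have e: "block_of lam i = block_of lam (next_pos r i)" using parab_gens_iff_block_of[OF lam i'] i by simp
  show ?thesis
    unfolding B_refl_apply[OF ii] using e block_of_star[OF lam ir(1)] block_of_star[OF lam ir(2)] by simp
qed

lemma parab_preserves_blocks:
  assumes lam: "lam \<in> Lambda n r" and u: "u \<in> parab r (parab_gens n r lam)" and x: "x \<in> {1..2*r+1}"
  shows "block_of lam (u x) = block_of lam x"
proof -
  have in_range: "parab r (parab_gens n r lam) \<subseteq> BW r" by (rule parab_subset[OF parab_gens_subset])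
  from u have "u \<in> generate (B_group r) (B_refl r ` parab_gens n r lam)" by (simp add: parab_def)
  then show ?thesis using x
  proof (induction arbitrary: x rule: generate.induct)
    case one then show ?case by (simp add: id_apply)
  next
    case (incl h) then show ?case using refl_preserves_blocks[OF lam] by auto
  next
    case (inv h)
    then obtain i where i: "i \<in> parab_gens n r lam" "h = B_refl r i" by auto
    then have "i \<in> {1..r}" using parab_gens_subset by blast
    then have "inv\<^bsub>B_group r\<^esub> h = h" using i by (simp only: B_group_inv B_refl_in B_refl_inv)
    then show ?case using refl_preserves_blocks[OF lam i(1) inv(2)] i by simp
  next
    case (eng h1 h2)
    have "h2 \<in> BW r" using eng(2) in_range by (auto simp: parab_def)
    then have "h2 x \<in> {1..2*r+1}" using BW_range eng(5) by blast
    then show ?case using eng by (simp add: o_apply)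
  qed
qed

text \<open>Induction on the length: at a descent \<open>i\<close> of an element that preserves the blocks, \<open>i\<close> and its neighbour lie in the same block,
  because elements of different blocks stay in order.\<close>

lemma preserves_blocks_parab:
  assumes lam: "lam \<in> Lambda n r"
  shows "w \<in> BW r \<Longrightarrow> (\<And>x. x \<in> {1..2*r+1} \<Longrightarrow> block_of lam (w x) = block_of lam x) \<Longrightarrow> w \<in> parab r (parab_gens n r lam)"
proof (induction "B_length r w" arbitrary: w rule: less_induct)
  case less
  note w = less.prems(1)
  show ?case
  proof (cases "\<exists>i\<in>{1..r}. rdesc r w i")
    case False
    then have "w = id" using no_rdesc_imp_id[OF w] by blast
    then show ?thesis using parab_id by simp
  next
    case True
    then obtain i where i: "i \<in> {1..r}" "rdesc r w i" by blast
    have ir: "i \<in> {1..2*r+1}" "next_pos r i \<in> {1..2*r+1}" using i(1) next_pos_range[OF i(1)] by auto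
    have wr: "w i \<in> {1..2*r+1}" "w (next_pos r i) \<in> {1..2*r+1}" using BW_range[OF w] ir by blast+
    have lt: "w (next_pos r i) < w i" using i(2) by (simp add: rdesc_def)
    have "block_of lam (next_pos r i) \<le> block_of lam i"
      using block_of_mono[OF lam wr(2,1)] lt less.prems(2)[OF ir(1)] less.prems(2)[OF ir(2)] by simp
    moreover have "block_of lam i \<le> block_of lam (next_pos r i)"
      by (rule block_of_mono[OF lam ir]) (use i(1) in \<open>auto simp: next_pos_def\<close>)
    ultimately have iJ: "i \<in> parab_gens n r lam" using parab_gens_iff_block_of[OF lam i(1)] by simp
    let ?v = "w \<circ> B_refl r i"
    have v: "?v \<in> BW r" using w i(1) by (rule refl_comp_in(2))
    have "block_of lam (?v x) = block_of lam x" if "x \<in> {1..2*r+1}" for x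
      using refl_preserves_blocks[OF lam iJ that] less.prems(2)[OF BW_range[OF B_refl_in[OF i(1)] that]]
      by (simp add: o_apply)
    then have "?v \<in> parab r (parab_gens n r lam)"
      using less.hyps[of ?v] v length_right_descent[OF w i] by simp
    then have "?v \<circ> B_refl r i \<in> parab r (parab_gens n r lam)"
      using parab_comp[OF parab_gens_subset] parab_refl[OF iJ] by blast
    then show ?thesis unfolding B_refl_comp_right[OF i(1)] .
  qed
qed

section \<open>Matrices and double cosets\<close>

subsection \<open>Matrices of double cosets\<close>

definition block_count :: "nat list \<Rightarrow> nat list \<Rightarrow> (nat \<Rightarrow> nat) \<Rightarrow> nat \<Rightarrow> nat \<Rightarrow> nat" where
  "block_count lam mu w i j = card (block lam i \<inter> w ` block mu j)"

definition dcoset :: "nat \<Rightarrow> nat \<Rightarrow> nat list \<Rightarrow> nat list \<Rightarrow> (nat \<Rightarrow> nat) \<Rightarrow> (nat \<Rightarrow> nat) set" where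
  "dcoset n r lam mu w = parab r (parab_gens n r lam) <#>\<^bsub>B_group r\<^esub> {w} <#>\<^bsub>B_group r\<^esub> parab r (parab_gens n r mu)"

lemma dcoset_iff: "x \<in> dcoset n r lam mu w \<longleftrightarrow>
    (\<exists>u\<in>parab r (parab_gens n r lam). \<exists>v\<in>parab r (parab_gens n r mu). x = u \<circ> w \<circ> v)"
  unfolding dcoset_def set_mult_def by auto

lemma block_count_alt:
  assumes lam: "lam \<in> Lambda n r" and mu: "mu \<in> Lambda n r" and w: "w \<in> BW r"
    and ij: "i < 2*n+1" "j < 2*n+1"
  shows "block_count lam mu w i j = card {x \<in> {1..2*r+1}. block_of lam (w x) = i \<and> block_of mu x = j}"
proof -
  have "block lam i \<inter> w ` block mu j = w ` {x \<in> {1..2*r+1}. block_of lam (w x) = i \<and> block_of mu x = j}"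
    unfolding block_conv_block_of[OF lam ij(1)] block_conv_block_of[OF mu ij(2)]
    using BW_range[OF w] by auto
  moreover have "inj_on w X" for X using BW_inj[OF w] by (auto intro: inj_onI)
  ultimately show ?thesis by (simp add: block_count_def card_image)
qed

lemma block_count_invariant:
  assumes lam: "lam \<in> Lambda n r" and mu: "mu \<in> Lambda n r" and w: "w \<in> BW r"
    and u: "u \<in> parab r (parab_gens n r lam)" and v: "v \<in> parab r (parab_gens n r mu)"
    and ij: "i < 2*n+1" "j < 2*n+1"
  shows "block_count lam mu (u \<circ> w \<circ> v) i j = block_count lam mu w i j"
proof -
  have ub: "u \<in> BW r" and vb: "v \<in> BW r" using parab_in[OF parab_gens_subset] u v by blast+
  have uwv: "u \<circ> w \<circ> v \<in> BW r" using ub vb w by blast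
  have e: "block_of lam ((u \<circ> w \<circ> v) x) = block_of lam (w (v x))" "block_of mu x = block_of mu (v x)" if "x \<in> {1..2*r+1}" for x
    using parab_preserves_blocks[OF lam u BW_range[OF w BW_range[OF vb that]]] parab_preserves_blocks[OF mu v that]
    by (simp_all add: o_apply)
  have im: "v ` {x \<in> {1..2*r+1}. block_of lam ((u \<circ> w \<circ> v) x) = i \<and> block_of mu x = j}
      = {x \<in> {1..2*r+1}. block_of lam (w x) = i \<and> block_of mu x = j}"
  proof (intro equalityI subsetI)
    fix y assume "y \<in> v ` {x \<in> {1..2*r+1}. block_of lam ((u \<circ> w \<circ> v) x) = i \<and> block_of mu x = j}"
    then obtain x where x: "y = v x" "x \<in> {1..2*r+1}" "block_of lam ((u \<circ> w \<circ> v) x) = i" "block_of mu x = j" by blast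
    show "y \<in> {x \<in> {1..2*r+1}. block_of lam (w x) = i \<and> block_of mu x = j}"
      using e[OF x(2)] BW_range[OF vb x(2)] x by simp
  next
    fix y assume y: "y \<in> {x \<in> {1..2*r+1}. block_of lam (w x) = i \<and> block_of mu x = j}"
    have p: "pinv v y \<in> {1..2*r+1}" using y BW_range[OF BW_inv[OF vb]] by blast
    have "v (pinv v y) = y" using vb by simp
    then show "y \<in> v ` {x \<in> {1..2*r+1}. block_of lam ((u \<circ> w \<circ> v) x) = i \<and> block_of mu x = j}"
      using e[OF p] p y by (intro image_eqI[of _ _ "pinv v y"]) simp_all
  qed
  have inj: "inj_on v X" for X using BW_inj[OF vb] by (auto intro: inj_onI)
  show ?thesis
    unfolding block_count_alt[OF lam mu uwv ij] block_count_alt[OF lam mu w ij] im[symmetric] card_image[OF inj] ..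
qed

lemma star_facts:
  fixes x r :: nat
  assumes "x \<in> {1..2*r+1}"
  shows "2*r+2-x \<in> {1..2*r+1}" "2*r+2-(2*r+2-x) = x"
  using assms by auto

lemma equivariant_BW:
  assumes bij: "bij_betw g {1..2*r+1} {1..2*r+1}"
    and eq: "\<And>x. x \<in> {1..2*r+1} \<Longrightarrow> g (2*r+2-x) = 2*r+2 - g x"
  shows "(\<lambda>x. if x \<in> {1..2*r+1} then g x else x) \<in> BW r"
proof -
  let ?h = "\<lambda>x. if x \<in> {1..2*r+1} then g x else x"
  have "bij_betw ?h {1..2*r+1} {1..2*r+1}"
    using bij by (rule bij_betw_cong[THEN iffD1, rotated]) simp
  then have "?h permutes {1..2*r+1}" by (rule bij_imp_permutes) auto
  moreover have "?h (2*r+2-x) = 2*r+2 - ?h x" if "x \<in> {1..2*r+1}" for x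
    using eq[OF that] star_facts[OF that] that by simp
  ultimately show ?thesis by (simp add: BW_iff)
qed

text \<open>For two elements with the same matrix, the pieces into which they cut the column blocks are
  matched compatibly with the symmetry.  The matching preserves the column blocks, and composing one
  element with it gives the other up to a permutation that preserves the row blocks.\<close>

lemma same_block_count_dcoset:
  assumes lam: "lam \<in> Lambda n r" and mu: "mu \<in> Lambda n r" and w: "w \<in> BW r" and w': "w' \<in> BW r"
    and same: "\<And>i j. i < 2*n+1 \<Longrightarrow> j < 2*n+1 \<Longrightarrow> block_count lam mu w i j = block_count lam mu w' i j"
  shows "w' \<in> dcoset n r lam mu w"
proof -
  let ?X = "{1..2*r+1}"
  let ?l = "\<lambda>w x. (block_of lam (w x), block_of mu x)"
  let ?k = "\<lambda>p. (2*n - fst p, 2*n - snd p)"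
  have lab: "?l w (2*r+2-x) = ?k (?l w x)" if "x \<in> ?X" "w \<in> BW r" for x w
    using block_of_star[OF mu that(1)] block_of_star[OF lam BW_range[OF that(2,1)]] BW_star[OF that(2,1)] by simp
  have fib: "card {x \<in> ?X. ?l w x = p} = card {x \<in> ?X. ?l w' x = p}" for p
  proof (cases "fst p < 2*n+1 \<and> snd p < 2*n+1")
    case True
    then show ?thesis
      using same[of "fst p" "snd p"] block_count_alt[OF lam mu w, of "fst p" "snd p"] block_count_alt[OF lam mu w', of "fst p" "snd p"]
      by (cases p) simp
  next
    case False
    have "?l v x \<noteq> p" if "x \<in> ?X" "v \<in> BW r" for v x
      using block_of_block(2)[OF lam BW_range[OF that(2,1)]] block_of_block(2)[OF mu that(1)] False by (cases p) auto
    then have "{x \<in> ?X. ?l w x = p} = {}" "{x \<in> ?X. ?l w' x = p} = {}" using w w' by blast+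
    then show ?thesis by (simp only:)
  qed
  have "\<exists>g. bij_betw g ?X ?X \<and> (\<forall>x\<in>?X. ?l w' (g x) = ?l w x \<and> g (2*r+2-x) = 2*r+2 - g x)"
  proof (rule equivariant_matching)
    show "?l w (2*r+2-x) = ?k (?l w x)" if "x \<in> ?X" for x by (rule lab[OF that w])
    show "?l w' (2*r+2-x) = ?k (?l w' x)" if "x \<in> ?X" for x by (rule lab[OF that w'])
  qed (use fib star_facts in auto)
  then obtain g where g: "bij_betw g ?X ?X" "\<And>x. x \<in> ?X \<Longrightarrow> ?l w' (g x) = ?l w x"
    "\<And>x. x \<in> ?X \<Longrightarrow> g (2*r+2-x) = 2*r+2 - g x" by blast
  define h where "h = (\<lambda>x. if x \<in> ?X then g x else x)"
  have h: "h \<in> BW r" unfolding h_def by (rule equivariant_BW[OF g(1,3)])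
  have hx: "block_of lam (w' (h x)) = block_of lam (w x)" "block_of mu (h x) = block_of mu x" if "x \<in> ?X" for x
    using g(2)[OF that] that by (simp_all add: h_def)
  have hP: "h \<in> parab r (parab_gens n r mu)" by (rule preserves_blocks_parab[OF mu h hx(2)])
  let ?u = "w' \<circ> h \<circ> pinv w"
  have ub: "?u \<in> BW r" using w w' h by blast
  have "?u \<in> parab r (parab_gens n r lam)"
  proof (rule preserves_blocks_parab[OF lam ub])
    fix x assume x: "x \<in> ?X"
    have "block_of lam (w' (h (pinv w x))) = block_of lam (w (pinv w x))"
      by (rule hx(1)[OF BW_range[OF BW_inv[OF w] x]])
    then show "block_of lam (?u x) = block_of lam x" using w by (simp add: o_apply)
  qed
  moreover have "w' = ?u \<circ> w \<circ> pinv h"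
    using w h by (simp add: fun_eq_iff o_apply)
  ultimately show ?thesis using parab_inv[OF parab_gens_subset hP] unfolding dcoset_iff by blast
qed

lemma dcoset_eq_block_count:
  assumes lam: "lam \<in> Lambda n r" and mu: "mu \<in> Lambda n r" and w: "w \<in> BW r"
  shows "dcoset n r lam mu w = {x \<in> BW r. \<forall>i<2*n+1. \<forall>j<2*n+1. block_count lam mu x i j = block_count lam mu w i j}"
proof (intro equalityI subsetI)
  fix x assume "x \<in> dcoset n r lam mu w"
  then obtain u v where uv: "u \<in> parab r (parab_gens n r lam)" "v \<in> parab r (parab_gens n r mu)" "x = u \<circ> w \<circ> v"
    unfolding dcoset_iff by blast
  have "u \<in> BW r" "v \<in> BW r" using parab_in[OF parab_gens_subset] uv by blast+
  then show "x \<in> {x \<in> BW r. \<forall>i<2*n+1. \<forall>j<2*n+1. block_count lam mu x i j = block_count lam mu w i j}"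
    using block_count_invariant[OF lam mu w uv(1,2)] w uv(3) by blast
next
  fix x assume "x \<in> {x \<in> BW r. \<forall>i<2*n+1. \<forall>j<2*n+1. block_count lam mu x i j = block_count lam mu w i j}"
  then show "x \<in> dcoset n r lam mu w"
    using same_block_count_dcoset[OF lam mu w, of x] by auto
qed

lemma tilde_inj:
  assumes "lam \<in> Lambda n r" "mu \<in> Lambda n r" "tilde lam = tilde mu"
  shows "lam = mu"
proof -
  have l: "length (butlast lam) = length (butlast mu)" using assms by (simp add: Lambda_def)
  have "butlast lam = butlast mu" "last lam = last mu"
    using assms(3) l by (simp_all add: tilde_def)
  then show ?thesis using Lambda_split assms by metis
qed

text \<open>The middle entry of a palindrome of odd length and odd sum is odd.\<close>

lemma tilde_exists:
  assumes len: "length xs = 2*n+1" and pal: "rev xs = xs" and sum: "sum_list xs = 2*r+1"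
  shows "\<exists>lam\<in>Lambda n r. tilde lam = xs"
proof -
  define ys where "ys = take n xs"
  define m where "m = xs ! n"
  have d: "drop (n+1) xs = rev ys"
  proof -
    have "rev ys = drop (n+1) (rev xs)" unfolding ys_def using len by (simp add: rev_take)
    then show ?thesis using pal by simp
  qed
  have "xs = take n xs @ [xs ! n] @ drop (n+1) xs"
    using id_take_nth_drop[of n xs] len by simp
  then have xs: "xs = ys @ [m] @ rev ys" unfolding d by (simp only: ys_def m_def)
  have s: "2 * sum_list ys + m = 2*r+1"
    using sum unfolding xs by simp
  then have "\<exists>k. m = 2 * k + 1" by presburger
  then obtain k where m: "m = 2 * k + 1" by blast
  have "length ys = n" using len by (simp add: ys_def)
  then have "ys @ [k] \<in> Lambda n r" using s m by (simp add: Lambda_def)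
  moreover have "tilde (ys @ [k]) = ys @ [m] @ rev ys" unfolding m by (simp add: tilde_def)
  ultimately show ?thesis unfolding xs[symmetric] by blast
qed

definition sym_mat :: "nat \<Rightarrow> nat \<Rightarrow> (nat \<Rightarrow> nat \<Rightarrow> nat) \<Rightarrow> bool" where
  "sym_mat n r a \<longleftrightarrow> (\<Sum>i<2*n+1. \<Sum>j<2*n+1. a i j) = 2*r+1 \<and>
    (\<forall>i<2*n+1. \<forall>j<2*n+1. a i j = a (2*n - i) (2*n - j))"

lemma Theta_iff: "A \<in> Theta n r \<longleftrightarrow> A \<in> carrier_mat (2*n+1) (2*n+1) \<and> sym_mat n r (\<lambda>i j. A $$ (i, j))"
  by (simp add: Theta_def sym_mat_def Let_def)

lemma flip_bij: "bij_betw (\<lambda>j::nat. 2*n - j) {..<2*n+1} {..<2*n+1}"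
  by (rule bij_betwI[of _ _ _ "\<lambda>j. 2*n - j"]) auto

lemma sym_row_weight:
  assumes a: "sym_mat n r a"
  shows "\<exists>lam\<in>Lambda n r. tilde lam = map (\<lambda>i. \<Sum>j<2*n+1. a i j) [0..<2*n+1]"
proof (rule tilde_exists)
  let ?R = "\<lambda>i. \<Sum>j<2*n+1. a i j"
  have sym: "?R (2*n - i) = ?R i" if "i < 2*n+1" for i
  proof -
    have "a i j = a (2*n - i) (2*n - j)" if "j < 2*n+1" for j
      using a \<open>i < 2*n+1\<close> that unfolding sym_mat_def by blast
    then have "?R i = (\<Sum>j<2*n+1. a (2*n - i) (2*n - j))"
      by (intro sum.cong) simp_all
    also have "\<dots> = ?R (2*n - i)" by (rule sum.reindex_bij_betw[OF flip_bij])
    finally show ?thesis by simp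
  qed
  show "rev (map ?R [0..<2*n+1]) = map ?R [0..<2*n+1]"
  proof (rule nth_equalityI)
    fix i assume "i < length (rev (map ?R [0..<2*n+1]))"
    then have i: "i < 2*n+1" by simp
    have "2*n+1 - Suc i = 2*n - i" by simp
    then show "rev (map ?R [0..<2*n+1]) ! i = map ?R [0..<2*n+1] ! i"
      using i sym[OF i] by (simp add: rev_nth del: upt_Suc)
  qed simp
  show "sum_list (map ?R [0..<2*n+1]) = 2*r+1"
  proof -
    have "(\<Sum>i<2*n+1. ?R i) = 2*r+1" using a unfolding sym_mat_def by blast
    then show ?thesis by (simp only: interv_sum_list_conv_sum_set_nat atLeast0LessThan set_upt)
  qed
qed (simp del: upt_Suc)

lemma sym_mat_transpose: "sym_mat n r a \<Longrightarrow> sym_mat n r (\<lambda>i j. a j i)"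
proof -
  assume a: "sym_mat n r a"
  have "(\<Sum>i<2*n+1. \<Sum>j<2*n+1. a j i) = (\<Sum>j<2*n+1. \<Sum>i<2*n+1. a j i)" by (rule sum.swap)
  moreover have "(\<Sum>j<2*n+1. \<Sum>i<2*n+1. a j i) = 2*r+1"
    "\<forall>i<2*n+1. \<forall>j<2*n+1. a i j = a (2*n - i) (2*n - j)"
    using a unfolding sym_mat_def by blast+
  ultimately show "sym_mat n r (\<lambda>i j. a j i)" unfolding sym_mat_def by presburger
qed

lemma row_weight_spec:
  assumes "A \<in> Theta n r"
  shows "row_weight n r A \<in> Lambda n r" "tilde (row_weight n r A) = row_sums A"
proof -
  have A: "A \<in> carrier_mat (2*n+1) (2*n+1)" "sym_mat n r (\<lambda>i j. A $$ (i, j))"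
    using assms by (simp_all add: Theta_iff)
  have r: "row_sums A = map (\<lambda>i. \<Sum>j<2*n+1. A $$ (i, j)) [0..<2*n+1]"
    using A(1) by (simp add: row_sums_def)
  have "\<exists>!lam. lam \<in> Lambda n r \<and> tilde lam = row_sums A"
    using sym_row_weight[OF A(2)] tilde_inj unfolding r by metis
  from theI'[OF this] show "row_weight n r A \<in> Lambda n r" "tilde (row_weight n r A) = row_sums A"
    by (simp_all add: row_weight_def)
qed

lemma col_weight_spec:
  assumes "A \<in> Theta n r"
  shows "col_weight n r A \<in> Lambda n r" "tilde (col_weight n r A) = col_sums A"
proof -
  have A: "A \<in> carrier_mat (2*n+1) (2*n+1)" "sym_mat n r (\<lambda>i j. A $$ (j, i))"
    using assms sym_mat_transpose by (auto simp: Theta_iff)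
  have r: "col_sums A = map (\<lambda>i. \<Sum>j<2*n+1. A $$ (j, i)) [0..<2*n+1]"
    using A(1) by (simp add: col_sums_def)
  have "\<exists>!lam. lam \<in> Lambda n r \<and> tilde lam = col_sums A"
    using sym_row_weight[OF A(2)] tilde_inj unfolding r by metis
  from theI'[OF this] show "col_weight n r A \<in> Lambda n r" "tilde (col_weight n r A) = col_sums A"
    by (simp_all add: col_weight_def)
qed

lemma Omega_iff: "A \<in> Omega n r \<longleftrightarrow> A \<in> Theta n r \<and> row_weight n r A = col_weight n r A"
  using row_weight_spec[of A n r] col_weight_spec[of A n r] tilde_inj[of "row_weight n r A" n r "col_weight n r A"]
  by (auto simp: Omega_def)

lemma block_count_row:
  assumes lam: "lam \<in> Lambda n r" and mu: "mu \<in> Lambda n r" and w: "w \<in> BW r" and i: "i < 2*n+1"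
  shows "(\<Sum>j<2*n+1. block_count lam mu w i j) = tilde lam ! i"
proof -
  let ?F = "\<lambda>j. {x \<in> {1..2*r+1}. block_of lam (w x) = i \<and> block_of mu x = j}"
  have "(\<Sum>j<2*n+1. block_count lam mu w i j) = (\<Sum>j<2*n+1. card (?F j))"
    by (rule sum.cong) (use block_count_alt[OF lam mu w i] in auto)
  also have "\<dots> = card (\<Union>j<2*n+1. ?F j)" by (subst card_UN_disjoint) auto
  also have "(\<Union>j<2*n+1. ?F j) = {x \<in> {1..2*r+1}. block_of lam (w x) = i}" using block_of_block(2)[OF mu] by auto
  also have "card \<dots> = card (w ` \<dots>)"
    using BW_inj[OF w] by (intro card_image[symmetric]) (auto intro: inj_onI)
  also have "w ` {x \<in> {1..2*r+1}. block_of lam (w x) = i} = block lam i"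
  proof (intro equalityI subsetI)
    fix y assume "y \<in> block lam i"
    then have y: "y \<in> {1..2*r+1}" "block_of lam y = i" unfolding block_conv_block_of[OF lam i] by auto
    have "y = w (pinv w y)" using w by simp
    then show "y \<in> w ` {x \<in> {1..2*r+1}. block_of lam (w x) = i}"
      using BW_range[OF BW_inv[OF w] y(1)] y(2) w by (intro image_eqI[of _ _ "pinv w y"]) simp_all
  next
    fix y assume "y \<in> w ` {x \<in> {1..2*r+1}. block_of lam (w x) = i}"
    then show "y \<in> block lam i" unfolding block_conv_block_of[OF lam i] using BW_range[OF w] by auto
  qed
  finally show ?thesis using card_block[OF lam i] by simp
qed

lemma block_count_col:
  assumes lam: "lam \<in> Lambda n r" and mu: "mu \<in> Lambda n r" and w: "w \<in> BW r" and j: "j < 2*n+1"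
  shows "(\<Sum>i<2*n+1. block_count lam mu w i j) = tilde mu ! j"
proof -
  let ?F = "\<lambda>i. {x \<in> {1..2*r+1}. block_of lam (w x) = i \<and> block_of mu x = j}"
  have "(\<Sum>i<2*n+1. block_count lam mu w i j) = (\<Sum>i<2*n+1. card (?F i))"
    by (rule sum.cong) (use block_count_alt[OF lam mu w _ j] in auto)
  also have "\<dots> = card (\<Union>i<2*n+1. ?F i)" by (subst card_UN_disjoint) auto
  also have "(\<Union>i<2*n+1. ?F i) = block mu j"
    unfolding block_conv_block_of[OF mu j] using block_of_block(2)[OF lam BW_range[OF w]] by auto
  finally show ?thesis using card_block[OF mu j] by simp
qed

lemma block_count_sym:
  assumes lam: "lam \<in> Lambda n r" and mu: "mu \<in> Lambda n r" and w: "w \<in> BW r"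
    and ij: "i < 2*n+1" "j < 2*n+1"
  shows "block_count lam mu w i j = block_count lam mu w (2*n - i) (2*n - j)"
proof -
  have i': "2*n - i < 2*n+1" "2*n - j < 2*n+1" by auto
  have "bij_betw (\<lambda>x. 2*r+2-x) {x \<in> {1..2*r+1}. block_of lam (w x) = i \<and> block_of mu x = j}
      {x \<in> {1..2*r+1}. block_of lam (w x) = 2*n - i \<and> block_of mu x = 2*n - j}"
  proof (rule bij_betwI[of _ _ _ "\<lambda>x. 2*r+2-x"])
    have s: "block_of lam (w (2*r+2-x)) = 2*n - block_of lam (w x)" "block_of mu (2*r+2-x) = 2*n - block_of mu x"
      if "x \<in> {1..2*r+1}" for x
      using block_of_star[OF mu that] block_of_star[OF lam BW_range[OF w that]] BW_star[OF w that] by simp_all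
    show "(\<lambda>x. 2*r+2-x) \<in> {x \<in> {1..2*r+1}. block_of lam (w x) = i \<and> block_of mu x = j} \<rightarrow>
        {x \<in> {1..2*r+1}. block_of lam (w x) = 2*n - i \<and> block_of mu x = 2*n - j}"
      using s star_facts(1) by blast
    show "(\<lambda>x. 2*r+2-x) \<in> {x \<in> {1..2*r+1}. block_of lam (w x) = 2*n - i \<and> block_of mu x = 2*n - j} \<rightarrow>
        {x \<in> {1..2*r+1}. block_of lam (w x) = i \<and> block_of mu x = j}"
    proof
      fix x assume "x \<in> {x \<in> {1..2*r+1}. block_of lam (w x) = 2*n - i \<and> block_of mu x = 2*n - j}"
      then have x: "x \<in> {1..2*r+1}" "block_of lam (w x) = 2*n - i" "block_of mu x = 2*n - j" by auto
      show "2*r+2-x \<in> {x \<in> {1..2*r+1}. block_of lam (w x) = i \<and> block_of mu x = j}"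
        using s[OF x(1)] star_facts(1)[OF x(1)] x(2,3) ij by simp
    qed
  qed auto
  then show ?thesis
    unfolding block_count_alt[OF lam mu w ij] block_count_alt[OF lam mu w i'] by (rule bij_betw_same_card)
qed

text \<open>The cells of a symmetric matrix, each entry counted with its multiplicity, are matched with the
  points of the row blocks and with the points of the column blocks; the composite realizes the matrix.\<close>

lemma realize_matrix:
  assumes a: "sym_mat n r a" and lam: "lam \<in> Lambda n r" and mu: "mu \<in> Lambda n r"
    and row: "\<And>i. i < 2*n+1 \<Longrightarrow> (\<Sum>j<2*n+1. a i j) = tilde lam ! i"
    and col: "\<And>j. j < 2*n+1 \<Longrightarrow> (\<Sum>i<2*n+1. a i j) = tilde mu ! j"
  shows "\<exists>w\<in>BW r. \<forall>i<2*n+1. \<forall>j<2*n+1. block_count lam mu w i j = a i j"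
proof -
  let ?N = "2*n+1" and ?X = "{1..2*r+1}"
  define E :: "(nat \<times> nat \<times> nat) set" where "E = (SIGMA i:{..<?N}. SIGMA j:{..<?N}. {..<a i j})"
  define \<sigma> :: "nat \<times> nat \<times> nat \<Rightarrow> nat \<times> nat \<times> nat"
    where "\<sigma> = (\<lambda>(i, j, k). (2*n - i, 2*n - j, a i j - 1 - k))"
  (* Reversing the third coordinate as well makes the mirror symmetry reverse the lexicographic order. *)
  have sym: "a (2*n - i) (2*n - j) = a i j" if "i < ?N" "j < ?N" for i j
  proof -
    have "a i j = a (2*n - i) (2*n - j)" using a that unfolding sym_mat_def by blast
    then show ?thesis by (rule HOL.sym)
  qed
  have lab: "fst (\<sigma> e) = 2*n - fst e" "fst (snd (\<sigma> e)) = 2*n - fst (snd e)" for e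
    by (simp_all add: \<sigma>_def split_beta)
  have fE: "finite E" by (simp add: E_def)
  have s1: "\<sigma> e \<in> E" if "e \<in> E" for e
    using that sym by (auto simp: E_def \<sigma>_def)
  have s2: "\<sigma> (\<sigma> e) = e" if "e \<in> E" for e
    using that sym by (auto simp: E_def \<sigma>_def)
  have s3: "\<sigma> d < \<sigma> e" if "e \<in> E" "d \<in> E" "e < d" for e d
    using that by (auto simp: E_def \<sigma>_def less_prod_def' split: if_splits)
  have row_fib: "card {e \<in> E. fst e = k} = card {x \<in> ?X. block_of lam x = k}" for k
  proof (cases "k < ?N")
    case True
    have "{e \<in> E. fst e = k} = Pair k ` (SIGMA j:{..<?N}. {..<a k j})" using True by (auto simp: E_def)
    then have "card {e \<in> E. fst e = k} = (\<Sum>j<?N. a k j)" by (simp add: card_image inj_on_def)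
    also have "\<dots> = card (block lam k)" using row[OF True] card_block[OF lam True] by simp
    finally show ?thesis by (simp only: block_conv_block_of[OF lam True])
  next
    case False
    then have "{e \<in> E. fst e = k} = {}" by (auto simp: E_def)
    moreover have "{x \<in> ?X. block_of lam x = k} = {}" using block_of_block(2)[OF lam] False by blast
    ultimately show ?thesis by (simp only: card.empty)
  qed
  have col_fib: "card {e \<in> E. fst (snd e) = k} = card {x \<in> ?X. block_of mu x = k}" for k
  proof (cases "k < ?N")
    case True
    have "{e \<in> E. fst (snd e) = k} = (\<lambda>(i, l). (i, k, l)) ` (SIGMA i:{..<?N}. {..<a i k})"
      using True by (force simp: E_def)
    moreover have "inj_on (\<lambda>(i, l). (i, k, l)) S" for S :: "(nat \<times> nat) set" by (auto simp: inj_on_def)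
    ultimately have "card {e \<in> E. fst (snd e) = k} = (\<Sum>i<?N. a i k)" by (simp add: card_image)
    also have "\<dots> = card (block mu k)" using col[OF True] card_block[OF mu True] by simp
    finally show ?thesis by (simp only: block_conv_block_of[OF mu True])
  next
    case False
    then have "{e \<in> E. fst (snd e) = k} = {}" by (auto simp: E_def)
    moreover have "{x \<in> ?X. block_of mu x = k} = {}" using block_of_block(2)[OF mu] False by blast
    ultimately show ?thesis by (simp only: card.empty)
  qed
  have X: "finite ?X" "\<And>x. x \<in> ?X \<Longrightarrow> 2*r+2-x \<in> ?X" "\<And>x. x \<in> ?X \<Longrightarrow> 2*r+2-(2*r+2-x) = x"
    "\<And>x y. x \<in> ?X \<Longrightarrow> y \<in> ?X \<Longrightarrow> x < y \<Longrightarrow> 2*r+2-y < 2*r+2-x"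
    using star_facts by auto
  have "\<exists>g. bij_betw g E ?X \<and> (\<forall>e\<in>E. block_of lam (g e) = fst e \<and> g (\<sigma> e) = 2*r+2 - g e)"
    by (rule equivariant_matching[where \<sigma> = \<sigma> and \<tau> = "\<lambda>x. 2*r+2-x" and l = "fst" and l' = "block_of lam" and \<kappa> = "\<lambda>i. 2*n - i"])
      (rule fE X s1 s2 s3 lab block_of_star[OF lam] row_fib | assumption)+
  then obtain f where f: "bij_betw f E ?X" "\<And>e. e \<in> E \<Longrightarrow> block_of lam (f e) = fst e"
    "\<And>e. e \<in> E \<Longrightarrow> f (\<sigma> e) = 2*r+2 - f e" by blast
  have "\<exists>g. bij_betw g E ?X \<and> (\<forall>e\<in>E. block_of mu (g e) = fst (snd e) \<and> g (\<sigma> e) = 2*r+2 - g e)"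
    by (rule equivariant_matching[where \<sigma> = \<sigma> and \<tau> = "\<lambda>x. 2*r+2-x" and l = "(\<lambda>e. fst (snd e))" and l' = "block_of mu" and \<kappa> = "\<lambda>i. 2*n - i"])
      (rule fE X s1 s2 s3 lab block_of_star[OF mu] col_fib | assumption)+
  then obtain g where g: "bij_betw g E ?X" "\<And>e. e \<in> E \<Longrightarrow> block_of mu (g e) = fst (snd e)"
    "\<And>e. e \<in> E \<Longrightarrow> g (\<sigma> e) = 2*r+2 - g e" by blast
  define g' where "g' = the_inv_into E g"
  have g'b: "bij_betw g' ?X E" unfolding g'_def by (rule bij_betw_the_inv_into[OF g(1)])
  have g'E: "g' x \<in> E" if "x \<in> ?X" for x using bij_betwE[OF g'b] that by blast
  have gg': "g (g' x) = x" if "x \<in> ?X" for x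
    unfolding g'_def using that g(1) by (simp add: f_the_inv_into_f_bij_betw)
  have g'g: "g' (g e) = e" if "e \<in> E" for e
    unfolding g'_def using that g(1) by (simp add: bij_betw_def the_inv_into_f_f)
  have g's: "g' (2*r+2-x) = \<sigma> (g' x)" if "x \<in> ?X" for x
    using g'g[OF s1[OF g'E[OF that]]] g(3)[OF g'E[OF that]] gg'[OF that] by simp
  have fg: "bij_betw (\<lambda>x. f (g' x)) ?X ?X" using bij_betw_trans[OF g'b f(1)] by (simp add: comp_def)
  define w where "w = (\<lambda>x. if x \<in> ?X then f (g' x) else x)"
  have w: "w \<in> BW r"
    unfolding w_def by (rule equivariant_BW[OF fg]) (simp only: g's f(3) g'E)
  have "block_count lam mu w i j = a i j" if ij: "i < ?N" "j < ?N" for i j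
  proof -
    have im: "g ` {e \<in> E. fst e = i \<and> fst (snd e) = j} = {x \<in> ?X. block_of lam (w x) = i \<and> block_of mu x = j}"
    proof (intro equalityI subsetI)
      fix x assume "x \<in> g ` {e \<in> E. fst e = i \<and> fst (snd e) = j}"
      then obtain e where e: "e \<in> E" "fst e = i" "fst (snd e) = j" "x = g e" by blast
      have "x \<in> ?X" using e(1,4) bij_betwE[OF g(1)] by blast
      then show "x \<in> {x \<in> ?X. block_of lam (w x) = i \<and> block_of mu x = j}"
        using e g(2)[OF e(1)] g'g[OF e(1)] f(2)[OF e(1)] by (simp add: w_def)
    next
      fix x assume x: "x \<in> {x \<in> ?X. block_of lam (w x) = i \<and> block_of mu x = j}"
      then have xX: "x \<in> ?X" by blast
      then have wx: "w x = f (g' x)" unfolding w_def by (rule if_P)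
      show "x \<in> g ` {e \<in> E. fst e = i \<and> fst (snd e) = j}"
        using x f(2)[OF g'E[OF xX]] g(2)[OF g'E[OF xX]] gg'[OF xX] g'E[OF xX]
        by (intro image_eqI[of _ _ "g' x"]) (simp_all add: wx)
    qed
    have inj: "inj_on g {e \<in> E. fst e = i \<and> fst (snd e) = j}"
      using g(1) by (auto simp: bij_betw_def inj_on_def)
    have "block_count lam mu w i j = card {e \<in> E. fst e = i \<and> fst (snd e) = j}"
      unfolding block_count_alt[OF lam mu w ij] im[symmetric] by (rule card_image[OF inj])
    also have "{e \<in> E. fst e = i \<and> fst (snd e) = j} = (\<lambda>k. (i, j, k)) ` {..<a i j}"
      using ij by (auto simp: E_def)
    also have "card \<dots> = a i j" by (simp add: card_image inj_on_def)
    finally show ?thesis .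
  qed
  with w show ?thesis by blast
qed

lemma double_coset_spec:
  assumes A: "A \<in> Theta n r"
  defines "lam \<equiv> row_weight n r A" and "mu \<equiv> col_weight n r A"
  shows "double_coset n r A = {w \<in> BW r. \<forall>i<2*n+1. \<forall>j<2*n+1. block_count lam mu w i j = A $$ (i, j)}"
    and "\<exists>w. w \<in> double_coset n r A \<and> double_coset n r A = dcoset n r lam mu w"
proof -
  note row = row_weight_spec[OF A, folded lam_def] and col = col_weight_spec[OF A, folded mu_def]
  have Ac: "A \<in> carrier_mat (2*n+1) (2*n+1)" and a: "sym_mat n r (\<lambda>i j. A $$ (i, j))"
    using A by (simp_all add: Theta_iff)
  let ?N = "2*n+1"
  have "\<exists>w\<in>BW r. \<forall>i<?N. \<forall>j<?N. block_count lam mu w i j = A $$ (i, j)"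
  proof (rule realize_matrix[OF a row(1) col(1)])
    show "(\<Sum>j<?N. A $$ (i, j)) = tilde lam ! i" if "i < ?N" for i
      using that Ac unfolding row(2) by (simp add: row_sums_def del: upt_Suc)
    show "(\<Sum>i<?N. A $$ (i, j)) = tilde mu ! j" if "j < ?N" for j
      using that Ac unfolding col(2) by (simp add: col_sums_def del: upt_Suc)
  qed
  then obtain w where w: "w \<in> BW r" "\<And>i j. i < ?N \<Longrightarrow> j < ?N \<Longrightarrow> block_count lam mu w i j = A $$ (i, j)"
    by blast
  let ?S = "{w \<in> BW r. \<forall>i<?N. \<forall>j<?N. block_count lam mu w i j = A $$ (i, j)}"
  have S: "dcoset n r lam mu v = ?S" if "v \<in> BW r" "\<forall>i<?N. \<forall>j<?N. block_count lam mu v i j = A $$ (i, j)" for v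
    unfolding dcoset_eq_block_count[OF row(1) col(1) that(1)] using that(2) by auto
  have "double_coset n r A = (THE D. \<exists>w\<in>BW r. D = dcoset n r lam mu w \<and>
      (\<forall>i<?N. \<forall>j<?N. A $$ (i, j) = block_count lam mu w i j))"
    by (simp add: double_coset_def Let_def lam_def mu_def parabolic_eq dcoset_def block_count_def)
  also have "\<dots> = ?S"
  proof (rule the_equality)
    show "\<exists>w\<in>BW r. ?S = dcoset n r lam mu w \<and> (\<forall>i<?N. \<forall>j<?N. A $$ (i, j) = block_count lam mu w i j)"
      using w S[OF w(1)] by (intro bexI[of _ w]) auto
    show "D = ?S" if "\<exists>w\<in>BW r. D = dcoset n r lam mu w \<and> (\<forall>i<?N. \<forall>j<?N. A $$ (i, j) = block_count lam mu w i j)" for D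
      using that S by auto
  qed
  finally show D: "double_coset n r A = ?S" .
  show "\<exists>w. w \<in> double_coset n r A \<and> double_coset n r A = dcoset n r lam mu w"
    unfolding D using S[OF w(1)] w by (intro exI[of _ w]) auto
qed

lemma matrix_of_element:
  assumes lam: "lam \<in> Lambda n r" and mu: "mu \<in> Lambda n r" and w: "w \<in> BW r"
  shows "\<exists>!A. A \<in> Theta n r \<and> row_weight n r A = lam \<and> col_weight n r A = mu \<and> w \<in> double_coset n r A"
proof
  let ?N = "2*n+1"
  let ?A = "mat ?N ?N (\<lambda>(i, j). block_count lam mu w i j)"
  have "(\<Sum>i<?N. \<Sum>j<?N. ?A $$ (i, j)) = (\<Sum>i<?N. tilde lam ! i)"
    by (rule sum.cong) (use block_count_row[OF lam mu w] in simp_all)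
  also have "\<dots> = 2*r+1"
    using tilde_sum[OF lam] tilde_length[OF lam] by (simp add: sum_list_sum_nth atLeast0LessThan)
  finally have total: "(\<Sum>i<?N. \<Sum>j<?N. ?A $$ (i, j)) = 2*r+1" .
  have "sym_mat n r (\<lambda>i j. ?A $$ (i, j))"
    unfolding sym_mat_def
  proof (intro conjI allI impI)
    fix i j assume ij: "i < ?N" "j < ?N"
    have "2*n - i < ?N" "2*n - j < ?N" by simp_all
    then show "?A $$ (i, j) = ?A $$ (2*n - i, 2*n - j)"
      using ij by (simp only: index_mat split block_count_sym[OF lam mu w ij])
  qed (rule total)
  then have A: "?A \<in> Theta n r" by (simp add: Theta_iff)
  have "row_sums ?A = tilde lam"
    by (rule nth_equalityI) (use block_count_row[OF lam mu w] tilde_length[OF lam] in \<open>simp_all add: row_sums_def del: upt_Suc sum.lessThan_Suc\<close>)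
  then have rw: "row_weight n r ?A = lam"
    using row_weight_spec[OF A] tilde_inj lam by metis
  have "col_sums ?A = tilde mu"
    by (rule nth_equalityI) (use block_count_col[OF lam mu w] tilde_length[OF mu] in \<open>simp_all add: col_sums_def del: upt_Suc sum.lessThan_Suc\<close>)
  then have cw: "col_weight n r ?A = mu"
    using col_weight_spec[OF A] tilde_inj mu by metis
  have "w \<in> double_coset n r ?A"
    unfolding double_coset_spec(1)[OF A] rw cw using w by simp
  then show "?A \<in> Theta n r \<and> row_weight n r ?A = lam \<and> col_weight n r ?A = mu \<and> w \<in> double_coset n r ?A"
    using A rw cw by blast
  fix B assume B: "B \<in> Theta n r \<and> row_weight n r B = lam \<and> col_weight n r B = mu \<and> w \<in> double_coset n r B"
  then have "\<forall>i<?N. \<forall>j<?N. block_count lam mu w i j = B $$ (i, j)" using double_coset_spec(1)[of B n r] by auto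
  moreover have "B \<in> carrier_mat ?N ?N" using B by (simp add: Theta_iff)
  ultimately show "B = ?A" by (intro eq_matI) auto
qed

lemma double_coset_invariant:
  assumes A: "A \<in> Theta n r"
  shows "double_coset n r A \<subseteq> BW r"
    "left_invariant r (parab_gens n r (row_weight n r A)) (indic (double_coset n r A))"
    "right_invariant r (parab_gens n r (col_weight n r A)) (indic (double_coset n r A))"
proof -
  let ?lam = "row_weight n r A" and ?mu = "col_weight n r A"
  note lam = row_weight_spec(1)[OF A] and mu = col_weight_spec(1)[OF A]
  note D = double_coset_spec(1)[OF A]
  show "double_coset n r A \<subseteq> BW r" unfolding D by blast
  have l: "B_refl r i \<circ> w \<in> double_coset n r A \<longleftrightarrow> w \<in> double_coset n r A"
    if i: "i \<in> parab_gens n r ?lam" and w: "w \<in> BW r" for i w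
  proof -
    have "i \<in> {1..r}" using i parab_gens_subset by blast
    then have "B_refl r i \<circ> w \<in> BW r" using w by (intro refl_comp_in)
    moreover have "block_count ?lam ?mu (B_refl r i \<circ> w) a b = block_count ?lam ?mu w a b" if "a < 2*n+1" "b < 2*n+1" for a b
      using block_count_invariant[OF lam mu w parab_refl[OF i] parab_id that] by simp
    ultimately show ?thesis unfolding D using w by simp
  qed
  have ri: "w \<circ> B_refl r i \<in> double_coset n r A \<longleftrightarrow> w \<in> double_coset n r A"
    if i: "i \<in> parab_gens n r ?mu" and w: "w \<in> BW r" for i w
  proof -
    have "i \<in> {1..r}" using i parab_gens_subset by blast
    then have "w \<circ> B_refl r i \<in> BW r" using w by (intro refl_comp_in)
    moreover have "block_count ?lam ?mu (w \<circ> B_refl r i) a b = block_count ?lam ?mu w a b" if "a < 2*n+1" "b < 2*n+1" for a b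
      using block_count_invariant[OF lam mu w parab_id parab_refl[OF i] that] by simp
    ultimately show ?thesis unfolding D using w by simp
  qed
  show "left_invariant r (parab_gens n r ?lam) (indic (double_coset n r A))"
    unfolding left_invariant_def indic_def using l by simp
  show "right_invariant r (parab_gens n r ?mu) (indic (double_coset n r A))"
    unfolding right_invariant_def indic_def using ri by simp
qed

lemma finite_Theta: "finite (Theta n r)"
proof (rule finite_subset)
  let ?N = "2*n+1"
  let ?F = "{..<?N} \<times> {..<?N} \<rightarrow>\<^sub>E {..2*r+1}"
  show "finite ((\<lambda>f. mat ?N ?N f) ` ?F)" by (intro finite_imageI finite_PiE) auto
  show "Theta n r \<subseteq> (\<lambda>f. mat ?N ?N f) ` ?F"
  proof
    fix A assume A: "A \<in> Theta n r"
    have Ac: "A \<in> carrier_mat ?N ?N" and s: "(\<Sum>i<?N. \<Sum>j<?N. A $$ (i, j)) = 2*r+1"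
      using A unfolding Theta_iff sym_mat_def by blast+
    have le: "A $$ (i, j) \<le> 2*r+1" if "i < ?N" "j < ?N" for i j
    proof -
      have "A $$ (i, j) \<le> (\<Sum>j<?N. A $$ (i, j))" by (rule member_le_sum) (use that in auto)
      also have "\<dots> \<le> (\<Sum>i<?N. \<Sum>j<?N. A $$ (i, j))" by (rule member_le_sum[where f = "\<lambda>i. \<Sum>j<?N. A $$ (i, j)"]) (use that in auto)
      finally show ?thesis using s by simp
    qed
    have "A = mat ?N ?N (\<lambda>p\<in>{..<?N} \<times> {..<?N}. A $$ p)" using Ac by (intro eq_matI) simp_all
    moreover have "(\<lambda>p\<in>{..<?N} \<times> {..<?N}. A $$ p) \<in> ?F"
    proof (rule restrict_PiE_iff[THEN iffD2], intro ballI)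
      fix p assume "p \<in> {..<?N} \<times> {..<?N}"
      then show "A $$ p \<in> {..2*r+1}" using le[of "fst p" "snd p"] by (simp add: mem_Times_iff)
    qed
    ultimately show "A \<in> (\<lambda>f. mat ?N ?N f) ` ?F" by blast
  qed
qed

section \<open>The basis of the q-Schur algebra and its center\<close>

subsection \<open>Coefficients\<close>

lemma ups_K_nonzero: "ups_K \<noteq> 0"
  by (simp add: ups_K_def Zero_fract_def eq_fract)

lemma laurent_to_K_ext: "laurent_to_K f = lin_ext (\<lambda>k a. of_int a * ups_K powi k) f"
  by (simp add: laurent_to_K_def lin_ext_def)

lemma laurent_to_K_add: "laurent_to_K (f + g) = laurent_to_K f + laurent_to_K g"
  unfolding laurent_to_K_ext by (rule lin_ext_add) (simp_all add: distrib_right)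

lemma laurent_to_K_single: "laurent_to_K (Poly_Mapping.single k a) = of_int a * ups_K powi k"
  unfolding laurent_to_K_ext by (simp add: lin_ext_single)

lemma laurent_to_K_one: "laurent_to_K 1 = 1"
  using laurent_to_K_single[of 0 1] by simp

lemma laurent_to_K_mult: "laurent_to_K (f * g) = laurent_to_K f * laurent_to_K g"
proof -
  have zero: "laurent_to_K 0 = 0" by (simp add: laurent_to_K_def)
  have "Poly_Mapping.keys f \<subseteq> UNIV" "Poly_Mapping.keys g \<subseteq> UNIV" by auto
  then show ?thesis
  proof (induction f rule: monoid_ring_induct)
    case fs: (single k a)
    from fs(2) show ?case
    proof (induction g rule: monoid_ring_induct)
      case (single l b)
      then show ?case
        using ups_K_nonzero by (simp add: mult_single laurent_to_K_single power_int_add)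
    qed (simp_all add: distrib_left laurent_to_K_add zero)
  qed (simp_all add: distrib_right laurent_to_K_add zero)
qed

subsection \<open>The normalized basis over the Laurent polynomials\<close>

lemma right_invariant_parab:
  assumes J: "J \<subseteq> {1..r}" and ri: "right_invariant r J v" and u: "u \<in> parab r J" and w: "w \<in> BW r"
  shows "v (w \<circ> u) = v w"
proof -
  have ub: "u \<in> BW r" by (rule parab_in[OF J u])
  have "inv_pull r v (pinv u \<circ> pinv w) = inv_pull r v (pinv w)"
    using ri unfolding right_invariant_inv_pull[OF J] by (rule left_invariant_parab[OF J _ parab_inv[OF J u] BW_inv[OF w]])
  moreover have "pinv u \<circ> pinv w = pinv (w \<circ> u)" using BW_inv_of_comp[OF w ub] by simp
  ultimately show ?thesis using w ub BW_comp[OF w ub] BW_inv[OF w] BW_inv[OF BW_comp[OF w ub]]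
    by (simp add: inv_pull_def)
qed

definition norm_exponent :: "nat \<Rightarrow> nat \<Rightarrow> nat mat \<Rightarrow> int" where
  "norm_exponent n r A = - int (B_length r (longest r (double_coset n r A)))
     + int (B_length r (longest r (parabolic n r (col_weight n r A))))"

lemma norm_basis_norm_exponent: "norm_basis n r A = schur_smult n r (ups_pow (norm_exponent n r A)) (e_basis n r A)"
  by (simp add: norm_basis_def norm_exponent_def)

lemma ups_pow_inverse: "ups_pow (- k) * ups_pow k = 1"
  by (simp add: ups_pow_def mult_single)

definition coset_point :: "nat \<Rightarrow> nat \<Rightarrow> nat mat \<Rightarrow> (nat \<Rightarrow> nat)" where
  "coset_point n r A = (SOME w. w \<in> double_coset n r A)"

text \<open>An invariant function is determined by its value at one point of each double coset.\<close>

definition norm_coord :: "nat \<Rightarrow> nat \<Rightarrow> nat mat \<Rightarrow> (tspace_elt \<Rightarrow> tspace_elt) \<Rightarrow> laurent" where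
  "norm_coord n r A f =
     ups_pow (- norm_exponent n r A) * entry n r f (row_weight n r A) (col_weight n r A) (coset_point n r A)"

lemma coset_point_in: "A \<in> Theta n r \<Longrightarrow> coset_point n r A \<in> double_coset n r A"
  unfolding coset_point_def using double_coset_spec(2) by (metis someI_ex)

lemma entry_const_on_double_coset:
  assumes A: "A \<in> Theta n r" and f: "f \<in> carrier (schur n r)"
    and x: "x \<in> double_coset n r A" and y: "y \<in> double_coset n r A"
  shows "entry n r f (row_weight n r A) (col_weight n r A) x = entry n r f (row_weight n r A) (col_weight n r A) y"
proof -
  let ?lam = "row_weight n r A" and ?mu = "col_weight n r A"
  note inv = entry_invariant[OF f row_weight_spec(1)[OF A] col_weight_spec(1)[OF A]]
  obtain w where w: "w \<in> double_coset n r A" "double_coset n r A = dcoset n r ?lam ?mu w"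
    using double_coset_spec(2)[OF A] by blast
  have wb: "w \<in> BW r" using w(1) double_coset_invariant(1)[OF A] by blast
  have "entry n r f ?lam ?mu z = entry n r f ?lam ?mu w" if z: "z \<in> double_coset n r A" for z
  proof -
    obtain u v where uv: "u \<in> parab r (parab_gens n r ?lam)" "v \<in> parab r (parab_gens n r ?mu)" "z = u \<circ> w \<circ> v"
      using z unfolding w(2) dcoset_iff by blast
    have ub: "u \<circ> w \<in> BW r" using parab_in[OF parab_gens_subset uv(1)] wb by blast
    show ?thesis
      unfolding uv(3) right_invariant_parab[OF parab_gens_subset inv(2) uv(2) ub] by (rule left_invariant_parab[OF parab_gens_subset inv(1) uv(1) wb])
  qed
  then show ?thesis using x y by simp
qed

lemma e_basis_facts:
  assumes "A \<in> Theta n r"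
  shows "e_basis n r A \<in> carrier (schur n r)"
    "\<And>lam mu. lam \<in> Lambda n r \<Longrightarrow> mu \<in> Lambda n r \<Longrightarrow> entry n r (e_basis n r A) lam mu =
      (if lam = row_weight n r A \<and> mu = col_weight n r A then indic (double_coset n r A) else (\<lambda>w. 0))"
  using e_basis_spec[OF row_weight_spec(1) col_weight_spec(1) double_coset_invariant] assms by blast+

lemma norm_basis_closed: "A \<in> Theta n r \<Longrightarrow> norm_basis n r A \<in> carrier (schur n r)"
  unfolding norm_basis_norm_exponent by (intro schur_smult_closed e_basis_facts)

lemma entry_norm_basis:
  assumes "A \<in> Theta n r" "lam \<in> Lambda n r" "mu \<in> Lambda n r"
  shows "entry n r (norm_basis n r A) lam mu w =
    (if lam = row_weight n r A \<and> mu = col_weight n r A \<and> w \<in> double_coset n r A then ups_pow (norm_exponent n r A) else 0)"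
  unfolding norm_basis_norm_exponent using e_basis_facts[OF assms(1)] assms
  by (simp add: entry_smult indic_def)

lemma norm_coord_basis:
  assumes A: "A \<in> Theta n r" and B: "B \<in> Theta n r"
  shows "norm_coord n r A (norm_basis n r B) = (if A = B then 1 else 0)"
proof (cases "A = B")
  case True
  then show ?thesis using row_weight_spec(1)[OF A] col_weight_spec(1)[OF A] coset_point_in[OF A]
    by (simp add: norm_coord_def entry_norm_basis[OF B] ups_pow_inverse)
next
  case False
  note w = row_weight_spec(1)[OF A] col_weight_spec(1)[OF A]
  have "coset_point n r A \<in> BW r" using coset_point_in[OF A] double_coset_invariant(1)[OF A] by blast
  from matrix_of_element[OF w this] have "\<not> (row_weight n r A = row_weight n r B \<and>
      col_weight n r A = col_weight n r B \<and> coset_point n r A \<in> double_coset n r B)"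
    using A B False coset_point_in[OF A] by metis
  then show ?thesis using False
    unfolding norm_coord_def entry_norm_basis[OF B w] by auto
qed

text \<open>At a given \<open>w\<close>, exactly one matrix of row weight \<open>lam\<close> and column weight \<open>mu\<close> contributes to the sum, namely that
  of the double coset of \<open>w\<close>.\<close>

lemma norm_basis_expand:
  assumes f: "f \<in> carrier (schur n r)"
  shows "f = (\<Oplus>\<^bsub>schur n r\<^esub>A\<in>Theta n r. schur_smult n r (norm_coord n r A f) (norm_basis n r A))"
proof (rule schur_eqI_entry[OF f])
  interpret S: ring "schur n r" by (rule schur_ring)
  let ?g = "\<lambda>A. schur_smult n r (norm_coord n r A f) (norm_basis n r A)"
  have g: "?g \<in> Theta n r \<rightarrow> carrier (schur n r)"
    by (auto intro!: schur_smult_closed norm_basis_closed)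
  then show "(\<Oplus>\<^bsub>schur n r\<^esub>A\<in>Theta n r. ?g A) \<in> carrier (schur n r)" by (rule S.finsum_closed)
  fix lam mu assume lam: "lam \<in> Lambda n r" and mu: "mu \<in> Lambda n r"
  show "entry n r f lam mu = entry n r (\<Oplus>\<^bsub>schur n r\<^esub>A\<in>Theta n r. ?g A) lam mu"
    unfolding entry_finsum[OF finite_Theta g lam]
  proof
    fix w
    have t: "entry n r (?g A) lam mu w = (if lam = row_weight n r A \<and> mu = col_weight n r A \<and> w \<in> double_coset n r A
        then entry n r f lam mu w else 0)" if A: "A \<in> Theta n r" for A
    proof -
      have "entry n r f (row_weight n r A) (col_weight n r A) (coset_point n r A) = entry n r f (row_weight n r A) (col_weight n r A) w"
        if "w \<in> double_coset n r A"
        by (rule entry_const_on_double_coset[OF A f coset_point_in[OF A] that])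
      moreover have "ups_pow (- k) * a * ups_pow k = a" for k and a :: laurent
        using ups_pow_inverse[of k] by (metis mult.commute mult.left_commute mult_1)
      ultimately show ?thesis
        using norm_basis_closed[OF A] lam mu
        by (simp add: entry_smult entry_norm_basis[OF A] norm_coord_def)
    qed
    have "(\<Sum>A\<in>Theta n r. entry n r (?g A) lam mu w) = entry n r f lam mu w"
    proof (cases "w \<in> BW r")
      case False
      then have z: "entry n r f lam mu w = 0" using entry_invariant(3)[OF f lam mu] by (simp add: supp_def)
      have "entry n r (?g A) lam mu w = 0" if "A \<in> Theta n r" for A
        unfolding t[OF that] z by (rule if_cancel)
      then show ?thesis unfolding z by (intro sum.neutral ballI)
    next
      case True
      obtain B where B: "B \<in> Theta n r" "row_weight n r B = lam" "col_weight n r B = mu" "w \<in> double_coset n r B"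
        and u: "\<And>A. A \<in> Theta n r \<Longrightarrow> row_weight n r A = lam \<Longrightarrow> col_weight n r A = mu \<Longrightarrow> w \<in> double_coset n r A \<Longrightarrow> A = B"
        using matrix_of_element[OF lam mu True] by metis
      have "(\<Sum>A\<in>Theta n r. entry n r (?g A) lam mu w) = (\<Sum>A\<in>Theta n r. if A = B then entry n r f lam mu w else 0)"
      proof (rule sum.cong[OF refl])
        fix A assume A: "A \<in> Theta n r"
        have c: "lam = row_weight n r A \<and> mu = col_weight n r A \<and> w \<in> double_coset n r A \<longleftrightarrow> A = B"
          using B u[OF A] by metis
        show "entry n r (?g A) lam mu w = (if A = B then entry n r f lam mu w else 0)"
          unfolding t[OF A] c ..
      qed
      then show ?thesis using B(1) finite_Theta[of n r] by simp
    qed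
    then show "entry n r f lam mu w = (\<Sum>A\<in>Theta n r. entry n r (?g A) lam mu w)" by simp
  qed
qed

lemma schur_free_algebra:
  "free_algebra (schur n r) laurent_to_K (schur_smult n r) (Theta n r) (norm_basis n r) (norm_coord n r)"
proof (intro free_algebra.intro free_algebra_axioms.intro schur_ring)
  show "laurent_to_K 1 = (1 :: ratfun)" by (rule laurent_to_K_one)
  fix a b
  show "laurent_to_K (a + b) = laurent_to_K a + laurent_to_K b" by (rule laurent_to_K_add)
  show "laurent_to_K (a * b) = laurent_to_K a * laurent_to_K b" by (rule laurent_to_K_mult)
next
  show "finite (Theta n r)" by (rule finite_Theta)
next
  fix A f g assume A: "A \<in> Theta n r" and fg: "f \<in> carrier (schur n r)" "g \<in> carrier (schur n r)"
  show "norm_coord n r A (f \<oplus>\<^bsub>schur n r\<^esub> g) = norm_coord n r A f + norm_coord n r A g"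
    using entry_add[OF fg row_weight_spec(1)[OF A]] by (simp add: norm_coord_def distrib_left)
next
  fix A f a assume A: "A \<in> Theta n r" and f: "f \<in> carrier (schur n r)"
  show "norm_coord n r A (schur_smult n r a f) = a * norm_coord n r A f"
    using entry_smult[OF f row_weight_spec(1)[OF A]] by (simp add: norm_coord_def mult.left_commute)
qed (simp_all add: schur_smult_closed schur_smult_mult norm_basis_closed norm_coord_basis norm_basis_expand[symmetric])

lemma norm_coord_proj:
  assumes A: "A \<in> Theta n r" and f: "f \<in> carrier (schur n r)" and kap: "kap \<in> Lambda n r"
  shows "norm_coord n r A (proj n r kap \<otimes>\<^bsub>schur n r\<^esub> f) = (if row_weight n r A = kap then norm_coord n r A f else 0)"
    "norm_coord n r A (f \<otimes>\<^bsub>schur n r\<^esub> proj n r kap) = (if col_weight n r A = kap then norm_coord n r A f else 0)"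
  using entry_proj_left[OF kap f row_weight_spec(1)[OF A]]
    entry_proj_right[OF kap f row_weight_spec(1)[OF A] col_weight_spec(1)[OF A]]
  by (simp_all add: norm_coord_def)

theorem lemma3p4:
  fixes n r :: nat
  shows "(\<forall>x :: nat mat \<Rightarrow> ratfun.
            lin_comb n r (Theta n r) x \<in> ring_center (schurK n r) \<longrightarrow>
              (\<forall>A\<in>Theta n r. A \<notin> Omega n r \<longrightarrow> x A = 0))
       \<and> (\<forall>c\<in>ring_center (schurK n r).
            \<exists>!x. x \<in> Omega n r \<rightarrow>\<^sub>E (UNIV :: ratfun set) \<and> c = lin_comb n r (Omega n r) x)"
proof -
  interpret FA: free_algebra "schur n r" laurent_to_K "schur_smult n r" "Theta n r" "norm_basis n r" "norm_coord n r"
    by (rule schur_free_algebra)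
  have comb: "lin_comb n r I x = FA.bc_comb I x" for I x
    by (simp add: lin_comb_def FA.bc_comb_def schurK_def schurK_smult_def norm_basis_K_def schurK_tensor_def)
  have Om: "Omega n r \<subseteq> Theta n r" by (simp add: Omega_def)
  have central: "FA.bc_coord A c = 0"
    if c: "c \<in> ring_center (schurK n r)" and A: "A \<in> Theta n r" "A \<notin> Omega n r" for c A
  proof -
    let ?kap = "row_weight n r A"
    let ?z = "tensor laurent_to_K (schur_smult n r) (schur n r) 1 (proj n r ?kap)"
    have ne: "col_weight n r A \<noteq> ?kap" using A by (auto simp: Omega_iff)
    have kap: "?kap \<in> Lambda n r" by (rule row_weight_spec(1)[OF A(1)])
    have p: "proj n r ?kap \<in> carrier (schur n r)" by (rule proj_closed[OF kap])
    have cc: "c \<in> carrier FA.BC" using c by (simp add: ring_center_def schurK_def)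
    have z: "?z \<in> carrier FA.BC" by (rule FA.tensor_closed[OF p])
    have "c \<otimes>\<^bsub>FA.BC\<^esub> ?z = ?z \<otimes>\<^bsub>FA.BC\<^esub> c"
      using c z by (simp add: ring_center_def schurK_def)
    moreover have "FA.bc_coord A (?z \<otimes>\<^bsub>FA.BC\<^esub> c) = FA.bc_coord A c"
    proof -
      have "FA.bc_coord A (?z \<otimes>\<^bsub>FA.BC\<^esub> c)
          = (\<Sum>B\<in>Theta n r. laurent_to_K (norm_coord n r A (proj n r ?kap \<otimes>\<^bsub>schur n r\<^esub> norm_basis n r B)) * FA.bc_coord B c)"
        using FA.bc_coord_mult_left[OF A(1) p cc, of 1] by simp
      also have "\<dots> = (\<Sum>B\<in>Theta n r. if A = B then FA.bc_coord B c else 0)"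
        by (rule sum.cong)
          (use A(1) kap in \<open>auto simp: norm_coord_proj norm_basis_closed norm_coord_basis FA.phi_one FA.phi_zero\<close>)
      finally show ?thesis using A(1) finite_Theta[of n r] by simp
    qed
    moreover have "FA.bc_coord A (c \<otimes>\<^bsub>FA.BC\<^esub> ?z) = 0"
    proof -
      have "FA.bc_coord A (c \<otimes>\<^bsub>FA.BC\<^esub> ?z)
          = (\<Sum>B\<in>Theta n r. laurent_to_K (norm_coord n r A (norm_basis n r B \<otimes>\<^bsub>schur n r\<^esub> proj n r ?kap)) * FA.bc_coord B c)"
        using FA.bc_coord_mult_right[OF A(1) p cc, of 1] by simp
      also have "\<dots> = (\<Sum>B\<in>Theta n r. 0)"
        by (rule sum.cong)
          (use A(1) kap ne in \<open>auto simp: norm_coord_proj norm_basis_closed FA.phi_zero\<close>)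
      finally show ?thesis by simp
    qed
    ultimately show ?thesis by simp
  qed
  show ?thesis
  proof (intro conjI allI impI ballI)
    fix x A assume x: "lin_comb n r (Theta n r) x \<in> ring_center (schurK n r)" and A: "A \<in> Theta n r" "A \<notin> Omega n r"
    show "x A = 0"
      using central[OF x A] FA.bc_coord_comb[OF order_refl A(1), of x] A(1) unfolding comb by simp
  next
    fix c assume c: "c \<in> ring_center (schurK n r)"
    then have cc: "c \<in> carrier FA.BC" by (simp add: ring_center_def schurK_def)
    let ?x = "\<lambda>A\<in>Omega n r. FA.bc_coord A c"
    show "\<exists>!x. x \<in> Omega n r \<rightarrow>\<^sub>E (UNIV :: ratfun set) \<and> c = lin_comb n r (Omega n r) x"
    proof
      have "FA.bc_coord A (lin_comb n r (Omega n r) ?x) = FA.bc_coord A c" if "A \<in> Theta n r" for A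
        unfolding comb FA.bc_coord_comb[OF Om that] using central[OF c that] by simp
      moreover have cl: "lin_comb n r (Omega n r) ?x \<in> carrier FA.BC"
        unfolding comb FA.bc_comb_alt[OF Om]
        by (rule FA.BC.finsum_closed) (use Om norm_basis_closed in \<open>auto intro!: FA.tensor_closed\<close>)
      ultimately have "FA.bc_comb (Theta n r) (\<lambda>A. FA.bc_coord A (lin_comb n r (Omega n r) ?x))
          = FA.bc_comb (Theta n r) (\<lambda>A. FA.bc_coord A c)"
        unfolding FA.bc_comb_alt[OF order_refl]
        by (intro FA.BC.finsum_cong') (auto intro!: FA.tensor_closed norm_basis_closed)
      then have "c = lin_comb n r (Omega n r) ?x"
        using FA.bc_expand[OF cc] FA.bc_expand[OF cl] by simp
      then show "?x \<in> Omega n r \<rightarrow>\<^sub>E (UNIV :: ratfun set) \<and> c = lin_comb n r (Omega n r) ?x" by simp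
      fix x assume x: "x \<in> Omega n r \<rightarrow>\<^sub>E (UNIV :: ratfun set) \<and> c = lin_comb n r (Omega n r) x"
      show "x = ?x"
      proof (rule PiE_ext[of x "Omega n r" "\<lambda>_. UNIV" ?x])
        fix A assume A: "A \<in> Omega n r"
        then have "FA.bc_coord A c = x A"
          using x FA.bc_coord_comb[OF Om, of A x] Om unfolding comb by auto
        then show "x A = ?x A" using A by simp
      qed (use x in auto)
    qed
  qed
qed

end
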